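(* Let $Y$ be a normal projective variety with class group $\operatorname{Cl}(Y)\cong\mathbf Z$, and let $\mathcal Z=\{(Z_1,\mu_1),\dots,(Z_s,\mu_s)\}$ be a set of prime divisors $Z_i$ of degree $1$ on $Y$ together with corresponding tuples $\mu_i=(\mu_{i1},\dots,\mu_{ir_i})$ of positive integers, such that the integers $\gcd(\mu_i)=\gcd(\mu_{i1},\dots,\mu_{ir_i})$, $1\le i\le s$, are pairwise coprime. Then the ring $A[\mathcal Z]=A[\mathcal D(\mathcal Z)]$ is a normal factorial ring.
   Context: $k$ is an algebraically closed field of characteristic $0$; a variety is a normal integral scheme of finite type over $k$. The degree map $\operatorname{Cl}(Y)\to\mathbf Z$ sends the ample generator to $1$. Set $|\mathcal Z|=\sum_i(r_i-1)$, $N=\mathbf Z^{|\mathcal Z|+1}$, $M=\operatorname{Hom}(N,\mathbf Z)$, $N_{\mathbf Q}=N\otimes\mathbf Q=\mathbf Q^{|\mathcal Z|+1}$. Points $v_{ij}\in N_{\mathbf Q}$ ($1\le i\le s$, $1\le j\le r_i$) are defined by induction on $|\mathcal Z|$: If $|\mathcal Z|=0$, the $\mu_1,\dots,\mu_s$ are positive pairwise coprime integers; one takes integers $e_1,\dots,e_s$ such that $1=\sum_i e_i\mu_i$ and defines $v_{ij}:=\frac{e_i\mu_i}{\mu_1\cdots\mu_s}\in N_{\mathbf Q}$ (here $j=1$ only). If $|\mathcal Z|>0$, there is a $j$ with $r_j>1$. Let $\mathcal Z'$ be obtained from $\mathcal Z$ by replacing $\mu_j$ by $\mu_j'=(\mu_{j1},\dots,\mu_{j\,r_j-2},\gcd(\mu_{j\,r_j-1},\mu_{jr_j}))$.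 By induction one has points $v'_{ik}$ for $\mathcal Z'$, with $v'_{j\,r_j-1}$ corresponding to $\mu'_{j\,r_j-1}=\gcd(\mu_{j\,r_j-1},\mu_{jr_j})$. Choose $\alpha,\beta\in\mathbf Z$ with $\mu'_{j\,r_j-1}=\alpha\mu_{j\,r_j-1}+\beta\mu_{jr_j}$ and put $$v_{j\,r_j-1}=\Big(v'_{j\,r_j-1},-\frac{\beta}{\mu_{j\,r_j-1}}\Big),\qquad v_{jr_j}=\Big(v'_{j\,r_j-1},\frac{\alpha}{\mu_{jr_j}}\Big),$$ and $v_{ik}=(v'_{ik},0)$ for $i\ne j$ or $k<r_j-1$. The polyhedral divisor $\mathcal D(\mathcal Z)=\sum_i\Delta_i\cdot Z_i$ has as tail cone the cone $\sigma\subseteq N_{\mathbf Q}$ spanned by the rays $\mathbf Q_{\ge0}\cdot\sum_iv_{ik_i}$, over all choices $1\le k_i\le r_i$, and $\Delta_i$ is the polyhedron with tail cone $\sigma$ whose vertices are exactly the $v_{ik}$, $1\le k\le r_i$. With $\sigma^\vee$ the dual cone, for $u\in\sigma^\vee\cap M$ put $\mathcal D(u)=\sum_i\min_{v\in\Delta_i}\langle u,v\rangle\cdot Z_i$, and $A[\mathcal D]=\bigoplus_{u\in\sigma^\vee\cap M}H^0(Y,\mathcal O_Y(\lfloor\mathcal D(u)\rfloor))\chi^u$, with multiplication induced from $\bigoplus_uK(Y)\chi^u$.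
   Formalization: In the base case of the v_ij, μ_i is replaced by its cofactor, the product of the other μ_l: 1 = Σ e_i·(cofactor of μ_i) and v_i = e_i/μ_i. As printed, the claim fails, e.g. on P^1 with μ = (2,3,5), e = (-1,1,0), where the class group is Z/5. *)

theory Defs
  imports
    "HOL-Algebra.Algebraic_Closure_Type"
    "HOL-Algebra.Elementary_Groups"
    "HOL-Algebra.Ring_Divisibility"
    "HOL-Computational_Algebra.Fraction_Field"
    "HOL-Library.Poly_Mapping"
begin

section \<open>Subrings of a ring given by a type class\<close>

abbreviation subring_of_type :: "'a::ring_1 set \<Rightarrow> 'a ring"
  where "subring_of_type A \<equiv> ring_of_type_algebra \<lparr>carrier := A\<rparr>"

definition integral_over :: "'a::field set \<Rightarrow> 'a \<Rightarrow> bool"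
  where "integral_over A x \<longleftrightarrow>
    (\<exists>p :: 'a poly. Polynomial.lead_coeff p = 1 \<and> (\<forall>i. Polynomial.coeff p i \<in> A) \<and> poly p x = 0)"

text \<open>A subring \<open>A\<close> of a field is normal if it is integrally closed in its field of fractions,
  which is formed inside the ambient field.\<close>

definition normal_subring :: "'a::field set \<Rightarrow> bool"
  where "normal_subring A \<longleftrightarrow>
    (\<forall>a\<in>A. \<forall>b\<in>A. b \<noteq> 0 \<longrightarrow> integral_over A (a / b) \<longrightarrow> a / b \<in> A)"


section \<open>Polynomials in the variables $x_0,\dots,x_n$\<close>

type_synonym 'k mpolynomial = "(nat \<Rightarrow>\<^sub>0 nat) \<Rightarrow>\<^sub>0 'k"

definition polynomials_upto :: "nat \<Rightarrow> 'k::comm_ring_1 mpolynomial set"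
  where "polynomials_upto n = {F. \<forall>m\<in>Poly_Mapping.keys F. Poly_Mapping.keys m \<subseteq> {..n}}"

definition variable :: "nat \<Rightarrow> 'k::comm_ring_1 mpolynomial"
  where "variable i = Poly_Mapping.single (Poly_Mapping.single i 1) 1"

definition monomial_degree :: "(nat \<Rightarrow>\<^sub>0 nat) \<Rightarrow> nat"
  where "monomial_degree m = (\<Sum>i\<in>Poly_Mapping.keys m. Poly_Mapping.lookup m i)"

definition homogeneous :: "nat \<Rightarrow> 'k::comm_ring_1 mpolynomial \<Rightarrow> bool"
  where "homogeneous d F \<longleftrightarrow> (\<forall>m\<in>Poly_Mapping.keys F. monomial_degree m = d)"

definition homogeneous_component :: "nat \<Rightarrow> 'k::comm_ring_1 mpolynomial \<Rightarrow> 'k mpolynomial"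
  where "homogeneous_component d F =
    (\<Sum>m\<in>{m \<in> Poly_Mapping.keys F. monomial_degree m = d}.
       Poly_Mapping.single m (Poly_Mapping.lookup F m))"

definition homogeneous_set :: "'k::comm_ring_1 mpolynomial set \<Rightarrow> bool"
  where "homogeneous_set I \<longleftrightarrow> (\<forall>F\<in>I. \<forall>d. homogeneous_component d F \<in> I)"

definition evaluate ::
  "('k::comm_ring_1 \<Rightarrow> 'K::comm_ring_1) \<Rightarrow> (nat \<Rightarrow> 'K) \<Rightarrow> 'k mpolynomial \<Rightarrow> 'K"
  where "evaluate \<iota> x F = (\<Sum>m\<in>Poly_Mapping.keys F.
    \<iota> (Poly_Mapping.lookup F m) * (\<Prod>i\<in>Poly_Mapping.keys m. x i ^ Poly_Mapping.lookup m i))"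


section \<open>Projective varieties\<close>

text \<open>
  An integral closed subscheme \<open>Y\<close> of projective \<open>n\<close>-space over \<open>k\<close> is $\mathrm{Proj}\,k[x_0,\dots,x_n]/P$
  for a homogeneous prime ideal \<open>P\<close> that does not contain all the variables, and the quotients
  $x_i/x_j$ are elements of its function field.  A variety is given here together with its function
  field, the type \<open>'K\<close>: \<open>scalar\<close> is the structure map $k \to K(Y)$ and \<open>coord\<close> are
  homogeneous coordinates in $K(Y)$ of the generic point of \<open>Y\<close>.  Then \<open>P\<close> is the homogeneous ideal
  of all polynomials vanishing at that point.  Every homogeneous prime \<open>P\<close> as above arises in this way.
\<close>

record ('k, 'K) proj_scheme =
  scalar :: "'k \<Rightarrow> 'K"
  dim :: nat
  coord :: "nat \<Rightarrow> 'K"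

type_synonym 'k point = "'k mpolynomial set"

definition coordinate_ring :: "('k::field, 'K::field) proj_scheme \<Rightarrow> 'k mpolynomial ring"
  where "coordinate_ring Y = subring_of_type (polynomials_upto (dim Y))"

definition vanishing_ideal :: "('k::field, 'K::field) proj_scheme \<Rightarrow> 'k mpolynomial set"
  where "vanishing_ideal Y = {F \<in> polynomials_upto (dim Y).
    \<forall>d. evaluate (scalar Y) (coord Y) (homogeneous_component d F) = 0}"

text \<open>The (not necessarily closed) points of $\mathrm{Proj}\,k[x_0,\dots,x_n]/P$; the closure of a
  point \<open>q\<close> consists of the points containing \<open>q\<close>.\<close>

definition points :: "('k::field, 'K::field) proj_scheme \<Rightarrow> 'k point set"
  where "points Y = {q. primeideal q (coordinate_ring Y) \<and> homogeneous_set q \<and>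
    vanishing_ideal Y \<subseteq> q \<and> (\<exists>i\<le>dim Y. variable i \<notin> q)}"

definition stalk :: "('k::field, 'K::field) proj_scheme \<Rightarrow> 'k point \<Rightarrow> 'K set"
  where "stalk Y q = {evaluate (scalar Y) (coord Y) F / evaluate (scalar Y) (coord Y) G | F G d.
    F \<in> polynomials_upto (dim Y) \<and> G \<in> polynomials_upto (dim Y) \<and>
    homogeneous d F \<and> homogeneous d G \<and> G \<notin> q}"

text \<open>The last condition says that the local ring at the generic point is all of \<open>'K\<close>, i.e. that
  \<open>'K\<close> is the function field and not a proper extension of it.\<close>

definition projective_integral :: "('k::field, 'K::field) proj_scheme \<Rightarrow> bool"
  where "projective_integral Y \<longleftrightarrow>
    scalar Y \<in> ring_hom ring_of_type_algebra ring_of_type_algebra \<and>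
    (\<exists>i\<le>dim Y. coord Y i \<noteq> 0) \<and> stalk Y (vanishing_ideal Y) = UNIV"

definition normal_projective_variety :: "('k::field, 'K::field) proj_scheme \<Rightarrow> bool"
  where "normal_projective_variety Y \<longleftrightarrow>
    projective_integral Y \<and> (\<forall>q\<in>points Y. normal_subring (stalk Y q))"


section \<open>Weil divisors\<close>

text \<open>A prime divisor is represented by its generic point, a point of codimension one.\<close>

definition prime_divisors :: "('k::field, 'K::field) proj_scheme \<Rightarrow> 'k point set"
  where "prime_divisors Y = {q \<in> points Y. q \<noteq> vanishing_ideal Y \<and>
    \<not> (\<exists>r\<in>points Y. vanishing_ideal Y \<subset> r \<and> r \<subset> q)}"

text \<open>On a normal variety the local ring \<open>R\<close> at a prime divisor is a discrete valuation ring: its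
  set of non-units, the maximal ideal, is generated by one element.\<close>

definition is_unit_in :: "'K::field set \<Rightarrow> 'K \<Rightarrow> bool"
  where "is_unit_in R a \<longleftrightarrow> a \<noteq> 0 \<and> a \<in> R \<and> inverse a \<in> R"

definition uniformizer :: "'K::field set \<Rightarrow> 'K \<Rightarrow> bool"
  where "uniformizer R t \<longleftrightarrow> {a \<in> R. \<not> is_unit_in R a} = {t * a | a. a \<in> R}"

definition ord_at :: "('k::field, 'K::field) proj_scheme \<Rightarrow> 'k point \<Rightarrow> 'K \<Rightarrow> int"
  where "ord_at Y W f = (THE m. \<exists>t a. uniformizer (stalk Y W) t \<and> is_unit_in (stalk Y W) a \<and>
    f = a * t powi m)"

definition div_group :: "('k::field, 'K::field) proj_scheme \<Rightarrow> ('k point \<Rightarrow> int) monoid"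
  where "div_group Y = \<lparr>carrier = {D. finite {W. D W \<noteq> 0} \<and> {W. D W \<noteq> 0} \<subseteq> prime_divisors Y},
    monoid.mult = (\<lambda>D E W. D W + E W), one = (\<lambda>W. 0)\<rparr>"

definition div_of :: "('k::field, 'K::field) proj_scheme \<Rightarrow> 'K \<Rightarrow> 'k point \<Rightarrow> int"
  where "div_of Y f = (\<lambda>W. if W \<in> prime_divisors Y then ord_at Y W f else 0)"

definition principal_divisors :: "('k::field, 'K::field) proj_scheme \<Rightarrow> ('k point \<Rightarrow> int) set"
  where "principal_divisors Y = {div_of Y f | f. f \<noteq> 0}"

definition class_group :: "('k::field, 'K::field) proj_scheme \<Rightarrow> ('k point \<Rightarrow> int) set monoid"
  where "class_group Y = div_group Y Mod principal_divisors Y"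

definition divisor_class ::
  "('k::field, 'K::field) proj_scheme \<Rightarrow> ('k point \<Rightarrow> int) \<Rightarrow> ('k point \<Rightarrow> int) set"
  where "divisor_class Y D = principal_divisors Y #>\<^bsub>div_group Y\<^esub> D"

definition prime_divisor :: "'k point \<Rightarrow> 'k point \<Rightarrow> int"
  where "prime_divisor W = (\<lambda>V. if V = W then 1 else 0)"

text \<open>$H^0(Y, \mathcal O_Y(D))$ for a Weil divisor \<open>D\<close>, as a subset of the function field.\<close>

definition global_sections ::
  "('k::field, 'K::field) proj_scheme \<Rightarrow> ('k point \<Rightarrow> int) \<Rightarrow> 'K set"
  where "global_sections Y D = {f. f = 0 \<or> (\<forall>W\<in>prime_divisors Y. ord_at Y W f + D W \<ge> 0)}"

text \<open>
  \<open>D\<close> is very ample if there are sections $f_0,\dots,f_N$ of $\mathcal O_Y(D)$ that generate it at every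
  point (so that \<open>D\<close> is Cartier, with local equation $1/f_j$) and such that the morphism
  $(f_0:\dots:f_N)$ from \<open>Y\<close> to projective \<open>N\<close>-space is a closed embedding.  The point
  $(f_0:\dots:f_N)$ over \<open>'K\<close> is the generic point of the image.  The morphism is a closed
  embedding iff the image has the same local rings as \<open>Y\<close>, as subrings of \<open>'K\<close>: a model of a
  function field is determined by its set of local rings.
\<close>

definition very_ample :: "('k::field, 'K::field) proj_scheme \<Rightarrow> ('k point \<Rightarrow> int) \<Rightarrow> bool"
  where "very_ample Y D \<longleftrightarrow> (\<exists>N f.
    (\<forall>j\<le>N. f j \<in> global_sections Y D) \<and>
    (\<forall>q\<in>points Y. \<exists>j\<le>N. f j \<noteq> 0 \<and>
       (\<forall>W\<in>prime_divisors Y. W \<subseteq> q \<longrightarrow> ord_at Y W (f j) + D W = 0)) \<and>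
    (let Y' = Y\<lparr>dim := N, coord := f\<rparr> in stalk Y' ` points Y' = stalk Y ` points Y))"

definition ample :: "('k::field, 'K::field) proj_scheme \<Rightarrow> ('k point \<Rightarrow> int) \<Rightarrow> bool"
  where "ample Y D \<longleftrightarrow> (\<exists>m::nat. m > 0 \<and> very_ample Y (\<lambda>W. int m * D W))"

text \<open>The existence of a degree map contains the hypothesis $\mathrm{Cl}(Y)\cong\mathbf Z$.\<close>

definition degree_map ::
  "('k::field, 'K::field) proj_scheme \<Rightarrow> (('k point \<Rightarrow> int) set \<Rightarrow> int) \<Rightarrow> bool"
  where "degree_map Y \<delta> \<longleftrightarrow> \<delta> \<in> iso (class_group Y) integer_group \<and>
    (\<exists>H \<in> carrier (div_group Y). ample Y H \<and> \<delta> (divisor_class Y H) = 1)"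


section \<open>The points $v_{ij}$\<close>

text \<open>
  The tuples $\mu_1,\dots,\mu_s$ form a list of lists, and all indices start at 0.  A vector of
  $\mathbf Q^d$ is a function \<open>nat \<Rightarrow> rat\<close> that vanishes outside \<open>{..<d}\<close>, so the vector
  $(v, x)$ with $v \in \mathbf Q^d$ is \<open>v(d := x)\<close>.
\<close>

type_synonym vec = "nat \<Rightarrow> rat"

definition excess :: "nat list list \<Rightarrow> nat"
  where "excess mu = (\<Sum>i<length mu. length (mu ! i) - 1)"

definition cofactor :: "nat list list \<Rightarrow> nat \<Rightarrow> nat"
  where "cofactor mu i = (\<Prod>l\<in>{..<length mu} - {i}. mu ! l ! 0)"

text \<open>
  All families $(v_{ij})$ that arise from some choice of the integers $e_i$ in the base case and of
  \<open>j\<close>, $\alpha$, $\beta$ in the inductive steps.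

  The base case uses $1 = \sum_i e_i\hat\mu_i$ and $v_{i1} = e_i\hat\mu_i/(\mu_1\cdots\mu_s) = e_i/\mu_i$
  where $\hat\mu_i = \prod_{l \ne i}\mu_l$ is the cofactor of $\mu_i$.  With $\mu_i$ in place of
  $\hat\mu_i$ there would be no $e_1$ for $s = 1$, $\mu_1 > 1$, and the associated ring would not be
  factorial in general: on the projective line, $\mu = (2,3,5)$, $e = (-1,1,0)$ would give
  $v = (-1/15, 1/10, 0)$ and the affine cone over the rational normal curve of degree 5.
\<close>

inductive vertex_family :: "nat list list \<Rightarrow> (nat \<Rightarrow> nat \<Rightarrow> vec) \<Rightarrow> bool"
  where
    base: "vertex_family mu v"
      if "\<forall>i<length mu. length (mu ! i) = 1"
        and "(\<Sum>i<length mu. e i * int (cofactor mu i)) = 1"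
        and "\<forall>i<length mu. v i 0 =
          (\<lambda>n. if n = 0 then of_int (e i * int (cofactor mu i)) / of_nat (\<Prod>l<length mu. mu ! l ! 0)
            else 0)"
  | step: "vertex_family mu v"
      if "j < length mu"
        and "mu ! j = ms @ [a, b]"
        and "vertex_family (mu[j := ms @ [gcd a b]]) v'"
        and "int (gcd a b) = \<alpha> * int a + \<beta> * int b"
        and "d = excess mu"
        and "v j (length ms) = (v' j (length ms))(d := - of_int \<beta> / of_nat a)"
        and "v j (Suc (length ms)) = (v' j (length ms))(d := of_int \<alpha> / of_nat b)"
        and "\<forall>i<length mu. \<forall>k<length (mu ! i). i \<noteq> j \<or> k < length ms \<longrightarrow> v i k = (v' i k)(d := 0)"


section \<open>The polyhedral divisor and its ring\<close>

definition cone_over :: "vec set \<Rightarrow> vec set"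
  where "cone_over S = {\<lambda>n. \<Sum>g\<in>F. c g * g n | F c. finite F \<and> F \<subseteq> S \<and> (\<forall>g\<in>F. 0 \<le> c g)}"

definition rational_convex_hull :: "vec set \<Rightarrow> vec set"
  where "rational_convex_hull S = {\<lambda>n. \<Sum>g\<in>F. c g * g n | F c.
    finite F \<and> F \<subseteq> S \<and> (\<forall>g\<in>F. 0 \<le> c g) \<and> sum c F = 1}"

definition tail_cone :: "nat list list \<Rightarrow> (nat \<Rightarrow> nat \<Rightarrow> vec) \<Rightarrow> vec set"
  where "tail_cone mu v = cone_over
    {\<lambda>n. \<Sum>i<length mu. v i (\<kappa> i) n | \<kappa>. \<forall>i<length mu. \<kappa> i < length (mu ! i)}"

text \<open>The polyhedron $\Delta_i$ with the given vertices and tail cone, as the Minkowski sum of the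
  convex hull of the vertices and the tail cone.\<close>

definition coefficient_polyhedron ::
  "nat list list \<Rightarrow> (nat \<Rightarrow> nat \<Rightarrow> vec) \<Rightarrow> nat \<Rightarrow> vec set"
  where "coefficient_polyhedron mu v i = {\<lambda>n. x n + y n | x y.
    x \<in> rational_convex_hull (v i ` {..<length (mu ! i)}) \<and> y \<in> tail_cone mu v}"

text \<open>Elements of \<open>M\<close> are finitely supported integer vectors; \<open>weights\<close> is $\sigma^\vee\cap M$.\<close>

definition pairing :: "(nat \<Rightarrow>\<^sub>0 int) \<Rightarrow> vec \<Rightarrow> rat"
  where "pairing u x = (\<Sum>n\<in>Poly_Mapping.keys u. of_int (Poly_Mapping.lookup u n) * x n)"

definition weights :: "nat list list \<Rightarrow> (nat \<Rightarrow> nat \<Rightarrow> vec) \<Rightarrow> (nat \<Rightarrow>\<^sub>0 int) set"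
  where "weights mu v = {u. Poly_Mapping.keys u \<subseteq> {..<excess mu + 1} \<and>
    (\<forall>x\<in>tail_cone mu v. 0 \<le> pairing u x)}"

text \<open>The set \<open>{(Z\<^sub>1,\<mu>\<^sub>1),\<dots>,(Z\<^sub>s,\<mu>\<^sub>s)}\<close> is given as a list of pairs.  \<open>LEAST\<close> is the
  minimum of the linear form \<open>u\<close> on the polyhedron, which exists for \<open>u\<close> in the dual cone.\<close>

definition polyhedral_eval ::
  "('k point \<times> nat list) list \<Rightarrow> (nat \<Rightarrow> nat \<Rightarrow> vec) \<Rightarrow> (nat \<Rightarrow>\<^sub>0 int) \<Rightarrow> 'k point \<Rightarrow> rat"
  where "polyhedral_eval Z v u = (\<lambda>W. \<Sum>i<length Z.
    (LEAST t. t \<in> pairing u ` coefficient_polyhedron (map snd Z) v i) *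
    (if W = fst (Z ! i) then 1 else 0))"

text \<open>$A[\mathcal Z]$ as a subring of the group algebra $\bigoplus_u K(Y)\chi^u$, whose
  multiplication is that of the type \<open>(nat \<Rightarrow>\<^sub>0 int) \<Rightarrow>\<^sub>0 'K\<close>.\<close>

definition polyhedral_ring :: "('k::field, 'K::field) proj_scheme \<Rightarrow>
    ('k point \<times> nat list) list \<Rightarrow> (nat \<Rightarrow> nat \<Rightarrow> vec) \<Rightarrow> ((nat \<Rightarrow>\<^sub>0 int) \<Rightarrow>\<^sub>0 'K) set"
  where "polyhedral_ring Y Z v = {a. \<forall>u\<in>Poly_Mapping.keys a. u \<in> weights (map snd Z) v \<and>
    Poly_Mapping.lookup a u \<in> global_sections Y (\<lambda>W. \<lfloor>polyhedral_eval Z v u W\<rfloor>)}"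

end

theory Submission
  imports Defs
begin

text \<open>
  For a vertex $v_{ik}$ of $\Delta_i$ let $\nu_{ik}(f\chi^u) = \mu_{ik}(\mathrm{ord}_{Z_i}(f) + \langle u, v_{ik}\rangle)$,
  and extend it, as well as $\mathrm{ord}_W$ for the prime divisors \<open>W\<close> not among the $Z_i$, to Laurent
  polynomials over $K(Y)$ by taking minima.  Then $A[\mathcal Z]$ is the subring of $K(Y)[M]$ on which all
  these valuations are non-negative; the condition $u \in \sigma^\vee$ holds automatically, because a divisor with a
  non-zero section has non-negative degree.  The map
  $(a, u) \mapsto (\mu_{ik}(a_i + \langle u, v_{ik}\rangle), \sum_i a_i)$ from $\mathbf Z^s \times M$ is integral
  and surjective, by induction along the construction of the vertices, and divisors of degree 0 are principal.
  So each of the valuations has a homogeneous unit of $K(Y)[M]$ on which it takes the value 1 while all the others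
  vanish.  These units are prime elements of $A[\mathcal Z]$, and stripping them off reduces factorization in $A[\mathcal Z]$ to
  factorization in $K(Y)[M]$, which is factorial by Gauss's lemma.  Factorial rings are normal.

  On the side of \<open>Y\<close>, everything rests on one fact: an element \<open>y\<close> of $K(Y)$ that is not in a graded localization \<open>R\<close>
  of the coordinate ring has a pole along some prime divisor, namely at a maximal one among the ideals \<open>(R : ry)\<close>.
  Applied to the local ring at a prime divisor, it gives the valuation $\mathrm{ord}_W$; applied to the standard charts,
  it shows that a function without poles is algebraic over \<open>k\<close>, and hence that its divisor is 0.
\<close>

section \<open>Factorization in subrings of an integral domain\<close>

text \<open>The delicate point is a homogeneous unit dual to a given valuation. A function
  \<open>f\<close> with prescribed orders exists as soon as they form a divisor of degree 0, so the
  values at the vertices and the sum of the orders along the $Z_i$ have to be prescribed at the same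
  time: the sum must offset a prime divisor outside the $Z_i$, whose degree may be any positive
  integer. The lattices on both sides of the resulting map have the same rank, so nothing can be
  spared: the vertices are constructed to make it unimodular.

  Positivity of degrees is not contained in the notion of a degree map, which only sends some ample
  class to 1. A divisor of negative degree with a section is raised to degree 0 with the help of
  sections of a multiple of that class. Finiteness of the support of a principal divisor has the
  same source, since the zeros of a section are bounded in number by the degree.

  Factorization into primes or units is used rather than factorization into irreducible elements:
  uniqueness is then automatic, and only divisibility has to be followed through polynomial rings,
  Laurent polynomials and the subring cut out by the valuations.\<close>

locale type_subring =
  fixes A :: "'a::idom set"
  assumes one_mem [simp, intro]: "1 \<in> A"
    and diff_mem [simp, intro]: "x \<in> A \<Longrightarrow> y \<in> A \<Longrightarrow> x - y \<in> A"
    and mult_mem [simp, intro]: "x \<in> A \<Longrightarrow> y \<in> A \<Longrightarrow> x * y \<in> A"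
begin

lemma zero_mem [simp, intro]: "0 \<in> A"
  using diff_mem[OF one_mem one_mem] by simp

lemma uminus_mem [simp, intro]: "x \<in> A \<Longrightarrow> - x \<in> A"
  using diff_mem[of 0 x] by simp

lemma add_mem [simp, intro]: "x \<in> A \<Longrightarrow> y \<in> A \<Longrightarrow> x + y \<in> A"
  using diff_mem[of x "- y"] by simp

lemma power_mem [simp, intro]: "x \<in> A \<Longrightarrow> x ^ n \<in> A"
  by (induction n) auto

lemma sum_mem [intro]: "(\<And>i. i \<in> I \<Longrightarrow> f i \<in> A) \<Longrightarrow> sum f I \<in> A"
  by (induction I rule: infinite_finite_induct) auto

lemma prod_mem [intro]: "(\<And>i. i \<in> I \<Longrightarrow> f i \<in> A) \<Longrightarrow> prod f I \<in> A"
  by (induction I rule: infinite_finite_induct) auto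

lemma prod_list_mem [intro]: "set xs \<subseteq> A \<Longrightarrow> prod_list xs \<in> A"
  by (induction xs) auto

end

section \<open>Divisibility and prime elements relative to a subring\<close>

definition dvd_in :: "'a::idom set \<Rightarrow> 'a \<Rightarrow> 'a \<Rightarrow> bool"
  where "dvd_in A a b \<longleftrightarrow> (\<exists>c\<in>A. b = a * c)"

definition prime_or_unit_in :: "'a::idom set \<Rightarrow> 'a \<Rightarrow> bool"
  where "prime_or_unit_in A p \<longleftrightarrow> p \<in> A \<and> p \<noteq> 0 \<and>
    (\<forall>x\<in>A. \<forall>y\<in>A. dvd_in A p (x * y) \<longrightarrow> dvd_in A p x \<or> dvd_in A p y)"

definition factorial_subring :: "'a::idom set \<Rightarrow> bool"
  where "factorial_subring A \<longleftrightarrow>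
    (\<forall>a\<in>A. a \<noteq> 0 \<longrightarrow> (\<exists>ps. set ps \<subseteq> {p. prime_or_unit_in A p} \<and> a = prod_list ps))"

lemma factorial_subringE:
  assumes "factorial_subring A" "a \<in> A" "a \<noteq> 0"
  obtains ps where "set ps \<subseteq> {p. prime_or_unit_in A p}" "a = prod_list ps"
  using assms unfolding factorial_subring_def by blast

lemma prime_or_unit_inD:
  assumes "prime_or_unit_in A p"
  shows "p \<in> A" "p \<noteq> 0"
    and "x \<in> A \<Longrightarrow> y \<in> A \<Longrightarrow> dvd_in A p (x * y) \<Longrightarrow> dvd_in A p x \<or> dvd_in A p y"
  using assms unfolding prime_or_unit_in_def by blast+

context type_subring
begin

lemma dvd_in_mult_right: "dvd_in A a b \<Longrightarrow> c \<in> A \<Longrightarrow> dvd_in A a (b * c)"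
  unfolding dvd_in_def by (metis mult.assoc mult_mem)

lemma dvd_in_mult_left: "dvd_in A a b \<Longrightarrow> c \<in> A \<Longrightarrow> dvd_in A a (c * b)"
  using dvd_in_mult_right[of a b c] by (simp add: mult.commute)

lemma dvd_in_add: "dvd_in A a b \<Longrightarrow> dvd_in A a c \<Longrightarrow> dvd_in A a (b + c)"
  unfolding dvd_in_def by (metis add_mem distrib_left)

lemma dvd_in_diff: "dvd_in A a b \<Longrightarrow> dvd_in A a c \<Longrightarrow> dvd_in A a (b - c)"
  unfolding dvd_in_def by (metis diff_mem right_diff_distrib)

lemma dvd_in_zero [simp]: "dvd_in A a 0"
  unfolding dvd_in_def by force

lemma dvd_in_refl [simp]: "dvd_in A a a"
  unfolding dvd_in_def by force

lemma dvd_in_trans: "dvd_in A a b \<Longrightarrow> dvd_in A b c \<Longrightarrow> dvd_in A a c"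
  unfolding dvd_in_def by (metis mult.assoc mult_mem)

lemma dvd_in_sum: "(\<And>i. i \<in> I \<Longrightarrow> dvd_in A a (f i)) \<Longrightarrow> dvd_in A a (sum f I)"
  by (induction I rule: infinite_finite_induct) (auto intro: dvd_in_add)

lemma dvd_in_one_mult: "dvd_in A (a * b) 1 \<Longrightarrow> b \<in> A \<Longrightarrow> dvd_in A a 1"
  unfolding dvd_in_def by (metis mult.assoc mult_mem)

lemma prime_or_unit_if_unit:
  assumes "u \<in> A" "w \<in> A" "u * w = 1"
  shows "prime_or_unit_in A u"
proof -
  have "dvd_in A u x" if "x \<in> A" for x
    unfolding dvd_in_def using assms that by (metis mult.assoc mult.left_neutral mult_mem)
  then show ?thesis
    using assms unfolding prime_or_unit_in_def by auto
qed

lemma prime_or_unit_dvd_power: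
  assumes p: "prime_or_unit_in A p" and "x \<in> A" "dvd_in A p (x ^ n)" "n > 0"
  shows "dvd_in A p x"
  using assms(3,4)
proof (induction n)
  case (Suc n)
  show ?case
  proof (cases "n = 0")
    case True
    then show ?thesis using Suc by simp
  next
    case False
    then show ?thesis
      using Suc prime_or_unit_inD(3)[OF p \<open>x \<in> A\<close>, of "x ^ n"] \<open>x \<in> A\<close> by auto
  qed
qed simp

lemma prime_or_unit_dvd_prod_list:
  assumes p: "prime_or_unit_in A p" and "set ds \<subseteq> A" "dvd_in A p (prod_list ds)" "ds \<noteq> []"
  shows "\<exists>d\<in>set ds. dvd_in A p d"
  using assms(2-4)
proof (induction ds)
  case (Cons d ds)
  show ?case
  proof (cases "ds = []")
    case True
    then show ?thesis using Cons by simp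
  next
    case False
    have "prod_list ds \<in> A"
      using Cons.prems by auto
    then show ?thesis
      using Cons False prime_or_unit_inD(3)[OF p, of d "prod_list ds"] by auto
  qed
qed simp

text \<open>The factor \<open>p\<close> divides one of the \<open>ds\<close>. Cancelling it leaves a
  cofactor that may be a unit; merging this cofactor with another entry keeps all entries nonunits
  and shortens the list by one. The bound replaces a gcd in the construction of contents.\<close>

lemma nonunit_list_length_le:
  assumes "set ps \<subseteq> {p. prime_or_unit_in A p}" "set ds \<subseteq> A" "\<forall>d\<in>set ds. \<not> dvd_in A d 1"
    and "prod_list ds = prod_list ps"
  shows "length ds \<le> length ps"
  using assms
proof (induction ps arbitrary: ds)
  case Nil
  show ?case
  proof (cases ds)
    case (Cons d ds')
    then have "dvd_in A d 1"
      using Nil unfolding dvd_in_def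
      by (metis list.set_intros(2) prod_list.Cons prod_list.Nil prod_list_mem set_subset_Cons subset_trans)
    then show ?thesis using Nil Cons by simp
  qed simp
next
  case (Cons p ps)
  have p: "prime_or_unit_in A p" and ps: "set ps \<subseteq> {p. prime_or_unit_in A p}"
    using Cons.prems by auto
  have psA: "prod_list ps \<in> A"
    using ps by (intro prod_list_mem) (auto simp: prime_or_unit_in_def)
  show ?case
  proof (cases "ds = []")
    case False
    have "dvd_in A p (prod_list ds)"
      unfolding dvd_in_def using Cons.prems(4) psA by auto
    then obtain d where d: "d \<in> set ds" "dvd_in A p d"
      using prime_or_unit_dvd_prod_list[OF p Cons.prems(2) _ False] by blast
    then obtain e where e: "e \<in> A" "d = p * e"
      unfolding dvd_in_def by blast
    obtain xs ys where ds: "ds = xs @ d # ys"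
      using d(1) by (meson split_list)
    have "p * (e * prod_list (xs @ ys)) = p * prod_list ps"
      using Cons.prems(4) by (simp add: ds e algebra_simps)
    then have eq: "e * prod_list (xs @ ys) = prod_list ps"
      using prime_or_unit_inD(2)[OF p] by simp
    show ?thesis
    proof (cases "xs @ ys")
      case Nil
      then show ?thesis using ds by simp
    next
      case (Cons z zs)
      have z: "z \<in> set ds" "set zs \<subseteq> set ds"
        using arg_cong[OF Cons, of set] ds by auto
      have "length ((e * z) # zs) \<le> length ps"
      proof (rule Cons.IH[OF ps])
        show "set (e * z # zs) \<subseteq> A"
          using z e Cons.prems(2) by auto
        show "\<forall>d\<in>set (e * z # zs). \<not> dvd_in A d 1"
          using z Cons.prems(2,3) e dvd_in_one_mult[of z e] by (auto simp: mult.commute)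
        show "prod_list (e * z # zs) = prod_list ps"
          using eq Cons by (simp add: mult.assoc)
      qed
      moreover have "length ds = length (xs @ ys) + 1"
        using ds by simp
      ultimately show ?thesis using Cons by simp
    qed
  qed simp
qed

text \<open>The equation is homogeneous in \<open>a\<close> and \<open>b\<close>. A prime factor
  \<open>p\<close> of \<open>b\<close> divides every summand on the right, hence
  \<open>a ^ n\<close> and \<open>a\<close>. Dividing both \<open>a\<close> and \<open>b\<close> by
  \<open>p\<close> keeps the shape of the equation, so all factors of \<open>b\<close> can be
  removed in turn.\<close>

lemma factorial_subring_integrally_closed:
  assumes fact: "factorial_subring A" and "a \<in> A" "b \<in> A" "b \<noteq> 0" "\<And>i. c i \<in> A"
    and "a ^ n = (\<Sum>i<n. c i * a ^ i * b ^ (n - i))"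
  shows "dvd_in A b a"
proof -
  obtain ps where ps: "set ps \<subseteq> {p. prime_or_unit_in A p}" "b = prod_list ps"
    using factorial_subringE[OF fact \<open>b \<in> A\<close> \<open>b \<noteq> 0\<close>] .
  have n: "n > 0"
    using assms(6) by (cases n) auto
  have "dvd_in A (prod_list ps) a"
    if "a \<in> A" "a ^ n = (\<Sum>i<n. c i * a ^ i * prod_list ps ^ (n - i))" for a
    using ps(1) that
  proof (induction ps arbitrary: a)
    case Nil
    then show ?case by (auto simp: dvd_in_def)
  next
    case (Cons p ps)
    have p: "prime_or_unit_in A p" "p \<in> A" "p \<noteq> 0" and psA: "prod_list ps \<in> A"
      using Cons.prems(1) by (auto simp: prime_or_unit_in_def intro!: prod_list_mem)
    have "dvd_in A p (a ^ n)"
      unfolding Cons.prems(3)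
    proof (rule dvd_in_sum)
      fix i assume "i \<in> {..<n}"
      then obtain k where k: "n - i = Suc k"
        by (metis Suc_diff_Suc lessThan_iff)
      have "c i * a ^ i * prod_list (p # ps) ^ (n - i)
          = p * (c i * a ^ i * prod_list ps * (p * prod_list ps) ^ k)"
        by (simp add: k algebra_simps)
      moreover have "c i * a ^ i * prod_list ps * (p * prod_list ps) ^ k \<in> A"
        using assms(5) Cons.prems p psA by auto
      ultimately show "dvd_in A p (c i * a ^ i * prod_list (p # ps) ^ (n - i))"
        unfolding dvd_in_def by blast
    qed
    then obtain a' where a': "a' \<in> A" "a = p * a'"
      using prime_or_unit_dvd_power[OF p(1) Cons.prems(2) _ n] unfolding dvd_in_def by blast
    have "p ^ n * a' ^ n = (\<Sum>i<n. p ^ n * (c i * a' ^ i * prod_list ps ^ (n - i)))"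
      using Cons.prems(3) unfolding a'(2)
      by (auto simp: power_mult_distrib algebra_simps power_add[symmetric] intro!: sum.cong)
    then have "a' ^ n = (\<Sum>i<n. c i * a' ^ i * prod_list ps ^ (n - i))"
      using p(3) by (simp add: sum_distrib_left[symmetric])
    then have "dvd_in A (prod_list ps) a'"
      using Cons a' by simp
    then show ?case
      unfolding a'(2) dvd_in_def by (auto simp: mult.assoc)
  qed
  then show ?thesis using assms ps by simp
qed

end

subsection \<open>Gauss's lemma\<close>

definition polys_over :: "'a::idom set \<Rightarrow> 'a poly set"
  where "polys_over A = {f. \<forall>i. Polynomial.coeff f i \<in> A}"

context type_subring
begin

lemma type_subring_polys_over: "type_subring (polys_over A)"
proof
  show "1 \<in> polys_over A"
    unfolding polys_over_def by (simp add: Polynomial.coeff_1)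
  show "x - y \<in> polys_over A" if "x \<in> polys_over A" "y \<in> polys_over A" for x y
    using that unfolding polys_over_def by simp
  show "x * y \<in> polys_over A" if "x \<in> polys_over A" "y \<in> polys_over A" for x y
    using that unfolding polys_over_def by (auto simp: Polynomial.coeff_mult)
qed

lemma const_mem_polys_over [simp]: "[:c:] \<in> polys_over A \<longleftrightarrow> c \<in> A"
  unfolding polys_over_def by (auto simp: Polynomial.coeff_pCons split: nat.splits dest: spec[of _ 0])

lemma monom_mem_polys_over: "c \<in> A \<Longrightarrow> Polynomial.monom c n \<in> polys_over A"
  unfolding polys_over_def by simp

lemma smult_mem_polys_over: "c \<in> A \<Longrightarrow> f \<in> polys_over A \<Longrightarrow> Polynomial.smult c f \<in> polys_over A"
  unfolding polys_over_def by simp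

lemma dvd_in_const_iff:
  "dvd_in (polys_over A) [:c:] f \<longleftrightarrow> (\<forall>i. dvd_in A c (Polynomial.coeff f i))"
proof
  assume "dvd_in (polys_over A) [:c:] f"
  then show "\<forall>i. dvd_in A c (Polynomial.coeff f i)"
    unfolding dvd_in_def polys_over_def by auto
next
  assume "\<forall>i. dvd_in A c (Polynomial.coeff f i)"
  then obtain g where g: "\<And>i. g i \<in> A" "\<And>i. Polynomial.coeff f i = c * g i"
    unfolding dvd_in_def by metis
  define h where "h = (\<Sum>i\<le>Polynomial.degree f. Polynomial.monom (g i) i)"
  interpret P: type_subring "polys_over A"
    by (rule type_subring_polys_over)
  have "h \<in> polys_over A"
    unfolding h_def using g(1) by (intro P.sum_mem monom_mem_polys_over)
  moreover have "f = [:c:] * h"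
  proof -
    have "f = (\<Sum>i\<le>Polynomial.degree f. Polynomial.monom (Polynomial.coeff f i) i)"
      by (simp add: poly_as_sum_of_monoms)
    also have "\<dots> = [:c:] * h"
      unfolding h_def sum_distrib_left by (intro sum.cong) (simp_all add: g(2) smult_monom)
    finally show ?thesis .
  qed
  ultimately show "dvd_in (polys_over A) [:c:] f"
    unfolding dvd_in_def by blast
qed

text \<open>If \<open>p\<close> divides neither polynomial, look at the first coefficient of each
  that is not divisible by \<open>p\<close>. In the product, the coefficient at the sum of these two
  indices has exactly one summand that is not a multiple of \<open>p\<close>.\<close>

lemma prime_or_unit_const:
  assumes p: "prime_or_unit_in A p"
  shows "prime_or_unit_in (polys_over A) [:p:]"
  unfolding prime_or_unit_in_def
proof (intro conjI ballI impI)
  show "[:p:] \<in> polys_over A" "[:p:] \<noteq> 0"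
    using prime_or_unit_inD[OF p] by auto
  fix f g assume f: "f \<in> polys_over A" and g: "g \<in> polys_over A"
    and dvd: "dvd_in (polys_over A) [:p:] (f * g)"
  show "dvd_in (polys_over A) [:p:] f \<or> dvd_in (polys_over A) [:p:] g"
  proof (rule ccontr)
    let ?D = "\<lambda>h i. dvd_in A p (Polynomial.coeff h i)"
    assume "\<not> ?thesis"
    then obtain i0 j0 where i0: "\<not> ?D f i0" and j0: "\<not> ?D g j0"
      unfolding dvd_in_const_iff by blast
    define i where "i = (LEAST i. \<not> ?D f i)"
    define j where "j = (LEAST j. \<not> ?D g j)"
    have i: "\<not> ?D f i" "\<And>k. k < i \<Longrightarrow> ?D f k"
      unfolding i_def using LeastI[of "\<lambda>i. \<not> ?D f i", OF i0] not_less_Least[of _ "\<lambda>i. \<not> ?D f i"] by blast+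
    have j: "\<not> ?D g j" "\<And>k. k < j \<Longrightarrow> ?D g k"
      unfolding j_def using LeastI[of "\<lambda>j. \<not> ?D g j", OF j0] not_less_Least[of _ "\<lambda>i. \<not> ?D g i"] by blast+
    have fA: "\<And>k. Polynomial.coeff f k \<in> A" and gA: "\<And>k. Polynomial.coeff g k \<in> A"
      using f g unfolding polys_over_def by auto
    have fg: "?D (f * g) (i + j)"
      using dvd unfolding dvd_in_const_iff by blast
    have split: "Polynomial.coeff (f * g) (i + j) = Polynomial.coeff f i * Polynomial.coeff g j +
        (\<Sum>k\<in>{..i + j} - {i}. Polynomial.coeff f k * Polynomial.coeff g (i + j - k))"
      unfolding Polynomial.coeff_mult by (subst sum.remove[of "{..i + j}" i]) simp_all
    have rest: "dvd_in A p (\<Sum>k\<in>{..i + j} - {i}. Polynomial.coeff f k * Polynomial.coeff g (i + j - k))"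
    proof (rule dvd_in_sum)
      fix k assume k: "k \<in> {..i + j} - {i}"
      show "dvd_in A p (Polynomial.coeff f k * Polynomial.coeff g (i + j - k))"
      proof (cases "k < i")
        case True
        then show ?thesis using i(2) gA by (intro dvd_in_mult_right) auto
      next
        case False
        then have "i + j - k < j" using k by auto
        then show ?thesis using j(2) fA by (intro dvd_in_mult_left) auto
      qed
    qed
    have "dvd_in A p (Polynomial.coeff f i * Polynomial.coeff g j)"
      using dvd_in_diff[OF fg rest] unfolding split by simp
    then show False
      using prime_or_unit_inD(3)[OF p fA gA] i(1) j(1) by blast
  qed
qed

text \<open>Multiplying \<open>f\<close> by the leading coefficient of \<open>m\<close> before each
  reduction of the degree avoids the fraction field of \<open>A\<close>; the constant
  \<open>c\<close> collects these factors.\<close>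

lemma pseudo_division:
  assumes m: "m \<in> polys_over A" "m \<noteq> 0" and "f \<in> polys_over A"
  shows "\<exists>c q r. c \<in> A \<and> c \<noteq> 0 \<and> q \<in> polys_over A \<and> r \<in> polys_over A \<and>
    Polynomial.smult c f = q * m + r \<and> (r = 0 \<or> Polynomial.degree r < Polynomial.degree m)"
  using assms(3)
proof (induction "Polynomial.degree f" arbitrary: f rule: less_induct)
  case less
  interpret P: type_subring "polys_over A"
    by (rule type_subring_polys_over)
  show ?case
  proof (cases "f = 0 \<or> Polynomial.degree f < Polynomial.degree m")
    case True
    then show ?thesis
      using less.prems by (intro exI[of _ 1] exI[of _ 0] exI[of _ f]) auto
  next
    case False
    define l where "l = Polynomial.lead_coeff m"
    define h where "h = Polynomial.monom (Polynomial.lead_coeff f) (Polynomial.degree f - Polynomial.degree m)"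
    define f' where "f' = Polynomial.smult l f - h * m"
    have l: "l \<in> A" "l \<noteq> 0" and "Polynomial.lead_coeff f \<in> A"
      using m less.prems unfolding l_def polys_over_def by auto
    then have h: "h \<in> polys_over A"
      unfolding h_def by (intro monom_mem_polys_over)
    have f': "f' \<in> polys_over A"
      unfolding f'_def using h m l less.prems by (auto intro: smult_mem_polys_over)
    have hdeg: "Polynomial.degree (h * m) = Polynomial.degree f"
      using False m unfolding h_def by (auto simp: Polynomial.degree_mult_eq Polynomial.degree_monom_eq)
    have "f' = 0 \<or> Polynomial.degree f' < Polynomial.degree f"
    proof (rule ccontr)
      assume a: "\<not> ?thesis"
      have "Polynomial.degree f' \<le> Polynomial.degree f"
        unfolding f'_def using hdeg l by (intro Polynomial.degree_diff_le) auto
      then have "Polynomial.coeff f' (Polynomial.degree f) \<noteq> 0"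
        using a by (metis Polynomial.leading_coeff_0_iff le_neq_implies_less)
      moreover have "Polynomial.coeff (h * m) (Polynomial.degree f) = Polynomial.lead_coeff f * l"
        using hdeg Polynomial.lead_coeff_mult[of h m] False unfolding l_def h_def
        by (cases "f = 0") (auto simp: Polynomial.degree_monom_eq)
      ultimately show False
        unfolding f'_def by (simp add: mult.commute)
    qed
    then have "\<exists>c q r. c \<in> A \<and> c \<noteq> 0 \<and> q \<in> polys_over A \<and> r \<in> polys_over A \<and>
      Polynomial.smult c f' = q * m + r \<and> (r = 0 \<or> Polynomial.degree r < Polynomial.degree m)"
    proof
      assume "f' = 0"
      then show ?thesis by (intro exI[of _ 1] exI[of _ 0]) auto
    qed (use less.hyps f' in blast)
    then obtain c q r where c: "c \<in> A" "c \<noteq> 0" "q \<in> polys_over A" "r \<in> polys_over A"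
      "Polynomial.smult c f' = q * m + r" "r = 0 \<or> Polynomial.degree r < Polynomial.degree m"
      by blast
    have "Polynomial.smult (c * l) f = (q + Polynomial.smult c h) * m + r"
      using c(5) unfolding f'_def by (simp add: algebra_simps Polynomial.smult_diff_right)
    then show ?thesis
      using c l h by (intro exI[of _ "c * l"] exI[of _ "q + Polynomial.smult c h"] exI[of _ r])
        (auto intro!: smult_mem_polys_over P.add_mem)
  qed
qed

definition primitive_poly :: "'a poly \<Rightarrow> bool"
  where "primitive_poly f \<longleftrightarrow> (\<forall>c\<in>A. dvd_in (polys_over A) [:c:] f \<longrightarrow> dvd_in A c 1)"

lemma primitive_poly_dvd:
  assumes "primitive_poly f" "dvd_in (polys_over A) g f"
  shows "primitive_poly g"
  using assms type_subring.dvd_in_trans[OF type_subring_polys_over] unfolding primitive_poly_def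
  by blast

text \<open>A prime factor \<open>p\<close> of \<open>c\<close> divides the product of
  \<open>m\<close> and the quotient, hence one of the two. By primitivity it divides
  \<open>m\<close> only if it is a unit, so in any case it can be cancelled from the
  quotient.\<close>

lemma primitive_cancel_const:
  assumes fact: "factorial_subring A" and "primitive_poly m" "m \<in> polys_over A"
    "c \<in> A" "c \<noteq> 0" "f \<in> polys_over A" "dvd_in (polys_over A) m (Polynomial.smult c f)"
  shows "dvd_in (polys_over A) m f"
proof -
  obtain ps where ps: "set ps \<subseteq> {p. prime_or_unit_in A p}" "c = prod_list ps"
    using factorial_subringE[OF fact \<open>c \<in> A\<close> \<open>c \<noteq> 0\<close>] .
  have "dvd_in (polys_over A) m f"
    if "f \<in> polys_over A" "dvd_in (polys_over A) m (Polynomial.smult (prod_list ps) f)" for f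
    using ps(1) that
  proof (induction ps arbitrary: f)
    case (Cons p ps)
    then have p: "prime_or_unit_in A p" "p \<in> A" "p \<noteq> 0" and psA: "prod_list ps \<in> A"
      by (auto simp: prime_or_unit_in_def intro!: prod_list_mem)
    define f1 where "f1 = Polynomial.smult (prod_list ps) f"
    have f1: "f1 \<in> polys_over A"
      unfolding f1_def using Cons.prems psA by (intro smult_mem_polys_over)
    obtain q where q: "q \<in> polys_over A" "Polynomial.smult p f1 = m * q"
      using Cons.prems unfolding f1_def dvd_in_def by auto
    then have "q * m = [:p:] * f1"
      by (simp add: mult.commute)
    then have "dvd_in (polys_over A) [:p:] (q * m)"
      unfolding dvd_in_def using f1 by blast
    then have "dvd_in (polys_over A) [:p:] q \<or> dvd_in (polys_over A) [:p:] m"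
      using prime_or_unit_inD(3)[OF prime_or_unit_const[OF p(1)]] q assms by blast
    then have "dvd_in (polys_over A) [:p:] q"
    proof
      assume "dvd_in (polys_over A) [:p:] m"
      then have "dvd_in A p 1"
        using assms(2) p unfolding primitive_poly_def by blast
      then obtain z where z: "z \<in> A" "p * z = 1"
        unfolding dvd_in_def by auto
      then have "q = [:p:] * Polynomial.smult z q"
        using z(2) by (simp add: mult.commute[of z p])
      then show ?thesis
        unfolding dvd_in_def using z q smult_mem_polys_over by blast
    qed
    then obtain q' where q': "q' \<in> polys_over A" "q = [:p:] * q'"
      unfolding dvd_in_def by blast
    then have "Polynomial.smult p f1 = Polynomial.smult p (m * q')"
      using q(2) by simp
    then have "f1 = m * q'"
      using p(3) by (metis Polynomial.smult_eq_0_iff Polynomial.smult_diff_right eq_iff_diff_eq_0)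
    then have "dvd_in (polys_over A) m f1"
      unfolding dvd_in_def using q' by blast
    then show ?case
      using Cons unfolding f1_def by simp
  qed simp
  then show ?thesis
    using assms ps by blast
qed

text \<open>The content is found as a longest product of nonunit constants that can be extracted
  from \<open>f\<close>. The length is bounded because these constants also divide the leading
  coefficient, a product of finitely many primes or units.\<close>

lemma content_primitive:
  assumes fact: "factorial_subring A" and f: "f \<in> polys_over A" "f \<noteq> 0"
  shows "\<exists>c f'. c \<in> A \<and> c \<noteq> 0 \<and> f' \<in> polys_over A \<and> f = Polynomial.smult c f' \<and> primitive_poly f'"
proof -
  define P where "P n \<longleftrightarrow> (\<exists>ds f'. length ds = n \<and> set ds \<subseteq> A \<and> (\<forall>d\<in>set ds. \<not> dvd_in A d 1) \<and>
    f' \<in> polys_over A \<and> f = Polynomial.smult (prod_list ds) f')" for n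
  have lf: "Polynomial.lead_coeff f \<in> A" "Polynomial.lead_coeff f \<noteq> 0"
    using f unfolding polys_over_def by auto
  obtain ps where ps: "set ps \<subseteq> {p. prime_or_unit_in A p}" "Polynomial.lead_coeff f = prod_list ps"
    using factorial_subringE[OF fact lf] .
  have bound: "n \<le> length ps" if Pn: "P n" for n
  proof -
    obtain ds f' where ds: "length ds = n" "set ds \<subseteq> A" "\<forall>d\<in>set ds. \<not> dvd_in A d 1"
      "f' \<in> polys_over A" "f = Polynomial.smult (prod_list ds) f'"
      using Pn unfolding P_def by blast
    show ?thesis
    proof (cases ds)
      case (Cons d ds')
      let ?l = "Polynomial.lead_coeff f'"
      have l: "?l \<in> A" using ds(4) unfolding polys_over_def by auto
      \<comment> \<open>The leading coefficient of \<open>f'\<close> may be a unit and is therefore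
        merged with one of the nonunits.\<close>
      have "length ((d * ?l) # ds') \<le> length ps"
      proof (rule nonunit_list_length_le[OF ps(1)])
        show "set (d * ?l # ds') \<subseteq> A"
          using l ds Cons by auto
        show "\<forall>d\<in>set (d * ?l # ds'). \<not> dvd_in A d 1"
          using ds Cons dvd_in_one_mult[of d ?l] l by auto
        show "prod_list (d * ?l # ds') = prod_list ps"
        proof -
          have "Polynomial.lead_coeff f = prod_list ds * ?l"
            using f(2) unfolding ds(5) by simp
          then show ?thesis
            using ps(2) Cons by (simp add: algebra_simps)
        qed
      qed
      then show ?thesis using Cons ds by simp
    qed (use ds in simp)
  qed
  have "P 0"
    unfolding P_def using f by (intro exI[of _ "[]"] exI[of _ f]) auto
  then obtain n where n: "P n" "\<And>k. P k \<Longrightarrow> k \<le> n"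
    using bound Nat.ex_has_greatest_nat[of P 0 "length ps"] by blast
  obtain ds f' where ds: "length ds = n" "set ds \<subseteq> A" "\<forall>d\<in>set ds. \<not> dvd_in A d 1"
    "f' \<in> polys_over A" "f = Polynomial.smult (prod_list ds) f'"
    using n(1) unfolding P_def by blast
  have "primitive_poly f'"
    unfolding primitive_poly_def
  proof (intro ballI impI, rule ccontr)
    fix c assume c: "c \<in> A" "dvd_in (polys_over A) [:c:] f'" "\<not> dvd_in A c 1"
    then obtain g where "g \<in> polys_over A" "f' = [:c:] * g"
      unfolding dvd_in_def by blast
    then have "P (length (c # ds))"
      unfolding P_def using c ds by (intro exI[of _ "c # ds"] exI[of _ g]) (auto simp: mult.commute)
    then show False
      using n(2)[of "length (c # ds)"] ds by simp
  qed
  moreover have "prod_list ds \<noteq> 0"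
    using ds(5) f by auto
  ultimately show ?thesis
    using ds by (intro exI[of _ "prod_list ds"] exI[of _ f']) auto
qed

text \<open>Over the fraction field, \<open>f\<close> and \<open>g\<close> would generate a
  principal ideal. Its generator is replaced by an element \<open>m\<close> of least degree in the
  ideal \<open>J\<close> over \<open>A\<close>: by pseudo-division its primitive part
  \<open>m'\<close> divides every element of \<open>J\<close> up to a constant, and the constant can
  be cancelled. Either \<open>m\<close> is constant, and then \<open>f\<close> divides a constant
  multiple of \<open>h\<close>, or \<open>m'\<close> differs from \<open>f\<close> by a unit and
  divides \<open>g\<close>.\<close>

lemma prime_or_unit_primitive:
  assumes fact: "factorial_subring A" and f: "f \<in> polys_over A" "f \<noteq> 0" "primitive_poly f"
    and irred: "\<And>g h. g \<in> polys_over A \<Longrightarrow> h \<in> polys_over A \<Longrightarrow> f = g * h \<Longrightarrow>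
      Polynomial.degree g = 0 \<or> Polynomial.degree h = 0"
  shows "prime_or_unit_in (polys_over A) f"
  unfolding prime_or_unit_in_def
proof (intro conjI ballI impI)
  interpret P: type_subring "polys_over A"
    by (rule type_subring_polys_over)
  fix g h assume g: "g \<in> polys_over A" and h: "h \<in> polys_over A"
    and "dvd_in (polys_over A) f (g * h)"
  then obtain k where k: "k \<in> polys_over A" "g * h = f * k"
    unfolding dvd_in_def by blast
  define J where "J = {\<alpha> * f + \<beta> * g | \<alpha> \<beta>. \<alpha> \<in> polys_over A \<and> \<beta> \<in> polys_over A}"
  have "f = 1 * f + 0 * g"
    by simp
  then have fJ: "f \<in> J"
    unfolding J_def using P.one_mem P.zero_mem by blast
  have "g = 0 * f + 1 * g"
    by simp
  then have gJ: "g \<in> J"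
    unfolding J_def using P.one_mem P.zero_mem by blast
  obtain m where m: "m \<in> J" "m \<noteq> 0"
    and min: "\<And>m'. m' \<in> J \<Longrightarrow> m' \<noteq> 0 \<Longrightarrow> Polynomial.degree m \<le> Polynomial.degree m'"
    using ex_has_least_nat[of "\<lambda>m. m \<in> J \<and> m \<noteq> 0" f Polynomial.degree] fJ f(2) by auto
  obtain \<alpha> \<beta> where ab: "\<alpha> \<in> polys_over A" "\<beta> \<in> polys_over A" "m = \<alpha> * f + \<beta> * g"
    using m(1) unfolding J_def by blast
  have mA: "m \<in> polys_over A"
    using ab f g by simp
  obtain d m' where m': "d \<in> A" "d \<noteq> 0" "m' \<in> polys_over A" "m = Polynomial.smult d m'" "primitive_poly m'"
    using content_primitive[OF fact mA m(2)] by blast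
  have dvd_J: "dvd_in (polys_over A) m' x" if x: "x \<in> J" for x
  proof -
    obtain \<gamma> \<epsilon> where x': "\<gamma> \<in> polys_over A" "\<epsilon> \<in> polys_over A" "x = \<gamma> * f + \<epsilon> * g"
      using x unfolding J_def by blast
    then have xA: "x \<in> polys_over A"
      using f g by simp
    obtain c q r where c: "c \<in> A" "c \<noteq> 0" "q \<in> polys_over A" "r \<in> polys_over A"
      "Polynomial.smult c x = q * m + r" "r = 0 \<or> Polynomial.degree r < Polynomial.degree m"
      using pseudo_division[OF mA m(2) xA] by blast
    have "r = (Polynomial.smult c \<gamma> - q * \<alpha>) * f + (Polynomial.smult c \<epsilon> - q * \<beta>) * g"
      using c(5) unfolding x'(3) ab(3) by (simp add: algebra_simps Polynomial.smult_add_right)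
    moreover have "Polynomial.smult c \<gamma> - q * \<alpha> \<in> polys_over A"
      "Polynomial.smult c \<epsilon> - q * \<beta> \<in> polys_over A"
      using c x' ab by (auto intro: smult_mem_polys_over)
    ultimately have "r \<in> J"
      unfolding J_def by blast
    then have "r = 0"
      using min c(6) by (meson leD)
    then have "Polynomial.smult c x = m' * Polynomial.smult d q"
      using c(5) m'(4) by (simp add: mult.commute)
    then have "dvd_in (polys_over A) m' (Polynomial.smult c x)"
      unfolding dvd_in_def using c m' smult_mem_polys_over by blast
    then show ?thesis
      using primitive_cancel_const[OF fact m'(5,3) c(1,2) xA] by blast
  qed
  obtain n where n: "n \<in> polys_over A" "f = m' * n"
    using dvd_J[OF fJ] unfolding dvd_in_def by blast
  show "dvd_in (polys_over A) f g \<or> dvd_in (polys_over A) f h"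
  proof (cases "Polynomial.degree m' = 0")
    case True
    then obtain z where "m' = [:z:]"
      by (rule degree_eq_zeroE)
    then obtain \<mu> where \<mu>: "m = [:\<mu>:]"
      using m'(4) by simp
    have "Polynomial.smult \<mu> h = f * (\<alpha> * h + \<beta> * k)"
    proof -
      have "Polynomial.smult \<mu> h = m * h"
        by (simp add: \<mu>)
      also have "\<dots> = \<alpha> * f * h + \<beta> * (g * h)"
        unfolding ab(3) by (simp add: algebra_simps)
      also have "\<dots> = f * (\<alpha> * h + \<beta> * k)"
        unfolding k(2) by (simp add: algebra_simps)
      finally show ?thesis .
    qed
    then have "dvd_in (polys_over A) f (Polynomial.smult \<mu> h)"
      unfolding dvd_in_def using ab h k by blast
    moreover have "\<mu> \<in> A" "\<mu> \<noteq> 0"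
      using mA m(2) \<mu> by auto
    ultimately have "dvd_in (polys_over A) f h"
      using primitive_cancel_const[OF fact f(3,1)] h by blast
    then show ?thesis ..
  next
    case False
    then have "Polynomial.degree n = 0"
      using irred[OF m'(3) n] by simp
    then obtain \<nu> where \<nu>: "n = [:\<nu>:]"
      by (rule degree_eq_zeroE)
    have "\<nu> \<in> A"
      using n \<nu> by auto
    moreover have "dvd_in (polys_over A) [:\<nu>:] f"
      unfolding dvd_in_def using n m' \<nu> by (metis mult.commute)
    ultimately obtain z where z: "z \<in> A" "1 = \<nu> * z"
      using f(3) unfolding primitive_poly_def dvd_in_def by blast
    then have "m' = f * [:z:]"
      unfolding n(2) \<nu> by (simp add: mult.commute)
    then have "dvd_in (polys_over A) f m'"
      unfolding dvd_in_def using z const_mem_polys_over by blast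
    then have "dvd_in (polys_over A) f g"
      using dvd_J[OF gJ] P.dvd_in_trans by blast
    then show ?thesis ..
  qed
qed (use f in auto)

lemma primitive_factorization:
  assumes fact: "factorial_subring A"
  shows "f \<in> polys_over A \<Longrightarrow> f \<noteq> 0 \<Longrightarrow> primitive_poly f \<Longrightarrow>
    \<exists>ps. set ps \<subseteq> {p. prime_or_unit_in (polys_over A) p} \<and> f = prod_list ps"
proof (induction "Polynomial.degree f" arbitrary: f rule: less_induct)
  case less
  show ?case
  proof (cases "\<exists>g h. g \<in> polys_over A \<and> h \<in> polys_over A \<and> f = g * h \<and>
      Polynomial.degree g \<noteq> 0 \<and> Polynomial.degree h \<noteq> 0")
    case True
    then obtain g h where gh: "g \<in> polys_over A" "h \<in> polys_over A" "f = g * h"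
      "Polynomial.degree g \<noteq> 0" "Polynomial.degree h \<noteq> 0"
      by blast
    have "g \<noteq> 0" "h \<noteq> 0"
      using gh less.prems by auto
    then have deg: "Polynomial.degree g < Polynomial.degree f" "Polynomial.degree h < Polynomial.degree f"
      using gh by (auto simp: Polynomial.degree_mult_eq)
    have "primitive_poly g" "primitive_poly h"
      using primitive_poly_dvd[OF less.prems(3)] gh unfolding dvd_in_def by (metis mult.commute)+
    then obtain ps qs where "set ps \<subseteq> {p. prime_or_unit_in (polys_over A) p}" "g = prod_list ps"
      "set qs \<subseteq> {p. prime_or_unit_in (polys_over A) p}" "h = prod_list qs"
      using less.hyps[OF deg(1) gh(1) \<open>g \<noteq> 0\<close>] less.hyps[OF deg(2) gh(2) \<open>h \<noteq> 0\<close>] by blast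
    then show ?thesis
      using gh by (intro exI[of _ "ps @ qs"]) auto
  next
    case False
    then have "prime_or_unit_in (polys_over A) f"
      using prime_or_unit_primitive[OF fact less.prems] by blast
    then show ?thesis by (intro exI[of _ "[f]"]) auto
  qed
qed

theorem factorial_polys_over:
  assumes fact: "factorial_subring A"
  shows "factorial_subring (polys_over A)"
  unfolding factorial_subring_def
proof (intro ballI impI)
  fix f assume f: "f \<in> polys_over A" "f \<noteq> 0"
  obtain c f' where c: "c \<in> A" "c \<noteq> 0" "f' \<in> polys_over A" "f = Polynomial.smult c f'" "primitive_poly f'"
    using content_primitive[OF fact f] by blast
  obtain ps where ps: "set ps \<subseteq> {p. prime_or_unit_in A p}" "c = prod_list ps"
    using factorial_subringE[OF fact c(1,2)] .
  have "f' \<noteq> 0" using c f by auto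
  then obtain qs where qs: "set qs \<subseteq> {p. prime_or_unit_in (polys_over A) p}" "f' = prod_list qs"
    using primitive_factorization[OF fact c(3) _ c(5)] by blast
  have const: "prod_list (map (\<lambda>p. [:p:]) ps) = [:prod_list ps:]" for ps :: "'a list"
    by (induction ps) (simp_all add: one_pCons)
  have "f = prod_list (map (\<lambda>p. [:p:]) ps @ qs)"
    unfolding c(4) prod_list.append const ps(2)[symmetric] qs(2)[symmetric] by simp
  moreover have "set (map (\<lambda>p. [:p:]) ps @ qs) \<subseteq> {p. prime_or_unit_in (polys_over A) p}"
    using ps qs prime_or_unit_const by auto
  ultimately show "\<exists>ps. set ps \<subseteq> {p. prime_or_unit_in (polys_over A) p} \<and> f = prod_list ps"
    by blast
qed

end

subsection \<open>Laurent polynomials and subrings defined by valuations\<close>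

context type_subring
begin

lemma type_subring_laurent_extension:
  assumes ts: "t * s = 1"
  shows "type_subring {poly f t * s ^ k | f k. f \<in> polys_over A}" (is "type_subring ?L")
proof -
  interpret P: type_subring "polys_over A"
    by (rule type_subring_polys_over)
  have ts': "t ^ k * s ^ k = 1" for k
    using ts by (metis power_mult_distrib power_one)
  have X: "Polynomial.monom 1 k \<in> polys_over A" for k
    by (rule monom_mem_polys_over) simp
  have mem: "poly f t * s ^ k \<in> ?L" if "f \<in> polys_over A" for f k
    using that by blast
  have lift: "\<exists>f k. f \<in> polys_over A \<and> x = poly f t * s ^ k" if "x \<in> ?L" for x
    using that by blast
  show ?thesis
  proof
    show "1 \<in> ?L"
      using mem[OF P.one_mem, of 0] by simp
    fix x y assume x: "x \<in> ?L" and y: "y \<in> ?L"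
    obtain f k where f: "f \<in> polys_over A" "x = poly f t * s ^ k"
      using lift[OF x] by blast
    obtain g l where g: "g \<in> polys_over A" "y = poly g t * s ^ l"
      using lift[OF y] by blast
    have "x * y = poly (f * g) t * s ^ (k + l)"
      unfolding f g by (simp add: power_add algebra_simps)
    then show "x * y \<in> ?L"
      using mem[OF P.mult_mem[OF f(1) g(1)]] by simp
    have "x - y = x * (t ^ l * s ^ l) - y * (t ^ k * s ^ k)"
      by (simp add: ts')
    also have "\<dots> = poly (f * Polynomial.monom 1 l - g * Polynomial.monom 1 k) t * s ^ (k + l)"
      unfolding f g by (simp add: power_add algebra_simps poly_monom)
    finally show "x - y \<in> ?L"
      using mem[of "f * Polynomial.monom 1 l - g * Polynomial.monom 1 k" "k + l"] f g X by simp
  qed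
qed

text \<open>This is the localization of the polynomial ring at its variable: primes stay primes or
  become units, as the variable does. Injectivity of evaluation at \<open>t\<close> on polynomials
  lets an identity in \<open>L\<close> be lifted once it has been multiplied by a power of
  \<open>t\<close>.\<close>

theorem factorial_laurent_extension:
  assumes fact: "factorial_subring A" and ts: "t * s = 1"
    and inj: "\<And>f. f \<in> polys_over A \<Longrightarrow> poly f t = 0 \<Longrightarrow> f = 0"
  defines "L \<equiv> {poly f t * s ^ k | f k. f \<in> polys_over A}"
  shows "factorial_subring L"
proof -
  interpret P: type_subring "polys_over A"
    by (rule type_subring_polys_over)
  have ts': "t ^ k * s ^ k = 1" for k
    using ts by (metis power_mult_distrib power_one)
  have X: "Polynomial.monom 1 k \<in> polys_over A" for k
    by (rule monom_mem_polys_over) simp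
  have Xt: "poly (Polynomial.monom 1 k) t = t ^ k" for k
    by (simp add: poly_monom)
  have mem: "poly f t * s ^ k \<in> L" if "f \<in> polys_over A" for f k
    using that unfolding L_def by blast
  have poly_mem: "poly f t \<in> L" if "f \<in> polys_over A" for f
    using mem[OF that, of 0] by simp
  have lift: "\<exists>f k. f \<in> polys_over A \<and> x = poly f t * s ^ k" if "x \<in> L" for x
    using that unfolding L_def by blast
  interpret L: type_subring L
    unfolding L_def by (rule type_subring_laurent_extension[OF ts])
  have s: "s \<in> L"
    using mem[OF P.one_mem, of 1] by simp
  have t: "t \<in> L"
    using poly_mem[OF X, of 1] by (simp add: Xt)
  have descend: "prime_or_unit_in L (poly p t)" if p: "prime_or_unit_in (polys_over A) p" for p
    unfolding prime_or_unit_in_def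
  proof (intro conjI ballI impI)
    note p' = prime_or_unit_inD[OF p]
    show "poly p t \<in> L"
      using p' poly_mem by blast
    show "poly p t \<noteq> 0"
      using inj p' by blast
    fix x y assume "x \<in> L" "y \<in> L" "dvd_in L (poly p t) (x * y)"
    then obtain z where z: "z \<in> L" "x * y = poly p t * z"
      unfolding dvd_in_def by blast
    obtain f k where f: "f \<in> polys_over A" "x = poly f t * s ^ k"
      using lift[OF \<open>x \<in> L\<close>] by blast
    obtain g l where g: "g \<in> polys_over A" "y = poly g t * s ^ l"
      using lift[OF \<open>y \<in> L\<close>] by blast
    obtain h m where h: "h \<in> polys_over A" "z = poly h t * s ^ m"
      using lift[OF z(1)] by blast
    have cl: "f * g * Polynomial.monom 1 m \<in> polys_over A"
      "p * h * Polynomial.monom 1 (k + l) \<in> polys_over A"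
      using f g h p'(1) X by auto
    \<comment> \<open>Clear the denominators: both sides of \<open>x * y = poly p t * z\<close>,
      multiplied by \<open>t ^ (k + l + m)\<close>, become values of polynomials.\<close>
    have "poly (f * g * Polynomial.monom 1 m) t = x * y * t ^ (k + l + m)"
    proof -
      have "x * y * t ^ (k + l + m) = poly f t * poly g t * (t ^ k * s ^ k) * (t ^ l * s ^ l) * t ^ m"
        unfolding f g by (simp add: power_add algebra_simps)
      then show ?thesis by (simp add: ts' Xt)
    qed
    also have "\<dots> = poly p t * poly h t * (t ^ m * s ^ m) * t ^ (k + l)"
      unfolding z h by (simp add: power_add algebra_simps)
    also have "\<dots> = poly (p * h * Polynomial.monom 1 (k + l)) t"
      by (simp add: ts' Xt)
    finally have "poly (f * g * Polynomial.monom 1 m - p * h * Polynomial.monom 1 (k + l)) t = 0"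
      by simp
    then have "f * g * Polynomial.monom 1 m - p * h * Polynomial.monom 1 (k + l) = 0"
      using inj cl by blast
    then have "(f * Polynomial.monom 1 m) * g = p * (h * Polynomial.monom 1 (k + l))"
      by (simp add: algebra_simps)
    then have "dvd_in (polys_over A) p ((f * Polynomial.monom 1 m) * g)"
      unfolding dvd_in_def using h X by blast
    then consider "dvd_in (polys_over A) p (f * Polynomial.monom 1 m)" | "dvd_in (polys_over A) p g"
      using p'(3)[of "f * Polynomial.monom 1 m" g] f g X by blast
    then show "dvd_in L (poly p t) x \<or> dvd_in L (poly p t) y"
    proof cases
      case 1
      then obtain q where q: "q \<in> polys_over A" "f * Polynomial.monom 1 m = p * q"
        unfolding dvd_in_def by blast
      have "x = poly (f * Polynomial.monom 1 m) t * s ^ (k + m)"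
        unfolding f using ts'[of m] by (simp add: power_add Xt algebra_simps)
      also have "\<dots> = poly p t * (poly q t * s ^ (k + m))"
        unfolding q by (simp add: mult.assoc)
      finally show ?thesis
        unfolding dvd_in_def using mem[OF q(1)] by blast
    next
      case 2
      then obtain q where q: "q \<in> polys_over A" "g = p * q"
        unfolding dvd_in_def by blast
      have "y = poly p t * (poly q t * s ^ l)"
        unfolding g q by (simp add: mult.assoc)
      then show ?thesis
        unfolding dvd_in_def using mem[OF q(1)] by blast
    qed
  qed
  show "factorial_subring L"
    unfolding factorial_subring_def
  proof (intro ballI impI)
    fix x assume "x \<in> L" "x \<noteq> 0"
    obtain f k where f: "f \<in> polys_over A" "x = poly f t * s ^ k"
      using lift[OF \<open>x \<in> L\<close>] by blast
    then have "f \<noteq> 0" using \<open>x \<noteq> 0\<close> by auto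
    then obtain ps where ps: "set ps \<subseteq> {p. prime_or_unit_in (polys_over A) p}" "f = prod_list ps"
      using factorial_subringE[OF factorial_polys_over[OF fact] f(1)] by blast
    have "prime_or_unit_in L (s ^ k)"
      using s t ts'[of k] by (intro L.prime_or_unit_if_unit[of _ "t ^ k"]) (auto simp: mult.commute)
    moreover have "poly (prod_list ps) t = prod_list (map (\<lambda>p. poly p t) ps)" for ps
      by (induction ps) auto
    then have "x = prod_list (map (\<lambda>p. poly p t) ps @ [s ^ k])"
      unfolding f ps by simp
    moreover have "set (map (\<lambda>p. poly p t) ps) \<subseteq> {p. prime_or_unit_in L p}"
      using ps(1) descend by auto
    ultimately show "\<exists>ps. set ps \<subseteq> {p. prime_or_unit_in L p} \<and> x = prod_list ps"
      by (intro exI[of _ "map (\<lambda>p. poly p t) ps @ [s ^ k]"]) auto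
  qed
qed

text \<open>A converse of localization in the manner of Nagata's criterion: \<open>A\<close> arises
  from \<open>B\<close> by inverting the elements \<open>p w\<close>, which are prime in
  \<open>B\<close>. A prime of \<open>A\<close> becomes a prime or unit of \<open>B\<close> once a
  unit of \<open>A\<close> with the same values is divided out, and the values removed in this way
  are made up by a product of the \<open>p w\<close>.\<close>

theorem factorial_valuation_subring:
  fixes \<nu> :: "'i \<Rightarrow> 'a \<Rightarrow> int"
  assumes fact: "factorial_subring A"
    and mult: "\<And>w x y. w \<in> I \<Longrightarrow> x \<in> A \<Longrightarrow> y \<in> A \<Longrightarrow> x \<noteq> 0 \<Longrightarrow> y \<noteq> 0 \<Longrightarrow> \<nu> w (x * y) = \<nu> w x + \<nu> w y"
    and fin: "\<And>x. x \<in> A \<Longrightarrow> x \<noteq> 0 \<Longrightarrow> finite {w \<in> I. \<nu> w x \<noteq> 0}"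
    and units: "\<And>w. w \<in> I \<Longrightarrow> \<exists>p\<in>A. \<exists>q\<in>A. p * q = 1 \<and> (\<forall>w'\<in>I. \<nu> w' p = (if w' = w then 1 else 0))"
    and B: "B = {x \<in> A. x = 0 \<or> (\<forall>w\<in>I. \<nu> w x \<ge> 0)}" and "type_subring B"
  shows "factorial_subring B"
proof -
  interpret B: type_subring B by fact
  obtain p q where p: "\<And>w. w \<in> I \<Longrightarrow> p w \<in> A" and q: "\<And>w. w \<in> I \<Longrightarrow> q w \<in> A"
    and pq: "\<And>w. w \<in> I \<Longrightarrow> p w * q w = 1"
    and \<nu>p: "\<And>w w'. w \<in> I \<Longrightarrow> w' \<in> I \<Longrightarrow> \<nu> w' (p w) = (if w' = w then 1 else 0)"
    using units by metis
  have \<nu>1: "\<nu> w 1 = 0" if "w \<in> I" for w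
    using mult[OF that one_mem one_mem] by simp
  have inv: "\<nu> w y = - \<nu> w x" if "w \<in> I" "x \<in> A" "y \<in> A" "x * y = 1" for w x y
    using mult[OF that(1-3)] that(4) \<nu>1[OF that(1)] by force
  have p_prime: "prime_or_unit_in B (p w)" if w: "w \<in> I" for w
    unfolding prime_or_unit_in_def
  proof (intro conjI ballI impI)
    show "p w \<in> B" "p w \<noteq> 0"
      using p[OF w] \<nu>p[OF w] pq[OF w] unfolding B by auto
    \<comment> \<open>Multiplication by \<open>q w\<close> lowers the value at \<open>w\<close> by 1
      and changes no other, so a value of at least 1 at \<open>w\<close> suffices for the quotient
      to stay in \<open>B\<close>.\<close>
    have *: "dvd_in B (p w) x" if x: "x \<in> B" "x = 0 \<or> \<nu> w x \<ge> 1" for x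
    proof (cases "x = 0")
      case False
      have x': "x \<in> A" "\<And>w. w \<in> I \<Longrightarrow> \<nu> w x \<ge> 0"
        using x False unfolding B by auto
      have "q w \<noteq> 0"
        using pq[OF w] by auto
      then have "q w * x \<in> B"
        using x' x False q[OF w] mult[OF _ q[OF w] x'(1)] inv[OF _ p[OF w] q[OF w] pq[OF w]] \<nu>p[OF w]
        unfolding B by auto
      moreover have "x = p w * (q w * x)"
        using pq[OF w] by (simp add: mult.assoc[symmetric])
      ultimately show ?thesis
        unfolding dvd_in_def by blast
    qed simp
    fix x y assume x: "x \<in> B" and y: "y \<in> B" and "dvd_in B (p w) (x * y)"
    then obtain z where z: "z \<in> B" "x * y = p w * z"
      unfolding dvd_in_def by blast
    show "dvd_in B (p w) x \<or> dvd_in B (p w) y"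
    proof (cases "x = 0 \<or> y = 0")
      case False
      then have "z \<noteq> 0" using z by auto
      have "\<nu> w x + \<nu> w y = \<nu> w (p w) + \<nu> w z"
        using mult[OF w, of x y] mult[OF w, of "p w" z] x y z False \<open>z \<noteq> 0\<close> p[OF w] \<open>p w \<noteq> 0\<close>
        unfolding B by simp
      moreover have "\<nu> w z \<ge> 0"
        using z \<open>z \<noteq> 0\<close> w unfolding B by simp
      ultimately have "\<nu> w x \<ge> 1 \<or> \<nu> w y \<ge> 1"
        using \<nu>p[OF w w] by simp linarith
      then show ?thesis using * x y by blast
    qed (use * x y in auto)
  qed
  \<comment> \<open>Dividing by an element with all values 0 does not change values. Hence a
    quotient of elements of \<open>B\<close> by \<open>x\<close> that exists in \<open>A\<close>
    lies in \<open>B\<close>, and primality is inherited.\<close>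
  have pu: "prime_or_unit_in B x"
    if x: "prime_or_unit_in A x" and \<nu>: "\<And>w. w \<in> I \<Longrightarrow> \<nu> w x = 0" for x
    unfolding prime_or_unit_in_def
  proof (intro conjI ballI impI)
    note x' = prime_or_unit_inD[OF x]
    show "x \<in> B" "x \<noteq> 0"
      using x' \<nu> unfolding B by auto
    have *: "dvd_in B x y" if y: "y \<in> B" "dvd_in A x y" for y
    proof (cases "y = 0")
      case False
      obtain z where z: "z \<in> A" "y = x * z"
        using y unfolding dvd_in_def by blast
      then have "z \<noteq> 0" using False by auto
      have "\<nu> w z \<ge> 0" if "w \<in> I" for w
        using y False \<nu>[OF that] mult[OF that x'(1) z(1) x'(2) \<open>z \<noteq> 0\<close>] that unfolding B z(2) by auto
      then have "z \<in> B"
        using z unfolding B by auto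
      then show ?thesis
        unfolding dvd_in_def using z by blast
    qed simp
    fix y z assume y: "y \<in> B" and z: "z \<in> B" and "dvd_in B x (y * z)"
    then have "dvd_in A x (y * z)" "y \<in> A" "z \<in> A"
      unfolding dvd_in_def B by auto
    then show "dvd_in B x y \<or> dvd_in B x z"
      using x'(3) * y z by blast
  qed
  \<comment> \<open>A negative value is realized by a power of the inverse \<open>q w\<close>. Only
    when no value is negative is the unit a product of the \<open>p w\<close>, hence the conditional
    clause.\<close>
  have prescribed: "\<exists>u v ps. u \<in> A \<and> v \<in> A \<and> u * v = 1 \<and> (\<forall>w\<in>I. \<nu> w u = (if w \<in> S then c w else 0)) \<and>
     ((\<forall>w\<in>S. c w \<ge> 0) \<longrightarrow> set ps \<subseteq> p ` I \<and> u = prod_list ps)"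
    if "finite S" "S \<subseteq> I" for S and c :: "'i \<Rightarrow> int"
    using that
  proof (induction S rule: finite_induct)
    case empty
    then show ?case using \<nu>1 by (intro exI[of _ 1] exI[of _ "[]"]) auto
  next
    case (insert w S)
    then obtain u v ps where u: "u \<in> A" "v \<in> A" "u * v = 1"
      "\<And>w. w \<in> I \<Longrightarrow> \<nu> w u = (if w \<in> S then c w else 0)"
      "\<forall>w\<in>S. c w \<ge> 0 \<Longrightarrow> set ps \<subseteq> p ` I \<and> u = prod_list ps"
      by blast
    have w: "w \<in> I" using insert by auto
    define n where "n = nat \<bar>c w\<bar>"
    have pow: "\<nu> w' (x ^ n) = int n * \<nu> w' x" if "w' \<in> I" "x \<in> A" "x \<noteq> 0" for w' x n
      using that \<nu>1[OF that(1)] mult[OF that(1)]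
      by (induction n) (auto simp: algebra_simps)
    have p0: "p w \<noteq> 0" and q0: "q w \<noteq> 0" and u0: "u \<noteq> 0"
      using pq[OF w] u(3) by auto
    have pqn: "p w ^ n * q w ^ n = 1"
      using pq[OF w] by (metis power_mult_distrib power_one)
    define a where "a = (if c w \<ge> 0 then p w ^ n else q w ^ n)"
    define b where "b = (if c w \<ge> 0 then q w ^ n else p w ^ n)"
    have ab: "a \<in> A" "b \<in> A" "a * b = 1" "a \<noteq> 0"
      using pqn p[OF w] q[OF w] p0 q0 unfolding a_def b_def by (auto simp: mult.commute)
    have \<nu>a: "\<nu> w' a = (if w' = w then c w else 0)" if w': "w' \<in> I" for w'
      using pow[OF w' p[OF w] p0] pow[OF w' q[OF w] q0] \<nu>p[OF w w'] inv[OF w' p[OF w] q[OF w] pq[OF w]]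
      unfolding a_def n_def by auto
    have "\<nu> w' (a * u) = (if w' \<in> insert w S then c w' else 0)" if w': "w' \<in> I" for w'
      using mult[OF w' ab(1) u(1) ab(4) u0] \<nu>a[OF w'] u(4)[OF w'] insert by auto
    moreover have "(a * u) * (b * v) = 1"
    proof -
      have "(a * u) * (b * v) = (a * b) * (u * v)" by (simp add: mult_ac)
      then show ?thesis using ab u by simp
    qed
    moreover have "set (replicate n (p w) @ ps) \<subseteq> p ` I \<and> a * u = prod_list (replicate n (p w) @ ps)"
      if "\<forall>w\<in>insert w S. c w \<ge> 0"
      using that u(5) w unfolding a_def by (auto simp: prod_list_replicate)
    moreover have "a * u \<in> A" "b * v \<in> A"
      using ab u by auto
    ultimately show ?case by meson
  qed
  have strip: "\<exists>u v ps. u \<in> A \<and> v \<in> A \<and> u * v = 1 \<and> (\<forall>w\<in>I. \<nu> w u = \<nu> w x) \<and>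
     ((\<forall>w\<in>I. \<nu> w x \<ge> 0) \<longrightarrow> set ps \<subseteq> p ` I \<and> u = prod_list ps)"
    if x: "x \<in> A" "x \<noteq> 0" for x
  proof -
    obtain u v ps where "u \<in> A" "v \<in> A" "u * v = 1"
      "\<forall>w\<in>I. \<nu> w u = (if w \<in> {w \<in> I. \<nu> w x \<noteq> 0} then \<nu> w x else 0)"
      "(\<forall>w\<in>{w \<in> I. \<nu> w x \<noteq> 0}. \<nu> w x \<ge> 0) \<longrightarrow> set ps \<subseteq> p ` I \<and> u = prod_list ps"
      using prescribed[OF fin[OF x], of "\<lambda>w. \<nu> w x"] by blast
    then show ?thesis by (intro exI[of _ u] exI[of _ v] exI[of _ ps]) auto
  qed
  \<comment> \<open>Single factors may have negative values, although the whole product does not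
    when it lies in \<open>B\<close>. The units stripped from the factors are therefore collected in
    \<open>U\<close> and treated together at the end.\<close>
  have decomp: "\<exists>U V rs. U \<in> A \<and> V \<in> A \<and> U * V = 1 \<and> set rs \<subseteq> {p. prime_or_unit_in B p} \<and>
      prod_list xs = prod_list rs * U \<and> (\<forall>w\<in>I. \<nu> w U = \<nu> w (prod_list xs))"
    if "set xs \<subseteq> {p. prime_or_unit_in A p}" for xs
    using that
  proof (induction xs)
    case Nil
    then show ?case by (intro exI[of _ 1] exI[of _ "[]"]) auto
  next
    case (Cons x xs)
    then obtain U V rs where U: "U \<in> A" "V \<in> A" "U * V = 1" "set rs \<subseteq> {p. prime_or_unit_in B p}"
      "prod_list xs = prod_list rs * U" "\<And>w. w \<in> I \<Longrightarrow> \<nu> w U = \<nu> w (prod_list xs)"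
      by auto
    have xs: "prod_list xs \<in> A" "prod_list xs \<noteq> 0"
    proof -
      show "prod_list xs \<in> A"
        using Cons.prems by (intro prod_list_mem) (auto simp: prime_or_unit_in_def)
      show "prod_list xs \<noteq> 0"
        using Cons.prems by (auto simp: prod_list_zero_iff prime_or_unit_in_def)
    qed
    have x: "prime_or_unit_in A x" and x': "x \<in> A" "x \<noteq> 0"
      using Cons.prems by (auto simp: prime_or_unit_in_def)
    obtain u v where u: "u \<in> A" "v \<in> A" "u * v = 1" "\<And>w. w \<in> I \<Longrightarrow> \<nu> w u = \<nu> w x"
      using strip[OF x'] by blast
    have nz: "u \<noteq> 0" "v \<noteq> 0" "U \<noteq> 0" using u(1-3) U(1-3) by auto
    have "prime_or_unit_in A (x * v)"
      unfolding prime_or_unit_in_def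
    proof (intro conjI ballI impI)
      have iff: "dvd_in A (x * v) y \<longleftrightarrow> dvd_in A x y" if "y \<in> A" for y
      proof
        show "dvd_in A (x * v) y \<Longrightarrow> dvd_in A x y"
          unfolding dvd_in_def using u by (metis mult.assoc mult_mem)
        assume "dvd_in A x y"
        then obtain z where "z \<in> A" "y = x * z" unfolding dvd_in_def by blast
        moreover have "x * v * (u * z) = x * z * (u * v)"
          by (simp add: mult_ac)
        ultimately have "y = x * v * (u * z)" "u * z \<in> A"
          using u by auto
        then show "dvd_in A (x * v) y" unfolding dvd_in_def by blast
      qed
      fix y z assume "y \<in> A" "z \<in> A" "dvd_in A (x * v) (y * z)"
      then show "dvd_in A (x * v) y \<or> dvd_in A (x * v) z"
        using iff prime_or_unit_inD(3)[OF x] by (meson mult_mem)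
    qed (use x' u nz in auto)
    moreover have "\<nu> w (x * v) = 0" if "w \<in> I" for w
      using mult[OF that x'(1) u(2) x'(2) nz(2)] inv[OF that u(1-3)] u(4)[OF that] by simp
    ultimately have "prime_or_unit_in B (x * v)"
      using pu by blast
    moreover have "prod_list (x # xs) = prod_list ((x * v) # rs) * (u * U)"
    proof -
      have "prod_list ((x * v) # rs) * (u * U) = x * (prod_list rs * U) * (u * v)"
        by (simp add: mult_ac)
      then show ?thesis using U(3,5) u(3) by simp
    qed
    moreover have "(u * U) * (v * V) = 1"
    proof -
      have "(u * U) * (v * V) = (u * v) * (U * V)" by (simp add: mult_ac)
      then show ?thesis using U(3,5) u(3) by simp
    qed
    moreover have "\<nu> w (u * U) = \<nu> w (prod_list (x # xs))" if "w \<in> I" for w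
      using mult[OF that u(1) U(1) nz(1,3)] mult[OF that x'(1) xs(1) x'(2) xs(2)] u(4)[OF that] U(6)[OF that]
      by simp
    moreover have "set ((x * v) # rs) \<subseteq> {p. prime_or_unit_in B p}"
      using U(4) calculation(1) by auto
    ultimately show ?case
      using u(1-3) U(1-3) by (intro exI[of _ "u * U"] exI[of _ "v * V"] exI[of _ "(x * v) # rs"]) blast
  qed
  show ?thesis
    unfolding factorial_subring_def
  proof (intro ballI impI)
    fix x assume x: "x \<in> B" "x \<noteq> 0"
    then have xA: "x \<in> A" and x\<nu>: "\<And>w. w \<in> I \<Longrightarrow> \<nu> w x \<ge> 0"
      unfolding B by auto
    obtain xs where xs: "set xs \<subseteq> {p. prime_or_unit_in A p}" "x = prod_list xs"
      using factorial_subringE[OF fact xA x(2)] .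
    obtain U V rs where U: "U \<in> A" "V \<in> A" "U * V = 1" "set rs \<subseteq> {p. prime_or_unit_in B p}"
      "x = prod_list rs * U" "\<And>w. w \<in> I \<Longrightarrow> \<nu> w U = \<nu> w x"
      using decomp[OF xs(1)] unfolding xs(2)[symmetric] by blast
    obtain u v ps where uv: "u \<in> A" "v \<in> A" "u * v = 1" "\<forall>w\<in>I. \<nu> w u = \<nu> w x"
      "(\<forall>w\<in>I. \<nu> w x \<ge> 0) \<longrightarrow> set ps \<subseteq> p ` I \<and> u = prod_list ps"
      using strip[OF xA x(2)] by (elim exE conjE) (rule that; assumption)
    have "set ps \<subseteq> p ` I \<and> u = prod_list ps"
      by (rule mp[OF uv(5)]) (intro ballI x\<nu>)
    note u = uv(1-3) bspec[OF uv(4)] conjunct1[OF this] conjunct2[OF this]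
    have nz: "u \<noteq> 0" "v \<noteq> 0" "U \<noteq> 0" "V \<noteq> 0" using u(1-3) U(1-3) by auto
    \<comment> \<open>\<open>U\<close> and the product \<open>u\<close> of the \<open>p w\<close>
      have the same values, so their quotient is a unit of \<open>B\<close>.\<close>
    have "\<nu> w (U * v) = 0" "\<nu> w (V * u) = 0" if "w \<in> I" for w
      using mult[OF that U(1) u(2) nz(3,2)] mult[OF that U(2) u(1) nz(4,1)]
        inv[OF that u(1-3)] inv[OF that U(1-3)] u(4)[OF that] U(6)[OF that] by auto
    then have "U * v \<in> B" "V * u \<in> B"
      using u(1,2) U(1,2) unfolding B by auto
    moreover have "(U * v) * (V * u) = 1"
    proof -
      have "(U * v) * (V * u) = (u * v) * (U * V)" by (simp add: mult_ac)
      then show ?thesis using U(3,5) u(3) by simp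
    qed
    ultimately have "prime_or_unit_in B (U * v)"
      by (rule B.prime_or_unit_if_unit)
    moreover have "x = prod_list (rs @ (U * v) # ps)"
    proof -
      have "prod_list (rs @ (U * v) # ps) = prod_list rs * U * (u * v)"
        by (simp add: u(6) mult_ac)
      then show ?thesis using U(3,5) u(3) by simp
    qed
    ultimately show "\<exists>ps. set ps \<subseteq> {p. prime_or_unit_in B p} \<and> x = prod_list ps"
      using U(4) u(5) p_prime by (intro exI[of _ "rs @ (U * v) # ps"]) auto
  qed
qed

end

subsection \<open>Normality and factoriality\<close>

lemma to_fract_sum: "to_fract (sum f I) = (\<Sum>i\<in>I. to_fract (f i))"
  by (induction I rule: infinite_finite_induct) auto

lemma to_fract_power: "to_fract (x ^ n) = to_fract x ^ n"
  by (induction n) auto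

context type_subring
begin

text \<open>The integral equation of \<open>a / b\<close>, multiplied by \<open>b ^ n\<close>, is
  the homogeneous equation of \<open>factorial_subring_integrally_closed\<close>. The ambient ring
  is only a domain, so the quotient is taken in its field of fractions.\<close>

lemma normal_subring_if_factorial:
  assumes fact: "factorial_subring A"
  shows "normal_subring ((\<lambda>a. Fract a 1) ` A)"
  unfolding normal_subring_def
proof (intro ballI impI)
  fix a b :: "'a fract"
  assume "a \<in> (\<lambda>a. Fract a 1) ` A" "b \<in> (\<lambda>a. Fract a 1) ` A" and b0: "b \<noteq> 0"
    and int: "integral_over ((\<lambda>a. Fract a 1) ` A) (a / b)"
  then obtain x y where x: "x \<in> A" "a = to_fract x" and y: "y \<in> A" "b = to_fract y"
    unfolding to_fract_def by auto
  obtain p :: "'a fract poly" where p: "Polynomial.lead_coeff p = 1"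
    "\<And>i. Polynomial.coeff p i \<in> (\<lambda>a. Fract a 1) ` A" "poly p (a / b) = 0"
    using int unfolding integral_over_def by blast
  then obtain c where c: "\<And>i. c i \<in> A" "\<And>i. Polynomial.coeff p i = to_fract (c i)"
    unfolding to_fract_def image_iff by metis
  define n where "n = Polynomial.degree p"
  have "0 = b ^ n * (\<Sum>i\<le>n. Polynomial.coeff p i * (a / b) ^ i)"
    using p(3) unfolding poly_altdef n_def by simp
  also have "\<dots> = (\<Sum>i\<le>n. Polynomial.coeff p i * a ^ i * b ^ (n - i))"
    unfolding sum_distrib_left
  proof (rule sum.cong)
    fix i assume "i \<in> {..n}"
    then have "b ^ n = b ^ i * b ^ (n - i)"
      by (simp add: power_add[symmetric])
    then show "b ^ n * (Polynomial.coeff p i * (a / b) ^ i) = Polynomial.coeff p i * a ^ i * b ^ (n - i)"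
      using b0 by (simp add: power_divide)
  qed simp
  also have "\<dots> = a ^ n + (\<Sum>i<n. Polynomial.coeff p i * a ^ i * b ^ (n - i))"
    using p(1) unfolding n_def[symmetric] lessThan_Suc_atMost[symmetric] by simp
  finally have "a ^ n = (\<Sum>i<n. - Polynomial.coeff p i * a ^ i * b ^ (n - i))"
    by (simp add: sum_negf eq_neg_iff_add_eq_0)
  then have "to_fract (x ^ n) = to_fract (\<Sum>i<n. - c i * x ^ i * y ^ (n - i))"
    unfolding x y c(2) by (simp add: to_fract_sum to_fract_power)
  then have "x ^ n = (\<Sum>i<n. - c i * x ^ i * y ^ (n - i))"
    by (simp only: to_fract_eq_iff)
  then have "dvd_in A y x"
    using factorial_subring_integrally_closed[OF fact x(1) y(1), of "\<lambda>i. - c i" n] c b0 y by auto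
  then obtain z where z: "z \<in> A" "x = y * z"
    unfolding dvd_in_def by blast
  then have "a / b = to_fract z"
    using b0 x y by simp
  then show "a / b \<in> (\<lambda>a. Fract a 1) ` A"
    using z unfolding to_fract_def by simp
qed

lemma subring_of_type_sel [simp]:
  "carrier (subring_of_type A) = A" "monoid.mult (subring_of_type A) = (*)" "add (subring_of_type A) = (+)"
  "monoid.one (subring_of_type A) = 1" "ring.zero (subring_of_type A) = 0"
  by (simp_all add: ring_of_type_algebra_def)

lemma domain_subring_of_type: "domain (subring_of_type A)"
proof -
  have "\<exists>y\<in>A. y + x = 0" if "x \<in> A" for x
    using that by (intro bexI[of _ "- x"]) auto
  then have "cring (subring_of_type A)"
    by (intro cringI abelian_groupI comm_monoidI) (auto simp: algebra_simps)
  then show ?thesis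
    by (intro domain.intro domain_axioms.intro) auto
qed

lemma comm_monoid_cancel_mult_of:
  "comm_monoid_cancel (Ring_Divisibility.mult_of (subring_of_type A))"
proof -
  interpret R: domain "subring_of_type A"
    by (rule domain_subring_of_type)
  show ?thesis
    by (rule R.mult_of.comm_monoid_cancel_axioms)
qed

text \<open>\<open>factorial_domain\<close> asks for factorizations into irreducible elements,
  unique up to order and associates. Existence comes from nonunit primes being irreducible.
  Uniqueness comes from the primeness condition: an irreducible element is associated to a nonunit
  prime of its factorization, hence prime.\<close>

lemma factorial_domain_if_factorial:
  assumes fact: "factorial_subring A"
  shows "factorial_domain (subring_of_type A)"
proof -
  let ?R = "subring_of_type A"
  let ?G = "Ring_Divisibility.mult_of ?R"
  interpret G: comm_monoid_cancel ?G
    by (rule comm_monoid_cancel_mult_of)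
  have G [simp]: "carrier ?G = A - {0}" "monoid.mult ?G = (*)" "monoid.one ?G = 1"
    by (simp_all add: Ring_Divisibility.mult_of_def)
  have div_iff: "a divides\<^bsub>?G\<^esub> b \<longleftrightarrow> dvd_in A a b" if "a \<in> A - {0}" "b \<in> A - {0}" for a b
    using that unfolding factor_def dvd_in_def by auto
  have unit_iff: "a \<in> Units ?G \<longleftrightarrow> dvd_in A a 1" if "a \<in> A - {0}" for a
    using that unfolding Units_def dvd_in_def by (auto simp: mult.commute)
  have prime: "Divisibility.prime ?G p" if "prime_or_unit_in A p" "\<not> dvd_in A p 1" for p
    unfolding Divisibility.prime_def
  proof (intro conjI ballI impI)
    note p = prime_or_unit_inD[OF that(1)]
    show "p \<notin> Units ?G"
      using unit_iff p that(2) by auto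
    fix a b assume ab: "a \<in> carrier ?G" "b \<in> carrier ?G" "p divides\<^bsub>?G\<^esub> a \<otimes>\<^bsub>?G\<^esub> b"
    have mem: "p \<in> A - {0}" "a \<in> A - {0}" "b \<in> A - {0}" "a * b \<in> A - {0}"
      using p(1,2) ab(1,2) unfolding G(1) by simp_all
    have "dvd_in A p (a * b)"
      using ab(3) unfolding div_iff[OF mem(1,4)] G(2) .
    then have "dvd_in A p a \<or> dvd_in A p b"
      using p(3)[of a b] mem by simp
    then show "p divides\<^bsub>?G\<^esub> a \<or> p divides\<^bsub>?G\<^esub> b"
      unfolding div_iff[OF mem(1,2)] div_iff[OF mem(1,3)] .
  qed
  interpret P: primeness_condition_monoid ?G
  proof
    fix a assume a: "a \<in> carrier ?G" and irr: "Divisibility.irreducible ?G a"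
    then have aA: "a \<in> A" "a \<noteq> 0" and nonunit: "\<not> dvd_in A a 1"
      using unit_iff unfolding Divisibility.irreducible_def by auto
    obtain ps where ps: "set ps \<subseteq> {p. prime_or_unit_in A p}" "a = prod_list ps"
      using factorial_subringE[OF fact aA] .
    have "\<exists>p\<in>set ps. \<not> dvd_in A p 1"
    proof (rule ccontr)
      assume *: "\<not> ?thesis"
      have "dvd_in A (prod_list qs) 1" if "\<forall>p\<in>set qs. dvd_in A p 1" for qs
        using that
      proof (induction qs)
        case (Cons q qs)
        then obtain x y where "x \<in> A" "1 = q * x" "y \<in> A" "1 = prod_list qs * y"
          unfolding dvd_in_def by auto
        then have "1 = (q * x) * (prod_list qs * y)"
          by simp
        also have "\<dots> = prod_list (q # qs) * (x * y)"
          by (simp add: mult_ac)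
        finally have "1 = prod_list (q # qs) * (x * y)" .
        then show ?case
          unfolding dvd_in_def using \<open>x \<in> A\<close> \<open>y \<in> A\<close> by blast
      qed simp
      then show False
        using * nonunit ps by blast
    qed
    then obtain p where p: "p \<in> set ps" "\<not> dvd_in A p 1"
      by blast
    have pu: "prime_or_unit_in A p"
      using ps p by auto
    then have pA: "p \<in> carrier ?G"
      by (simp add: prime_or_unit_inD)
    obtain xs ys where "ps = xs @ p # ys"
      using p(1) by (meson split_list)
    then have "a = p * prod_list (xs @ ys)" "prod_list (xs @ ys) \<in> A"
      using ps by (auto simp: mult_ac prime_or_unit_in_def intro!: prod_list_mem mult_mem)
    then have "p divides\<^bsub>?G\<^esub> a"
      using div_iff pA a unfolding dvd_in_def by auto
    moreover have "a divides\<^bsub>?G\<^esub> p"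
      using irr pA p(2) unit_iff[of p] \<open>p divides\<^bsub>?G\<^esub> a\<close> unfolding Divisibility.irreducible_def properfactor_def
      by auto
    ultimately have "p \<sim>\<^bsub>?G\<^esub> a"
      unfolding associated_def by blast
    then show "Divisibility.prime ?G a"
      using G.prime_cong[OF prime[OF pu p(2)]] pA a by blast
  qed
  have "factorial_monoid ?G"
  proof (rule G.factorial_monoidI)
    fix a assume a: "a \<in> carrier ?G" "a \<notin> Units ?G"
    then obtain ps where ps: "set ps \<subseteq> {p. prime_or_unit_in A p}" "a = prod_list ps"
      using factorial_subringE[OF fact, of a] by auto
    have "\<exists>fs. set fs \<subseteq> carrier ?G \<and> wfactors ?G fs (prod_list ps)" if "set ps \<subseteq> {p. prime_or_unit_in A p}" for ps
      using that
    proof (induction ps)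
      case Nil
      then show ?case by (intro exI[of _ "[]"]) (auto simp: wfactors_def)
    next
      case (Cons p ps)
      then obtain fs where fs: "set fs \<subseteq> carrier ?G" "wfactors ?G fs (prod_list ps)"
        by auto
      have p: "prime_or_unit_in A p" "p \<in> carrier ?G"
        using Cons.prems by (auto simp: prime_or_unit_in_def)
      have psG: "prod_list ps \<in> carrier ?G"
        using Cons.prems by (auto simp: prime_or_unit_in_def prod_list_zero_iff intro!: prod_list_mem)
      have fsG: "foldr (\<otimes>\<^bsub>?G\<^esub>) fs \<one>\<^bsub>?G\<^esub> \<in> carrier ?G"
        using fs(1) by (rule G.multlist_closed)
      have assoc: "foldr (\<otimes>\<^bsub>?G\<^esub>) fs \<one>\<^bsub>?G\<^esub> \<sim>\<^bsub>?G\<^esub> prod_list ps"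
        using fs(2) unfolding wfactors_def by blast
      show ?case
      proof (cases "dvd_in A p 1")
        case True
        then have "p \<in> Units ?G"
          using unit_iff p by simp
        then have "prod_list (p # ps) \<sim>\<^bsub>?G\<^esub> prod_list ps"
          using p psG by (intro G.associatedI2[of p]) (auto simp: mult.commute)
        then have "prod_list ps \<sim>\<^bsub>?G\<^esub> prod_list (p # ps)"
          by (rule G.associated_sym)
        then have "foldr (\<otimes>\<^bsub>?G\<^esub>) fs \<one>\<^bsub>?G\<^esub> \<sim>\<^bsub>?G\<^esub> prod_list (p # ps)"
          using G.associated_trans[OF assoc] fsG p psG by auto
        then show ?thesis
          using fs unfolding wfactors_def by blast
      next
        case False
        have "Divisibility.irreducible ?G p"
          using G.prime_irreducible[OF prime[OF p(1) False]] .
        moreover have "p \<otimes>\<^bsub>?G\<^esub> foldr (\<otimes>\<^bsub>?G\<^esub>) fs \<one>\<^bsub>?G\<^esub> \<sim>\<^bsub>?G\<^esub> p \<otimes>\<^bsub>?G\<^esub> prod_list ps"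
          using G.mult_cong_r[OF assoc p(2) fsG psG] .
        ultimately show ?thesis
          using fs p unfolding wfactors_def by (intro exI[of _ "p # fs"]) auto
      qed
    qed
    then show "\<exists>fs. set fs \<subseteq> carrier ?G \<and> wfactors ?G fs a"
      using ps by blast
  next
    fix a fs fs'
    assume "a \<in> carrier ?G" "set fs \<subseteq> carrier ?G" "set fs' \<subseteq> carrier ?G" "wfactors ?G fs a" "wfactors ?G fs' a"
    then show "essentially_equal ?G fs fs'"
      using P.wfactors_unique by blast
  qed
  then show ?thesis
    by (intro factorial_domain.intro domain_subring_of_type)
qed

end

subsection \<open>The Laurent polynomial ring\<close>

lemma poly_mapping_eq_sum_single:
  "a = (\<Sum>u\<in>Poly_Mapping.keys a. Poly_Mapping.single u (Poly_Mapping.lookup a u))"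
  by (rule poly_mapping_eqI)
    (simp add: lookup_sum lookup_single when_def sum.If_cases in_keys_iff Int_def)

text \<open>Exponents form a group, so for given \<open>u\<close> and \<open>w\<close> the
  complementary exponent \<open>w - u\<close> is determined and the convolution runs over the
  support of one factor.\<close>

lemma lookup_times_sum:
  fixes a b :: "'a::ab_group_add \<Rightarrow>\<^sub>0 'b::comm_semiring_0"
  shows "Poly_Mapping.lookup (a * b) w
    = (\<Sum>u\<in>Poly_Mapping.keys a. Poly_Mapping.lookup a u * Poly_Mapping.lookup b (w - u))"
proof -
  have eq: "w = u + q \<longleftrightarrow> q = w - u" for u q :: 'a
    by (auto simp: algebra_simps)
  have "Poly_Mapping.lookup (a * b) w
      = Sum_any (\<lambda>u. Poly_Mapping.lookup a u * Poly_Mapping.lookup b (w - u))"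
    unfolding lookup_mult eq by simp
  also have "\<dots> = (\<Sum>u\<in>Poly_Mapping.keys a. Poly_Mapping.lookup a u * Poly_Mapping.lookup b (w - u))"
    by (rule Sum_any.expand_superset) (auto simp: in_keys_iff)
  finally show ?thesis .
qed

lemma lookup_times_single:
  fixes a :: "'a::ab_group_add \<Rightarrow>\<^sub>0 'b::comm_semiring_0"
  shows "Poly_Mapping.lookup (a * Poly_Mapping.single v c) w = Poly_Mapping.lookup a (w - v) * c"
proof -
  have "Poly_Mapping.lookup (a * Poly_Mapping.single v c) w =
      (\<Sum>u\<in>Poly_Mapping.keys a. if u = w - v then Poly_Mapping.lookup a u * c else 0)"
    unfolding lookup_times_sum by (intro sum.cong) (auto simp: lookup_single when_def algebra_simps)
  then show ?thesis
    by (simp add: sum.delta in_keys_iff)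
qed

definition laurent :: "nat \<Rightarrow> ((nat \<Rightarrow>\<^sub>0 int) \<Rightarrow>\<^sub>0 'a::field) set"
  where "laurent n = {a. \<forall>u\<in>Poly_Mapping.keys a. Poly_Mapping.keys u \<subseteq> {..<n}}"

lemma laurent_lookup_zero:
  assumes "a \<in> laurent n" "\<not> Poly_Mapping.keys u \<subseteq> {..<n}"
  shows "Poly_Mapping.lookup a u = 0"
proof (rule ccontr)
  assume "Poly_Mapping.lookup a u \<noteq> 0"
  then have "u \<in> Poly_Mapping.keys a"
    by (simp add: in_keys_iff)
  then show False
    using assms unfolding laurent_def by blast
qed

lemma type_subring_laurent: "type_subring (laurent n)"
proof
  show "1 \<in> laurent n"
    unfolding laurent_def by simp
  show "a - b \<in> laurent n" if "a \<in> laurent n" "b \<in> laurent n" for a b :: "(nat \<Rightarrow>\<^sub>0 int) \<Rightarrow>\<^sub>0 'a"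
  proof -
    have "Poly_Mapping.keys (a - b) \<subseteq> Poly_Mapping.keys a \<union> Poly_Mapping.keys b"
      by (auto simp: in_keys_iff lookup_minus)
    then show ?thesis
      using that unfolding laurent_def by blast
  qed
  show "a * b \<in> laurent n" if "a \<in> laurent n" "b \<in> laurent n" for a b :: "(nat \<Rightarrow>\<^sub>0 int) \<Rightarrow>\<^sub>0 'a"
    unfolding laurent_def
  proof (intro CollectI ballI)
    fix w assume "w \<in> Poly_Mapping.keys (a * b)"
    then obtain u u' where "u \<in> Poly_Mapping.keys a" "u' \<in> Poly_Mapping.keys b" "w = u + u'"
      using keys_mult[of a b] by blast
    then show "Poly_Mapping.keys w \<subseteq> {..<n}"
      using that Poly_Mapping.keys_add[of u u'] unfolding laurent_def by blast
  qed
qed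

lemma single_mem_laurent: "Poly_Mapping.keys u \<subseteq> {..<n} \<Longrightarrow> Poly_Mapping.single u c \<in> laurent n"
  unfolding laurent_def by simp

text \<open>Puts the ring in one more variable into the shape that
  \<open>factorial_laurent_extension\<close> requires, for an induction on the number of
  variables.\<close>

lemma laurent_Suc:
  fixes n :: nat
  defines "t \<equiv> Poly_Mapping.single (Poly_Mapping.single n 1) 1"
    and "s \<equiv> Poly_Mapping.single (Poly_Mapping.single n (- 1)) 1"
  shows "laurent (Suc n) = {poly f t * s ^ k | f k. f \<in> polys_over (laurent n :: ((nat \<Rightarrow>\<^sub>0 int) \<Rightarrow>\<^sub>0 'a::field) set)}"
    (is "_ = ?L")
    and "f \<in> polys_over (laurent n :: ((nat \<Rightarrow>\<^sub>0 int) \<Rightarrow>\<^sub>0 'a::field) set) \<Longrightarrow> poly f t = 0 \<Longrightarrow> f = 0"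
    and "t * s = 1"
proof -
  interpret B: type_subring "laurent n :: ((nat \<Rightarrow>\<^sub>0 int) \<Rightarrow>\<^sub>0 'a) set"
    by (rule type_subring_laurent)
  interpret B': type_subring "laurent (Suc n) :: ((nat \<Rightarrow>\<^sub>0 int) \<Rightarrow>\<^sub>0 'a) set"
    by (rule type_subring_laurent)
  show ts: "t * s = (1 :: (nat \<Rightarrow>\<^sub>0 int) \<Rightarrow>\<^sub>0 'a)"
    unfolding t_def s_def mult_single by (simp flip: single_add)
  have tpow: "(t :: (nat \<Rightarrow>\<^sub>0 int) \<Rightarrow>\<^sub>0 'a) ^ k = Poly_Mapping.single (Poly_Mapping.single n (int k)) 1" for k
    by (induction k) (simp_all add: t_def mult_single single_add[symmetric] add.commute)
  have spow: "(s :: (nat \<Rightarrow>\<^sub>0 int) \<Rightarrow>\<^sub>0 'a) ^ k = Poly_Mapping.single (Poly_Mapping.single n (- int k)) 1" for k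
    by (induction k) (simp_all add: s_def mult_single single_add[symmetric] add.commute)
  show inj: "f = 0" if f: "f \<in> polys_over (laurent n :: ((nat \<Rightarrow>\<^sub>0 int) \<Rightarrow>\<^sub>0 'a) set)" and "poly f t = 0" for f
  proof (rule Polynomial.poly_eqI, rule poly_mapping_eqI)
    fix j u
    let ?c = "\<lambda>i. Polynomial.coeff f i"
    show "Poly_Mapping.lookup (?c j) u = Poly_Mapping.lookup (Polynomial.coeff 0 j) u"
    proof (cases "Poly_Mapping.keys u \<subseteq> {..<n}")
      case False
      then show ?thesis
        using f laurent_lookup_zero unfolding polys_over_def by fastforce
    next
      case True
      have un: "Poly_Mapping.lookup u n = 0"
        using True by (auto simp: in_keys_iff)
      \<comment> \<open>The coefficients of \<open>f\<close> do not involve the variable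
        \<open>n\<close>, so the exponent of that variable in \<open>?w\<close> singles out the
        \<open>j\<close>-th summand of \<open>poly f t\<close>.\<close>
      let ?w = "u + Poly_Mapping.single n (int j)"
      have *: "Poly_Mapping.lookup (?c i * t ^ i) ?w = (if i = j then Poly_Mapping.lookup (?c j) u else 0)" for i
      proof (cases "i = j")
        case True
        then show ?thesis
          unfolding tpow lookup_times_single by simp
      next
        case False
        have "Poly_Mapping.lookup (?w - Poly_Mapping.single n (int i)) n \<noteq> 0"
          using un False by (simp add: lookup_minus lookup_add)
        then have "\<not> Poly_Mapping.keys (?w - Poly_Mapping.single n (int i)) \<subseteq> {..<n}"
          by (metis in_keys_iff lessThan_iff less_irrefl subsetD)
        then have "Poly_Mapping.lookup (?c i) (?w - Poly_Mapping.single n (int i)) = 0"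
          using f laurent_lookup_zero unfolding polys_over_def by fastforce
        then show ?thesis
          using False unfolding tpow lookup_times_single by simp
      qed
      have "0 = Poly_Mapping.lookup (poly f t) ?w"
        using that by simp
      also have "\<dots> = (\<Sum>i\<le>Polynomial.degree f. Poly_Mapping.lookup (?c i * t ^ i) ?w)"
        by (simp add: poly_altdef lookup_sum)
      also have "\<dots> = (if j \<le> Polynomial.degree f then Poly_Mapping.lookup (?c j) u else 0)"
        unfolding * by (simp add: sum.delta)
      also have "\<dots> = Poly_Mapping.lookup (?c j) u"
        by (simp add: Polynomial.coeff_eq_0)
      finally show ?thesis by simp
    qed
  qed
  interpret L: type_subring ?L
    by (rule B.type_subring_laurent_extension[OF ts])
  have tL: "t ^ k \<in> ?L" for k
  proof -
    have "t ^ k = poly (Polynomial.monom 1 k) t * s ^ 0"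
      by (simp add: poly_monom)
    then show ?thesis
      using B.monom_mem_polys_over[OF B.one_mem, of k] by blast
  qed
  have sL: "s ^ k \<in> ?L" for k
  proof -
    have "s ^ k = poly [:1:] t * s ^ k"
      by simp
    then show ?thesis
      using B.const_mem_polys_over B.one_mem by blast
  qed
  have cL: "b \<in> ?L" if "b \<in> laurent n" for b
  proof -
    have "b = poly [:b:] t * s ^ 0"
      by simp
    then show ?thesis
      using B.const_mem_polys_over that by blast
  qed
  show "laurent (Suc n) = ?L"
  proof (intro equalityI subsetI)
    fix a :: "(nat \<Rightarrow>\<^sub>0 int) \<Rightarrow>\<^sub>0 'a" assume a: "a \<in> laurent (Suc n)"
    have single: "Poly_Mapping.single u c \<in> ?L" if u: "Poly_Mapping.keys u \<subseteq> {..<Suc n}" for u :: "nat \<Rightarrow>\<^sub>0 int" and c :: 'a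
    proof -
      define l where "l = Poly_Mapping.lookup u n"
      define u' where "u' = u - Poly_Mapping.single n l"
      have "Poly_Mapping.keys u' \<subseteq> {..<n}"
      proof
        fix i assume "i \<in> Poly_Mapping.keys u'"
        then have "Poly_Mapping.lookup u i \<noteq> 0 \<and> i \<noteq> n"
          unfolding u'_def l_def by (auto simp: in_keys_iff lookup_minus lookup_single when_def split: if_splits)
        then show "i \<in> {..<n}"
          using u by (metis in_keys_iff lessThan_iff less_SucE subsetD)
      qed
      then have c1: "Poly_Mapping.single u' c \<in> ?L"
        by (intro cL single_mem_laurent)
      have c2: "Poly_Mapping.single (Poly_Mapping.single n l) 1 \<in> ?L"
      proof (cases "l \<ge> 0")
        case True
        then show ?thesis using tL[of "nat l"] unfolding tpow by simp
      next
        case False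
        then show ?thesis using sL[of "nat (- l)"] unfolding spow by simp
      qed
      have eq: "Poly_Mapping.single u c = Poly_Mapping.single u' c * Poly_Mapping.single (Poly_Mapping.single n l) 1"
        unfolding mult_single u'_def by simp
      show ?thesis
        by (subst eq) (rule L.mult_mem[OF c1 c2])
    qed
    have "Poly_Mapping.keys u \<subseteq> {..<Suc n}" if "u \<in> Poly_Mapping.keys a" for u
      using a that unfolding laurent_def by blast
    then have "(\<Sum>u\<in>Poly_Mapping.keys a. Poly_Mapping.single u (Poly_Mapping.lookup a u)) \<in> ?L"
      by (intro L.sum_mem single)
    then show "a \<in> ?L"
      by (rule ssubst[where P = "\<lambda>x. x \<in> ?L", OF poly_mapping_eq_sum_single[of a]])
  next
    fix a :: "(nat \<Rightarrow>\<^sub>0 int) \<Rightarrow>\<^sub>0 'a" assume "a \<in> ?L"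
    then obtain f k where f: "f \<in> polys_over (laurent n)" "a = poly f t * s ^ k"
      by blast
    have "t ^ i \<in> laurent (Suc n)" "s ^ i \<in> laurent (Suc n)" for i
      unfolding tpow spow by (intro single_mem_laurent; auto)+
    moreover have "Polynomial.coeff f i \<in> laurent (Suc n)" for i
      using f(1) unfolding polys_over_def laurent_def by (fastforce simp: less_Suc_eq)
    ultimately show "a \<in> laurent (Suc n)"
      unfolding f(2) poly_altdef by (intro B'.mult_mem B'.sum_mem)
  qed
qed

theorem factorial_laurent: "factorial_subring (laurent n :: ((nat \<Rightarrow>\<^sub>0 int) \<Rightarrow>\<^sub>0 'a::field) set)"
proof (induction n)
  case 0
  interpret B: type_subring "laurent 0 :: ((nat \<Rightarrow>\<^sub>0 int) \<Rightarrow>\<^sub>0 'a) set"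
    by (rule type_subring_laurent)
  show ?case
    unfolding factorial_subring_def
  proof (intro ballI impI)
    fix a :: "(nat \<Rightarrow>\<^sub>0 int) \<Rightarrow>\<^sub>0 'a" assume a: "a \<in> laurent 0" "a \<noteq> 0"
    \<comment> \<open>Without variables the ring is the field of coefficients, so a nonzero element
      is a unit.\<close>
    define c where "c = Poly_Mapping.lookup a 0"
    have sub: "Poly_Mapping.keys a \<subseteq> {0}"
      using a(1) unfolding laurent_def by (auto simp flip: keys_eq_empty)
    have eq: "a = Poly_Mapping.single 0 c"
      by (rule poly_mapping_eqI) (use sub in \<open>auto simp: c_def lookup_single when_def in_keys_iff\<close>)
    then have "c \<noteq> 0"
      using a(2) by auto
    then have "a * Poly_Mapping.single 0 (inverse c) = 1"
      unfolding eq mult_single by simp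
    then have "prime_or_unit_in (laurent 0) a"
      using a(1) B.prime_or_unit_if_unit single_mem_laurent[of 0 0 "inverse c"] by simp
    then show "\<exists>ps. set ps \<subseteq> {p. prime_or_unit_in (laurent 0) p} \<and> a = prod_list ps"
      by (intro exI[of _ "[a]"]) auto
  qed
next
  case (Suc n)
  then show ?case
    unfolding laurent_Suc(1)
    using type_subring.factorial_laurent_extension[OF type_subring_laurent Suc laurent_Suc(3)]
      laurent_Suc(2) by blast
qed

subsection \<open>Monomial valuations\<close>

text \<open>The value at 0 is arbitrary in place of infinity; this is why every law is stated for
  nonzero elements.\<close>

locale field_valuation =
  fixes V :: "'a::field \<Rightarrow> int"
  assumes mult: "x \<noteq> 0 \<Longrightarrow> y \<noteq> 0 \<Longrightarrow> V (x * y) = V x + V y"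
    and add: "x \<noteq> 0 \<Longrightarrow> y \<noteq> 0 \<Longrightarrow> x + y \<noteq> 0 \<Longrightarrow> min (V x) (V y) \<le> V (x + y)"
begin

lemma one [simp]: "V 1 = 0"
  using mult[of 1 1] by simp

lemma uminus [simp]: "V (- x) = V x"
proof (cases "x = 0")
  case False
  have "V (- 1) + V (- 1) = V 1"
    using mult[of "- 1" "- 1"] by simp
  then show ?thesis
    using mult[of "- 1" x] False by simp
qed simp

lemma inverse: "x \<noteq> 0 \<Longrightarrow> V (inverse x) = - V x"
  using mult[of x "inverse x"] by simp

lemma divide: "x \<noteq> 0 \<Longrightarrow> y \<noteq> 0 \<Longrightarrow> V (x / y) = V x - V y"
  using mult[of x "inverse y"] inverse[of y] by (simp add: divide_inverse)

lemma power: "x \<noteq> 0 \<Longrightarrow> V (x ^ n) = int n * V x"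
  by (induction n) (auto simp: mult algebra_simps)

text \<open>For positive \<open>m\<close> these are the elements of value at least
  \<open>\<gamma> / m\<close>. With 0 included explicitly, the set is closed under sums, whatever
  cancels.\<close>

definition bounded_below :: "int \<Rightarrow> int \<Rightarrow> 'a set"
  where "bounded_below m \<gamma> = {x. x = 0 \<or> \<gamma> \<le> m * V x}"

lemma zero_bounded_below: "0 \<in> bounded_below m \<gamma>"
  unfolding bounded_below_def by simp

lemma add_bounded_below:
  assumes "m \<ge> 0" "x \<in> bounded_below m \<gamma>" "y \<in> bounded_below m \<gamma>"
  shows "x + y \<in> bounded_below m \<gamma>"
proof (cases "x = 0 \<or> y = 0 \<or> x + y = 0")
  case False
  have "m * V x \<le> m * V (x + y) \<or> m * V y \<le> m * V (x + y)"
    using add[of x y] False assms(1) by (auto simp: min_def mult_left_mono split: if_splits)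
  then show ?thesis
    using assms False unfolding bounded_below_def by auto
qed (use assms in \<open>auto simp: bounded_below_def\<close>)

lemma sum_bounded_below:
  assumes "m \<ge> 0" "\<And>i. i \<in> I \<Longrightarrow> f i \<in> bounded_below m \<gamma>"
  shows "sum f I \<in> bounded_below m \<gamma>"
  using assms(2) by (induction I rule: infinite_finite_induct)
    (simp_all add: add_bounded_below[OF assms(1)] zero_bounded_below)

lemma diff_bounded_below:
  assumes "m \<ge> 0" "x \<in> bounded_below m \<gamma>" "y \<in> bounded_below m \<gamma>"
  shows "x - y \<in> bounded_below m \<gamma>"
  using add_bounded_below[OF assms(1,2), of "- y"] assms(3) by (auto simp: bounded_below_def)

text \<open>The Gauss extension of \<open>m * V\<close> that gives the monomial \<open>u\<close> the
  weight \<open>c u\<close>. At \<open>a = 0\<close> it is a minimum over the empty set and carries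
  no meaning.\<close>

definition monomial_val :: "int \<Rightarrow> ('g \<Rightarrow> int) \<Rightarrow> ('g \<Rightarrow>\<^sub>0 'a) \<Rightarrow> int"
  where "monomial_val m c a = Min ((\<lambda>u. m * V (Poly_Mapping.lookup a u) + c u) ` Poly_Mapping.keys a)"

lemma monomial_val_ge_iff:
  "a \<noteq> 0 \<Longrightarrow> \<gamma> \<le> monomial_val m c a \<longleftrightarrow>
    (\<forall>u\<in>Poly_Mapping.keys a. \<gamma> \<le> m * V (Poly_Mapping.lookup a u) + c u)"
  unfolding monomial_val_def by (subst Min_ge_iff) auto

lemma monomial_val_single: "x \<noteq> 0 \<Longrightarrow> monomial_val m c (Poly_Mapping.single u x) = m * V x + c u"
  unfolding monomial_val_def by simp

lemma monomial_val_eq_zero: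
  assumes "a \<noteq> 0" "\<And>u. u \<in> Poly_Mapping.keys a \<Longrightarrow> m * V (Poly_Mapping.lookup a u) + c u = 0"
  shows "monomial_val m c a = 0"
proof -
  have "(\<lambda>u. m * V (Poly_Mapping.lookup a u) + c u) ` Poly_Mapping.keys a = {0}"
    using assms(2) keys_eq_empty[of a] assms(1) by fastforce
  then show ?thesis
    unfolding monomial_val_def by simp
qed

text \<open>Multiplicativity is Gauss's lemma: among the terms of minimal value of either factor,
  the product of the largest ones is not cancelled.\<close>

lemma monomial_val_mult:
  fixes a b :: "'g::linordered_ab_group_add \<Rightarrow>\<^sub>0 'a"
  assumes "a \<noteq> 0" "b \<noteq> 0" and m: "m \<ge> 0"
    and c: "\<And>u w. u \<in> Poly_Mapping.keys a \<Longrightarrow> w \<in> Poly_Mapping.keys b \<Longrightarrow> c (u + w) = c u + c w"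
  shows "monomial_val m c (a * b) = monomial_val m c a + monomial_val m c b"
proof -
  let ?K = "Poly_Mapping.keys" and ?l = "Poly_Mapping.lookup"
  define \<phi> where "\<phi> x u = m * V (?l x u) + c u" for x u
  define \<alpha> where "\<alpha> = monomial_val m c a"
  define \<beta> where "\<beta> = monomial_val m c b"
  have \<alpha>: "\<alpha> \<le> \<phi> a u" if "u \<in> ?K a" for u
    using monomial_val_ge_iff[OF assms(1), of \<alpha>] that unfolding \<alpha>_def \<phi>_def by blast
  have \<beta>: "\<beta> \<le> \<phi> b u" if "u \<in> ?K b" for u
    using monomial_val_ge_iff[OF assms(2), of \<beta>] that unfolding \<beta>_def \<phi>_def by blast
  have tm: "m * V (?l a u * ?l b (k - u)) + c k = \<phi> a u + \<phi> b (k - u)"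
    if "u \<in> ?K a" "k - u \<in> ?K b" for u k
    using that c[OF that] unfolding \<phi>_def by (simp add: mult in_keys_iff algebra_simps)
  have term_mem: "?l a u * ?l b (k - u) \<in> bounded_below m (\<gamma> - c k)"
    if "u \<in> ?K a" "k - u \<in> ?K b \<Longrightarrow> \<gamma> \<le> \<phi> a u + \<phi> b (k - u)" for u k \<gamma>
  proof (cases "k - u \<in> ?K b")
    case True
    then show ?thesis
      using that(2)[OF True] tm[OF that(1) True] unfolding bounded_below_def by simp
  next
    case False
    then show ?thesis unfolding bounded_below_def by (simp add: in_keys_iff)
  qed
  have ab: "a * b \<noteq> 0"
    using assms by simp
  have ge: "\<alpha> + \<beta> \<le> monomial_val m c (a * b)"
    unfolding monomial_val_ge_iff[OF ab]
  proof
    fix k assume k: "k \<in> ?K (a * b)"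
    have "?l (a * b) k \<in> bounded_below m (\<alpha> + \<beta> - c k)"
      unfolding lookup_times_sum using \<alpha> \<beta> by (intro sum_bounded_below[OF m] term_mem add_mono)
    then show "\<alpha> + \<beta> \<le> m * V (?l (a * b) k) + c k"
      using k unfolding bounded_below_def by (auto simp: in_keys_iff)
  qed
  define u0 where "u0 = Max {u \<in> ?K a. \<phi> a u = \<alpha>}"
  define w0 where "w0 = Max {w \<in> ?K b. \<phi> b w = \<beta>}"
  have "\<alpha> \<in> \<phi> a ` ?K a"
    unfolding \<alpha>_def monomial_val_def \<phi>_def using assms(1) by (intro Min_in) auto
  then have "u0 \<in> {u \<in> ?K a. \<phi> a u = \<alpha>}"
    unfolding u0_def by (intro Max_in) auto
  then have u0: "u0 \<in> ?K a" "\<phi> a u0 = \<alpha>"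
    by auto
  have "\<beta> \<in> \<phi> b ` ?K b"
    unfolding \<beta>_def monomial_val_def \<phi>_def using assms(2) by (intro Min_in) auto
  then have "w0 \<in> {w \<in> ?K b. \<phi> b w = \<beta>}"
    unfolding w0_def by (intro Max_in) auto
  then have w0: "w0 \<in> ?K b" "\<phi> b w0 = \<beta>"
    by auto
  define k where "k = u0 + w0"
  have kw: "k - u0 = w0"
    unfolding k_def by simp
  have strict: "\<alpha> + \<beta> + 1 \<le> \<phi> a u + \<phi> b (k - u)" if u: "u \<in> ?K a" "k - u \<in> ?K b" "u \<noteq> u0" for u
  proof (rule ccontr)
    assume "\<not> ?thesis"
    then have eq: "\<phi> a u = \<alpha>" "\<phi> b (k - u) = \<beta>"
      using \<alpha>[OF u(1)] \<beta>[OF u(2)] by linarith+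
    have "u \<le> u0"
      unfolding u0_def using eq u by (intro Max_ge) auto
    moreover have "k - u \<le> w0"
      unfolding w0_def using eq u by (intro Max_ge) auto
    then have "u0 \<le> u"
      unfolding k_def by (simp add: algebra_simps)
    ultimately show False
      using u(3) by simp
  qed
  have rest: "(\<Sum>u\<in>?K a - {u0}. ?l a u * ?l b (k - u)) \<in> bounded_below m (\<alpha> + \<beta> + 1 - c k)"
    using strict by (intro sum_bounded_below[OF m] term_mem) auto
  have split: "?l (a * b) k = ?l a u0 * ?l b w0 + (\<Sum>u\<in>?K a - {u0}. ?l a u * ?l b (k - u))"
    unfolding lookup_times_sum by (subst sum.remove[of _ u0]) (use u0 kw in auto)
  have lead: "?l a u0 * ?l b w0 \<notin> bounded_below m (\<alpha> + \<beta> + 1 - c k)"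
    using tm[of u0 k] u0 w0 kw unfolding bounded_below_def by (simp add: in_keys_iff)
  have "?l (a * b) k \<notin> bounded_below m (\<alpha> + \<beta> + 1 - c k)"
  proof
    assume "?l (a * b) k \<in> bounded_below m (\<alpha> + \<beta> + 1 - c k)"
    from diff_bounded_below[OF m this rest] show False
      using lead unfolding split by simp
  qed
  then have "k \<in> ?K (a * b)" "m * V (?l (a * b) k) + c k \<le> \<alpha> + \<beta>"
    unfolding bounded_below_def by (auto simp: in_keys_iff)
  then have "\<not> \<alpha> + \<beta> + 1 \<le> monomial_val m c (a * b)"
    unfolding monomial_val_ge_iff[OF ab] by force
  then show ?thesis
    using ge unfolding \<alpha>_def \<beta>_def by linarith
qed

end

section \<open>Noetherian subrings\<close>

text \<open>Dependent choice in which the next term may depend on all earlier ones: the recursion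
  carries along the list of the terms chosen so far.\<close>

lemma history_choice:
  assumes "\<And>h :: 'a list. \<exists>x. Q h x"
  shows "\<exists>g. \<forall>n. Q (map g [0..<n]) (g n)"
proof -
  define c where "c h = (SOME x. Q h x)" for h
  define hist where "hist = rec_nat [] (\<lambda>_ h. h @ [c h])"
  have hist: "hist n = map (\<lambda>k. c (hist k)) [0..<n]" for n
    by (induction n) (simp_all add: hist_def)
  have "Q h (c h)" for h
    unfolding c_def using someI_ex[OF assms] .
  then show ?thesis
    using hist by (intro exI[of _ "\<lambda>n. c (hist n)"]) metis
qed

section \<open>Finitely generated ideals and Hilbert's basis theorem\<close>

definition span_upto :: "'a::idom set \<Rightarrow> (nat \<Rightarrow> 'a) \<Rightarrow> nat \<Rightarrow> 'a set"
  where "span_upto A f n = {\<Sum>i<n. r i * f i | r. \<forall>i. r i \<in> A}"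

text \<open>The ascending chain condition for ideals, stated for sequences of generators.\<close>

definition noetherian_subring :: "'a::idom set \<Rightarrow> bool"
  where "noetherian_subring A \<longleftrightarrow> (\<forall>f. range f \<subseteq> A \<longrightarrow> (\<exists>n. f n \<in> span_upto A f n))"

lemma noetherian_subringE:
  assumes "noetherian_subring A" "\<And>n. f n \<in> A"
  obtains n :: nat and r where "\<And>i. r i \<in> A" "f n = (\<Sum>i<n. r i * f i)"
proof -
  have "range f \<subseteq> A"
    using assms(2) by blast
  then obtain n where "f n \<in> span_upto A f n"
    using assms(1) unfolding noetherian_subring_def by blast
  then show ?thesis
    unfolding span_upto_def using that by blast
qed

context type_subring
begin

lemma span_upto_add:
  assumes "x \<in> span_upto A f n" "y \<in> span_upto A f n"
  shows "x + y \<in> span_upto A f n"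
proof -
  obtain r s where "\<forall>i. r i \<in> A" "x = (\<Sum>i<n. r i * f i)" "\<forall>i. s i \<in> A" "y = (\<Sum>i<n. s i * f i)"
    using assms unfolding span_upto_def by blast
  then have "x + y = (\<Sum>i<n. (r i + s i) * f i)" "\<forall>i. r i + s i \<in> A"
    by (auto simp: sum.distrib distrib_right)
  then show ?thesis
    unfolding span_upto_def by (intro CollectI exI[of _ "\<lambda>i. r i + s i"]) blast
qed

lemma span_upto_mult:
  assumes "x \<in> span_upto A f n" "a \<in> A"
  shows "a * x \<in> span_upto A f n"
proof -
  obtain r where "\<forall>i. r i \<in> A" "x = (\<Sum>i<n. r i * f i)"
    using assms unfolding span_upto_def by blast
  then have "a * x = (\<Sum>i<n. (a * r i) * f i)" "\<forall>i. a * r i \<in> A"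
    using assms(2) by (auto simp: sum_distrib_left mult.assoc)
  then show ?thesis
    unfolding span_upto_def by (intro CollectI exI[of _ "\<lambda>i. a * r i"]) blast
qed

lemma span_upto_zero: "0 \<in> span_upto A f n"
  unfolding span_upto_def by (intro CollectI exI[of _ "\<lambda>_. 0"]) simp

lemma span_upto_sum: "(\<And>i. i \<in> I \<Longrightarrow> g i \<in> span_upto A f n) \<Longrightarrow> sum g I \<in> span_upto A f n"
  by (induction I rule: infinite_finite_induct) (simp_all add: span_upto_zero span_upto_add)

lemma span_upto_base:
  assumes "i < n"
  shows "f i \<in> span_upto A f n"
proof -
  have "f i = (\<Sum>j<n. (if j = i then 1 else 0) * f j)"
    using assms by (simp add: if_distrib[of "\<lambda>x. x * _"] sum.delta cong: if_cong)
  then show ?thesis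
    unfolding span_upto_def by (intro CollectI exI[of _ "\<lambda>j. if j = i then 1 else 0"]) simp
qed

lemma span_upto_subset:
  assumes "\<And>i. i < m \<Longrightarrow> g i \<in> span_upto A f n"
  shows "span_upto A g m \<subseteq> span_upto A f n"
proof
  fix x assume "x \<in> span_upto A g m"
  then obtain r where r: "\<And>i. r i \<in> A" "x = (\<Sum>i<m. r i * g i)"
    unfolding span_upto_def by blast
  show "x \<in> span_upto A f n"
    unfolding r(2) using assms r(1) by (intro span_upto_sum span_upto_mult) auto
qed

lemma span_upto_mono: "m \<le> n \<Longrightarrow> span_upto A f m \<subseteq> span_upto A f n"
  by (intro span_upto_subset span_upto_base) simp

text \<open>The classical argument: in an ideal that no finite subset generates, pick successively
  elements of least degree outside the span of their predecessors. A relation among the leading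
  coefficients then yields an element of smaller degree outside that span.\<close>

theorem noetherian_polys_over:
  assumes noeth: "noetherian_subring A"
  shows "noetherian_subring (polys_over A)"
proof (rule ccontr)
  interpret P: type_subring "polys_over A"
    by (rule type_subring_polys_over)
  assume "\<not> noetherian_subring (polys_over A)"
  then obtain f where fP: "range f \<subseteq> polys_over A" and f: "\<And>n. f n \<notin> span_upto (polys_over A) f n"
    unfolding noetherian_subring_def by blast
  define S where "S n = span_upto (polys_over A) f n" for n
  define I where "I = (\<Union>n. S n)"
  have S_mono: "m \<le> n \<Longrightarrow> S m \<subseteq> S n" for m n
    unfolding S_def by (rule P.span_upto_mono)
  have I_P: "x \<in> polys_over A" if "x \<in> I" for x
  proof -
    obtain n r where "\<And>i. r i \<in> polys_over A" "x = (\<Sum>i<n. r i * f i)"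
      using \<open>x \<in> I\<close> unfolding I_def S_def span_upto_def by blast
    then show ?thesis
      using fP by (auto intro!: P.sum_mem P.mult_mem)
  qed
  have I_mult: "a * x \<in> I" if "x \<in> I" "a \<in> polys_over A" for a x
    using that P.span_upto_mult unfolding I_def S_def by blast
  have I_add: "x + y \<in> I" if xy: "x \<in> I" "y \<in> I" for x y
  proof -
    obtain m n where "x \<in> S m" "y \<in> S n"
      using xy unfolding I_def by blast
    then have "x \<in> S (max m n)" "y \<in> S (max m n)"
      using S_mono[of m "max m n"] S_mono[of n "max m n"] by auto
    then have "x + y \<in> S (max m n)"
      unfolding S_def by (rule P.span_upto_add)
    then show ?thesis unfolding I_def by blast
  qed
  have zeroI: "0 \<in> I"
    unfolding I_def S_def using P.span_upto_zero by blast
  have I_sum: "sum g J \<in> I" if "\<And>i. i \<in> J \<Longrightarrow> g i \<in> I" for g :: "nat \<Rightarrow> 'a poly" and J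
    using that by (induction J rule: infinite_finite_induct) (simp_all add: zeroI I_add)
  define sp where "sp h = span_upto (polys_over A) (\<lambda>i. h ! i) (length h)" for h :: "'a poly list"
  \<comment> \<open>A finite subset of \<open>I\<close> lies in a single \<open>S n\<close>, and
    \<open>S n\<close> does not contain \<open>f n\<close>.\<close>
  have escape: "\<exists>x\<in>I. x \<notin> sp h" if h: "set h \<subseteq> I" for h
  proof -
    have "\<exists>n. set h \<subseteq> S n"
      using h
    proof (induction h)
      case (Cons x h)
      then obtain m n where "x \<in> S m" "set h \<subseteq> S n"
        unfolding I_def by auto
      then have "set (x # h) \<subseteq> S (max m n)"
        using S_mono[of m "max m n"] S_mono[of n "max m n"] by auto
      then show ?case by blast
    qed simp
    then obtain n where n: "set h \<subseteq> S n"
      by blast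
    have "sp h \<subseteq> S n"
      unfolding sp_def S_def using n by (intro P.span_upto_subset) (auto simp: S_def)
    then have "f n \<notin> sp h"
      using f unfolding S_def by blast
    moreover have "f n \<in> I"
      unfolding I_def S_def using P.span_upto_base[of n "Suc n"] by blast
    ultimately show ?thesis by blast
  qed
  \<comment> \<open>The condition is vacuous for lists not contained in \<open>I\<close>, so that a
    next term exists after every list; the lists that actually arise lie in
    \<open>I\<close>.\<close>
  define Q where "Q h x \<longleftrightarrow> (set h \<subseteq> I \<longrightarrow> x \<in> I \<and> x \<notin> sp h \<and>
    (\<forall>y. y \<in> I \<and> y \<notin> sp h \<longrightarrow> Polynomial.degree x \<le> Polynomial.degree y))" for h x
  have "\<exists>x. Q h x" for h
  proof (cases "set h \<subseteq> I")
    case True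
    then obtain x where "x \<in> I \<and> x \<notin> sp h"
      using escape by blast
    from ex_has_least_nat[of "\<lambda>x. x \<in> I \<and> x \<notin> sp h", OF this, of Polynomial.degree] show ?thesis
      unfolding Q_def by blast
  qed (simp add: Q_def)
  then obtain g where g: "\<And>n. Q (map g [0..<n]) (g n)"
    using history_choice[of Q] by blast
  have gI: "g n \<in> I" for n
  proof (induction n rule: less_induct)
    case (less n)
    then have "set (map g [0..<n]) \<subseteq> I" by auto
    then show ?case using g[of n] unfolding Q_def by blast
  qed
  define G where "G n = span_upto (polys_over A) g n" for n
  have sp: "sp (map g [0..<n]) = G n" for n
    unfolding sp_def G_def span_upto_def by simp
  have "set (map g [0..<n]) \<subseteq> I" for n
    using gI by auto
  then have g_notin: "g n \<notin> G n" and g_min: "y \<in> I \<Longrightarrow> y \<notin> G n \<Longrightarrow> Polynomial.degree (g n) \<le> Polynomial.degree y" for n y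
    using g[of n] unfolding Q_def sp by blast+
  have gP: "g n \<in> polys_over A" for n
    using gI I_P by blast
  have deg: "Polynomial.degree (g i) \<le> Polynomial.degree (g n)" if "i < n" for i n
  proof (rule g_min)
    show "g n \<notin> G i"
      using g_notin[of n] P.span_upto_mono[of i n g] that unfolding G_def by auto
  qed (rule gI)
  have lc: "Polynomial.lead_coeff (g n) \<in> A" for n
    using gP[of n] unfolding polys_over_def by blast
  obtain n r where r: "\<And>i. r i \<in> A"
    "Polynomial.lead_coeff (g n) = (\<Sum>i<n. r i * Polynomial.lead_coeff (g i))"
    by (rule noetherian_subringE[where f = "\<lambda>n. Polynomial.lead_coeff (g n)", OF noeth lc]) (rule that)
  \<comment> \<open>The monomials raise all \<open>g i\<close> to the degree of \<open>g n\<close>,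
    so that the leading terms cancel in \<open>y\<close>. The subtraction does not truncate, because
    the degrees of the \<open>g i\<close> are nondecreasing.\<close>
  define q where "q i = Polynomial.monom (r i) (Polynomial.degree (g n) - Polynomial.degree (g i))" for i
  define y where "y = g n - (\<Sum>i<n. q i * g i)"
  have q: "q i \<in> polys_over A" for i
    unfolding q_def using r(1) by (rule monom_mem_polys_over)
  have sumG: "(\<Sum>i<n. q i * g i) \<in> G n"
    unfolding G_def span_upto_def using q by blast
  have y_notin: "y \<notin> G n"
  proof
    assume "y \<in> G n"
    then have "y + (\<Sum>i<n. q i * g i) \<in> G n"
      using sumG unfolding G_def by (rule P.span_upto_add)
    then show False
      using g_notin[of n] unfolding y_def by simp
  qed
  have "(\<Sum>i<n. q i * g i) \<in> I"
    using I_mult[OF gI q] by (rule I_sum)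
  then have "- 1 * (\<Sum>i<n. q i * g i) \<in> I"
    by (rule I_mult) simp
  then have yI: "y \<in> I"
    using I_add[OF gI[of n]] unfolding y_def by fastforce
  have "y \<noteq> 0"
    using y_notin P.span_upto_zero unfolding G_def by blast
  have "Polynomial.degree (q i * g i) \<le> Polynomial.degree (g n)" if "i < n" for i
  proof -
    have "Polynomial.degree (q i * g i) \<le> Polynomial.degree (q i) + Polynomial.degree (g i)"
      by (rule Polynomial.degree_mult_le)
    also have "\<dots> \<le> Polynomial.degree (g n)"
      using deg[OF that] Polynomial.degree_monom_le[of "r i" "Polynomial.degree (g n) - Polynomial.degree (g i)"]
      unfolding q_def by linarith
    finally show ?thesis .
  qed
  then have "Polynomial.degree y \<le> Polynomial.degree (g n)"
    unfolding y_def by (intro Polynomial.degree_diff_le Polynomial.degree_sum_le) auto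
  moreover have "Polynomial.degree (g n) \<le> Polynomial.degree y"
    using g_min[OF yI y_notin] .
  ultimately have "Polynomial.coeff y (Polynomial.degree (g n)) \<noteq> 0"
    using \<open>y \<noteq> 0\<close> by (metis Polynomial.leading_coeff_0_iff le_antisym)
  moreover have "Polynomial.coeff (q i * g i) (Polynomial.degree (g n)) = r i * Polynomial.lead_coeff (g i)"
    if "i < n" for i
    using deg[OF that] unfolding q_def by (simp add: Polynomial.coeff_monom_mult)
  then have "Polynomial.coeff y (Polynomial.degree (g n)) = 0"
    unfolding y_def by (simp add: Polynomial.coeff_sum r(2))
  ultimately show False by simp
qed

theorem noetherian_adjoin:
  assumes "noetherian_subring A"
  shows "noetherian_subring {poly f t | f. f \<in> polys_over A}"
  unfolding noetherian_subring_def
proof (intro allI impI)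
  fix F :: "nat \<Rightarrow> 'a" assume "range F \<subseteq> {poly f t | f. f \<in> polys_over A}"
  then have "\<forall>n. \<exists>f. f \<in> polys_over A \<and> F n = poly f t"
    by blast
  then obtain f where f: "\<And>n. f n \<in> polys_over A" "\<And>n. F n = poly (f n) t"
    by metis
  obtain n r where r: "\<And>i. r i \<in> polys_over A" "f n = (\<Sum>i<n. r i * f i)"
    by (rule noetherian_subringE[where f = f, OF noetherian_polys_over[OF assms] f(1)]) (rule that)
  have "F n = (\<Sum>i<n. poly (r i) t * F i)"
    unfolding f(2) r(2) by (simp add: poly_sum)
  then show "\<exists>n. F n \<in> span_upto {poly f t | f. f \<in> polys_over A} F n"
    unfolding span_upto_def using r(1) by (intro exI[of _ n] CollectI exI[of _ "\<lambda>i. poly (r i) t"]) blast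
qed

lemma type_subring_adjoin: "type_subring {poly f t | f. f \<in> polys_over A}"
proof -
  interpret P: type_subring "polys_over A"
    by (rule type_subring_polys_over)
  have mem: "poly f t \<in> {poly f t | f. f \<in> polys_over A}" if "f \<in> polys_over A" for f
    using that by blast
  show ?thesis
  proof
    show "1 \<in> {poly f t | f. f \<in> polys_over A}"
      using mem[OF P.one_mem] by simp
  next
    fix x y assume "x \<in> {poly f t | f. f \<in> polys_over A}" "y \<in> {poly f t | f. f \<in> polys_over A}"
    then obtain f g where fg: "f \<in> polys_over A" "x = poly f t" "g \<in> polys_over A" "y = poly g t"
      by blast
    show "x - y \<in> {poly f t | f. f \<in> polys_over A}"
      using mem[OF P.diff_mem[OF fg(1,3)]] fg by simp
    show "x * y \<in> {poly f t | f. f \<in> polys_over A}"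
      using mem[OF P.mult_mem[OF fg(1,3)]] fg by simp
  qed
qed

end

text \<open>The chain condition for the elements \<open>y\<^sup>n z\<close> takes the place of the determinant trick.\<close>

lemma noetherian_integral:
  fixes y z :: "'a::field"
  assumes "noetherian_subring R" "z \<noteq> 0" "\<And>n. y ^ n * z \<in> R"
  obtains n :: nat and r where "\<And>i. r i \<in> R" "y ^ n = (\<Sum>i<n. r i * y ^ i)"
proof (rule noetherian_subringE[OF assms(1), of "\<lambda>n. y ^ n * z", OF assms(3)])
  fix n r assume r: "\<And>i. r i \<in> R" "y ^ n * z = (\<Sum>i<n. r i * (y ^ i * z))"
  then have "y ^ n * z = (\<Sum>i<n. r i * y ^ i) * z"
    by (simp add: sum_distrib_right mult.assoc)
  then show thesis
    using that[OF r(1)] assms(2) by simp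
qed

lemma integral_overI:
  assumes "type_subring R" "\<And>i. r i \<in> R" "y ^ n = (\<Sum>i<n. r i * y ^ i)"
  shows "integral_over R y"
proof -
  interpret type_subring R by fact
  define p where "p = Polynomial.monom 1 n - (\<Sum>i<n. Polynomial.monom (r i) i)"
  have c: "Polynomial.coeff p i = (if i = n then 1 else if i < n then - r i else 0)" for i
    unfolding p_def by (auto simp: Polynomial.coeff_sum sum.delta Polynomial.coeff_monom)
  have "Polynomial.degree p = n"
  proof (rule antisym)
    show "Polynomial.degree p \<le> n"
      by (rule Polynomial.degree_le) (simp add: c)
    show "n \<le> Polynomial.degree p"
      by (rule Polynomial.le_degree) (simp add: c)
  qed
  then have "Polynomial.lead_coeff p = 1"
    by (simp add: c)
  moreover have "poly p y = 0"
    unfolding p_def using assms(3) by (simp add: poly_sum poly_monom)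
  moreover have "Polynomial.coeff p i \<in> R" for i
    using assms(2) by (simp add: c)
  ultimately show ?thesis
    unfolding integral_over_def by blast
qed

section \<open>Projective schemes in terms of their homogeneous coordinates\<close>

subsection \<open>Evaluation of polynomials\<close>

lemma keys_mult_superset:
  fixes x :: "nat \<Rightarrow> 'a::comm_monoid_mult"
  assumes "finite S" "Poly_Mapping.keys m \<subseteq> S"
  shows "(\<Prod>i\<in>Poly_Mapping.keys m. x i ^ Poly_Mapping.lookup m i) = (\<Prod>i\<in>S. x i ^ Poly_Mapping.lookup m i)"
  using assms by (intro prod.mono_neutral_left) (auto simp: in_keys_iff)

lemma monomial_times:
  fixes x :: "nat \<Rightarrow> 'a::comm_monoid_mult"
  shows "(\<Prod>i\<in>Poly_Mapping.keys (m + m'). x i ^ Poly_Mapping.lookup (m + m') i)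
    = (\<Prod>i\<in>Poly_Mapping.keys m. x i ^ Poly_Mapping.lookup m i) *
      (\<Prod>i\<in>Poly_Mapping.keys m'. x i ^ Poly_Mapping.lookup m' i)"
proof -
  let ?S = "Poly_Mapping.keys m \<union> Poly_Mapping.keys m'"
  have "Poly_Mapping.keys (m + m') \<subseteq> ?S"
    by (rule Poly_Mapping.keys_add)
  then show ?thesis
    using keys_mult_superset[of ?S m x] keys_mult_superset[of ?S m' x] keys_mult_superset[of ?S "m + m'" x]
    by (simp add: prod.distrib[symmetric] lookup_add power_add)
qed

lemma monomial_degree_superset:
  assumes "finite S" "Poly_Mapping.keys m \<subseteq> S"
  shows "monomial_degree m = (\<Sum>i\<in>S. Poly_Mapping.lookup m i)"
  unfolding monomial_degree_def using assms by (intro sum.mono_neutral_left) (auto simp: in_keys_iff)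

lemma monomial_degree_add: "monomial_degree (m + m') = monomial_degree m + monomial_degree m'"
proof -
  let ?S = "Poly_Mapping.keys m \<union> Poly_Mapping.keys m'"
  have "Poly_Mapping.keys (m + m') \<subseteq> ?S"
    by (rule Poly_Mapping.keys_add)
  then show ?thesis
    using monomial_degree_superset[of ?S m] monomial_degree_superset[of ?S m']
      monomial_degree_superset[of ?S "m + m'"]
    by (simp add: sum.distrib lookup_add)
qed

lemma lookup_homogeneous_component:
  "Poly_Mapping.lookup (homogeneous_component d F) m = (if monomial_degree m = d then Poly_Mapping.lookup F m else 0)"
proof -
  have "Poly_Mapping.lookup (homogeneous_component d F) m =
      (\<Sum>m'\<in>{m' \<in> Poly_Mapping.keys F. monomial_degree m' = d}. if m' = m then Poly_Mapping.lookup F m else 0)"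
    unfolding homogeneous_component_def lookup_sum
    by (intro sum.cong) (auto simp: lookup_single when_def)
  then show ?thesis
    by (auto simp: sum.delta in_keys_iff)
qed

lemma homogeneous_component_homogeneous: "homogeneous d (homogeneous_component d F)"
  unfolding homogeneous_def by (auto simp: in_keys_iff lookup_homogeneous_component split: if_splits)

lemma homogeneous_component_of_homogeneous:
  "homogeneous e F \<Longrightarrow> homogeneous_component d F = (if d = e then F else 0)"
  unfolding homogeneous_def
  by (intro poly_mapping_eqI) (auto simp: lookup_homogeneous_component in_keys_iff)

lemma homogeneous_component_decomposition:
  "F = (\<Sum>d\<in>monomial_degree ` Poly_Mapping.keys F. homogeneous_component d F)"
proof (rule poly_mapping_eqI)
  fix m
  have "Poly_Mapping.lookup (\<Sum>d\<in>monomial_degree ` Poly_Mapping.keys F. homogeneous_component d F) m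
      = (\<Sum>d\<in>monomial_degree ` Poly_Mapping.keys F. if d = monomial_degree m then Poly_Mapping.lookup F m else 0)"
    unfolding lookup_sum lookup_homogeneous_component by (intro sum.cong) auto
  also have "\<dots> = Poly_Mapping.lookup F m"
    by (auto simp: sum.delta in_keys_iff)
  finally show "Poly_Mapping.lookup F m
    = Poly_Mapping.lookup (\<Sum>d\<in>monomial_degree ` Poly_Mapping.keys F. homogeneous_component d F) m" ..
qed

lemma homogeneous_zero [simp]: "homogeneous d 0"
  unfolding homogeneous_def by simp

lemma homogeneous_add: "homogeneous d F \<Longrightarrow> homogeneous d G \<Longrightarrow> homogeneous d (F + G)"
  unfolding homogeneous_def using Poly_Mapping.keys_add[of F G] by blast

lemma homogeneous_uminus: "homogeneous d F \<Longrightarrow> homogeneous d (- F)"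
  unfolding homogeneous_def by (auto simp: in_keys_iff)

lemma homogeneous_mult:
  assumes "homogeneous d F" "homogeneous e G"
  shows "homogeneous (d + e) (F * G)"
  unfolding homogeneous_def
proof
  fix m assume "m \<in> Poly_Mapping.keys (F * G)"
  then obtain a b where "a \<in> Poly_Mapping.keys F" "b \<in> Poly_Mapping.keys G" "m = a + b"
    using keys_mult[of F G] by blast
  then show "monomial_degree m = d + e"
    using assms unfolding homogeneous_def by (simp add: monomial_degree_add)
qed

lemma homogeneous_const: "homogeneous 0 (Poly_Mapping.single 0 c)"
  unfolding homogeneous_def by (simp add: monomial_degree_def)

lemma homogeneous_variable: "homogeneous 1 (variable i)"
  unfolding homogeneous_def variable_def monomial_degree_def by simp

lemma type_subring_polynomials_upto:
  "type_subring (polynomials_upto n :: 'k::field mpolynomial set)"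
proof
  show "1 \<in> (polynomials_upto n :: 'k mpolynomial set)"
    unfolding polynomials_upto_def by simp
  fix F G :: "'k mpolynomial" assume *: "F \<in> polynomials_upto n" "G \<in> polynomials_upto n"
  have "Poly_Mapping.keys (F - G) \<subseteq> Poly_Mapping.keys F \<union> Poly_Mapping.keys G"
    by (auto simp: in_keys_iff lookup_minus)
  then show "F - G \<in> polynomials_upto n"
    using * unfolding polynomials_upto_def by blast
  show "F * G \<in> polynomials_upto n"
    unfolding polynomials_upto_def
  proof (intro CollectI ballI)
    fix m assume "m \<in> Poly_Mapping.keys (F * G)"
    then obtain a b where "a \<in> Poly_Mapping.keys F" "b \<in> Poly_Mapping.keys G" "m = a + b"
      using keys_mult[of F G] by blast
    then show "Poly_Mapping.keys m \<subseteq> {..n}"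
      using * Poly_Mapping.keys_add[of a b] unfolding polynomials_upto_def by blast
  qed
qed

lemma single_mem_polynomials_upto:
  "Poly_Mapping.keys m \<subseteq> {..n} \<Longrightarrow> Poly_Mapping.single m c \<in> polynomials_upto n"
  unfolding polynomials_upto_def by simp

lemma variable_mem_polynomials_upto: "i \<le> n \<Longrightarrow> variable i \<in> polynomials_upto n"
  unfolding variable_def by (rule single_mem_polynomials_upto) simp

lemma homogeneous_component_mem_polynomials_upto:
  "F \<in> polynomials_upto n \<Longrightarrow> homogeneous_component d F \<in> polynomials_upto n"
  unfolding polynomials_upto_def
  by (auto simp: in_keys_iff lookup_homogeneous_component split: if_splits)

locale evaluation =
  fixes \<iota> :: "'k::comm_ring_1 \<Rightarrow> 'K::comm_ring_1"
  assumes \<iota>_add: "\<iota> (a + b) = \<iota> a + \<iota> b" and \<iota>_mult: "\<iota> (a * b) = \<iota> a * \<iota> b" and \<iota>_one [simp]: "\<iota> 1 = 1"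
begin

lemma \<iota>_zero [simp]: "\<iota> 0 = 0"
  using \<iota>_add[of 0 0] by simp

lemma \<iota>_uminus: "\<iota> (- a) = - \<iota> a"
  using \<iota>_add[of a "- a"] by (simp add: add_eq_0_iff)

lemma evaluate_superset:
  assumes "finite S" "Poly_Mapping.keys F \<subseteq> S"
  shows "evaluate \<iota> x F = (\<Sum>m\<in>S. \<iota> (Poly_Mapping.lookup F m) *
    (\<Prod>i\<in>Poly_Mapping.keys m. x i ^ Poly_Mapping.lookup m i))"
  unfolding evaluate_def using assms by (intro sum.mono_neutral_left) (auto simp: in_keys_iff)

lemma evaluate_add: "evaluate \<iota> x (F + G) = evaluate \<iota> x F + evaluate \<iota> x G"
proof -
  let ?S = "Poly_Mapping.keys F \<union> Poly_Mapping.keys G"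
  have "Poly_Mapping.keys (F + G) \<subseteq> ?S"
    by (rule Poly_Mapping.keys_add)
  then show ?thesis
    using evaluate_superset[of ?S F x] evaluate_superset[of ?S G x] evaluate_superset[of ?S "F + G" x]
    by (simp add: sum.distrib[symmetric] lookup_add \<iota>_add distrib_right)
qed

lemma evaluate_zero [simp]: "evaluate \<iota> x 0 = 0"
  unfolding evaluate_def by simp

lemma evaluate_uminus: "evaluate \<iota> x (- F) = - evaluate \<iota> x F"
  using evaluate_add[of x F "- F"] by (simp add: add_eq_0_iff)

lemma evaluate_diff: "evaluate \<iota> x (F - G) = evaluate \<iota> x F - evaluate \<iota> x G"
  using evaluate_add[of x F "- G"] by (simp add: evaluate_uminus)

lemma evaluate_sum: "evaluate \<iota> x (sum f I) = (\<Sum>i\<in>I. evaluate \<iota> x (f i))"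
  by (induction I rule: infinite_finite_induct) (simp_all add: evaluate_add)

lemma evaluate_single:
  "evaluate \<iota> x (Poly_Mapping.single m c) = \<iota> c * (\<Prod>i\<in>Poly_Mapping.keys m. x i ^ Poly_Mapping.lookup m i)"
  using evaluate_superset[of "{m}" "Poly_Mapping.single m c" x] by simp

lemma evaluate_const: "evaluate \<iota> x (Poly_Mapping.single 0 c) = \<iota> c"
  by (simp add: evaluate_single)

lemma evaluate_one [simp]: "evaluate \<iota> x 1 = 1"
  using evaluate_const[of x 1] by simp

lemma evaluate_variable: "evaluate \<iota> x (variable i) = x i"
  unfolding variable_def by (simp add: evaluate_single)

lemma evaluate_mult: "evaluate \<iota> x (F * G) = evaluate \<iota> x F * evaluate \<iota> x G"
proof -
  let ?K = "Poly_Mapping.keys" and ?l = "Poly_Mapping.lookup"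
  have "F * G = (\<Sum>a\<in>?K F. \<Sum>b\<in>?K G. Poly_Mapping.single (a + b) (?l F a * ?l G b))"
    using arg_cong2[OF poly_mapping_eq_sum_single[of F] poly_mapping_eq_sum_single[of G], of "(*)"]
    by (simp only: sum_product mult_single)
  then have "evaluate \<iota> x (F * G) = (\<Sum>a\<in>?K F. \<Sum>b\<in>?K G.
      (\<iota> (?l F a) * (\<Prod>i\<in>?K a. x i ^ ?l a i)) * (\<iota> (?l G b) * (\<Prod>i\<in>?K b. x i ^ ?l b i)))"
    by (simp add: evaluate_sum evaluate_single monomial_times \<iota>_mult mult_ac)
  also have "\<dots> = evaluate \<iota> x F * evaluate \<iota> x G"
    unfolding evaluate_def by (simp add: sum_product)
  finally show ?thesis .
qed

end

subsection \<open>The homogeneous coordinate ring\<close>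

locale projective_scheme =
  fixes Y :: "('k::field, 'K::field) proj_scheme"
  assumes projective_integral: "projective_integral Y"
begin

abbreviation sc :: "'k \<Rightarrow> 'K" where "sc \<equiv> scalar Y"
abbreviation crd :: "nat \<Rightarrow> 'K" where "crd \<equiv> coord Y"
abbreviation ev :: "'k mpolynomial \<Rightarrow> 'K" where "ev \<equiv> evaluate sc crd"
abbreviation PU :: "'k mpolynomial set" where "PU \<equiv> polynomials_upto (dim Y)"

sublocale evaluation sc
proof
  have *: "sc \<in> ring_hom ring_of_type_algebra ring_of_type_algebra"
    using projective_integral unfolding projective_integral_def by blast
  show "sc (a + b) = sc a + sc b" "sc (a * b) = sc a * sc b" "sc 1 = 1" for a b
    using ring_hom_add[OF *, of a b] ring_hom_mult[OF *, of a b] ring_hom_one[OF *]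
    by (simp_all add: ring_of_type_algebra_def)
qed

sublocale PU: type_subring PU
  by (rule type_subring_polynomials_upto)

lemma sc_eq_zero_iff [simp]: "sc a = 0 \<longleftrightarrow> a = 0"
proof
  assume "sc a = 0"
  then show "a = 0"
    using \<iota>_mult[of "inverse a" a] by (cases "a = 0") simp_all
qed simp

lemma inverse_sc: "a \<noteq> 0 \<Longrightarrow> inverse (sc a) = sc (inverse a)"
  using \<iota>_mult[of a "inverse a"] by (intro inverse_unique) simp

text \<open>Substituting \<open>crd i * T\<close> for the variables separates the homogeneous components.\<close>

definition graded_ev :: "'k mpolynomial \<Rightarrow> 'K poly"
  where "graded_ev F = evaluate (\<lambda>c. [:sc c:]) (\<lambda>i. Polynomial.monom (crd i) 1) F"

sublocale graded: evaluation "\<lambda>c. [:sc c:]"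
  by standard (simp_all add: \<iota>_add \<iota>_mult one_pCons)

lemma graded_ev_monomial:
  "[:sc c:] * (\<Prod>i\<in>Poly_Mapping.keys m. Polynomial.monom (crd i) 1 ^ Poly_Mapping.lookup m i)
    = Polynomial.monom (sc c * (\<Prod>i\<in>Poly_Mapping.keys m. crd i ^ Poly_Mapping.lookup m i)) (monomial_degree m)"
proof -
  have "(\<Prod>i\<in>S. Polynomial.monom (crd i) 1 ^ l i) = Polynomial.monom (\<Prod>i\<in>S. crd i ^ l i) (\<Sum>i\<in>S. l i)"
    if "finite S" for S l
    using that by (induction S rule: finite_induct)
      (simp_all add: Polynomial.monom_power Polynomial.mult_monom Polynomial.monom_0 one_pCons)
  then show ?thesis
    by (simp add: monomial_degree_def Polynomial.smult_monom)
qed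

lemma coeff_graded_ev: "Polynomial.coeff (graded_ev F) d = ev (homogeneous_component d F)"
proof -
  let ?K = "Poly_Mapping.keys" and ?l = "Poly_Mapping.lookup"
  have "Polynomial.coeff (graded_ev F) d
      = (\<Sum>m\<in>?K F. if monomial_degree m = d then sc (?l F m) * (\<Prod>i\<in>?K m. crd i ^ ?l m i) else 0)"
    unfolding graded_ev_def evaluate_def graded_ev_monomial by (simp add: Polynomial.coeff_sum Polynomial.coeff_monom)
  also have "\<dots> = (\<Sum>m\<in>?K F. sc (?l (homogeneous_component d F) m) * (\<Prod>i\<in>?K m. crd i ^ ?l m i))"
    by (intro sum.cong) (simp_all add: lookup_homogeneous_component)
  also have "\<dots> = ev (homogeneous_component d F)"
    by (rule evaluate_superset[symmetric])
      (auto simp: in_keys_iff lookup_homogeneous_component split: if_splits)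
  finally show ?thesis .
qed

lemma graded_ev_homogeneous: "homogeneous d F \<Longrightarrow> graded_ev F = Polynomial.monom (ev F) d"
  by (rule Polynomial.poly_eqI)
    (simp add: coeff_graded_ev homogeneous_component_of_homogeneous Polynomial.coeff_monom)

lemma graded_ev_mult: "graded_ev (F * G) = graded_ev F * graded_ev G"
  unfolding graded_ev_def by (rule graded.evaluate_mult)

lemma graded_ev_add: "graded_ev (F + G) = graded_ev F + graded_ev G"
  unfolding graded_ev_def by (rule graded.evaluate_add)

lemma graded_ev_diff: "graded_ev (F - G) = graded_ev F - graded_ev G"
  unfolding graded_ev_def by (rule graded.evaluate_diff)

lemma vanishing_ideal_iff: "F \<in> vanishing_ideal Y \<longleftrightarrow> F \<in> PU \<and> graded_ev F = 0"
  unfolding vanishing_ideal_def by (simp add: Polynomial.poly_eq_iff coeff_graded_ev)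

text \<open>The degree-\<open>d\<close> part of the homogeneous coordinate ring, which embeds in the
  function field in each single degree. The images for different degrees may overlap, so an element
  is always used together with a degree.\<close>

definition gr :: "nat \<Rightarrow> 'K set"
  where "gr d = ev ` {F \<in> PU. homogeneous d F}"

lemma grE:
  assumes "a \<in> gr d"
  obtains F where "F \<in> PU" "homogeneous d F" "a = ev F"
  using assms unfolding gr_def by blast

lemma grI: "F \<in> PU \<Longrightarrow> homogeneous d F \<Longrightarrow> ev F \<in> gr d"
  unfolding gr_def by blast

lemma gr_zero [simp]: "0 \<in> gr d"
  using grI[OF PU.zero_mem homogeneous_zero] by simp

lemma gr_add: "a \<in> gr d \<Longrightarrow> b \<in> gr d \<Longrightarrow> a + b \<in> gr d"
  by (elim grE) (metis PU.add_mem evaluate_add grI homogeneous_add)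

lemma gr_uminus: "a \<in> gr d \<Longrightarrow> - a \<in> gr d"
  by (elim grE) (metis PU.uminus_mem evaluate_uminus grI homogeneous_uminus)

lemma gr_diff: "a \<in> gr d \<Longrightarrow> b \<in> gr d \<Longrightarrow> a - b \<in> gr d"
  using gr_add[of a d "- b"] gr_uminus[of b d] by simp

lemma gr_mult: "a \<in> gr d \<Longrightarrow> b \<in> gr e \<Longrightarrow> a * b \<in> gr (d + e)"
  by (elim grE) (metis PU.mult_mem evaluate_mult grI homogeneous_mult)

lemma gr_mult': "a \<in> gr d \<Longrightarrow> b \<in> gr e \<Longrightarrow> a * b \<in> gr (e + d)"
  using gr_mult[of a d b e] by (simp add: add.commute)

lemma gr_sum: "(\<And>i. i \<in> I \<Longrightarrow> f i \<in> gr d) \<Longrightarrow> sum f I \<in> gr d"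
  by (induction I rule: infinite_finite_induct) (simp_all add: gr_add)

lemma gr_scalar: "sc c \<in> gr 0"
  using grI[OF single_mem_polynomials_upto[of 0] homogeneous_const[of c]] by (simp add: evaluate_const)

lemma gr_one [simp]: "1 \<in> gr 0"
  using gr_scalar[of 1] by simp

lemma gr_coord: "i \<le> dim Y \<Longrightarrow> crd i \<in> gr 1"
  using grI[OF variable_mem_polynomials_upto homogeneous_variable, of i] by (simp add: evaluate_variable)

lemma gr_power: "a \<in> gr d \<Longrightarrow> a ^ k \<in> gr (k * d)"
  by (induction k) (auto intro: gr_mult)

lemma gr_coord_power: "i \<le> dim Y \<Longrightarrow> crd i ^ d \<in> gr d"
  using gr_power[OF gr_coord, of i d] by simp

lemma gr_0E:
  assumes "a \<in> gr 0"
  obtains c where "a = sc c"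
proof -
  obtain F where F: "F \<in> PU" "homogeneous 0 F" "a = ev F"
    using assms by (rule grE)
  have "Poly_Mapping.keys F \<subseteq> {0}"
  proof
    fix m assume m: "m \<in> Poly_Mapping.keys F"
    then have "monomial_degree m = 0"
      using F(2) unfolding homogeneous_def by blast
    then have "\<forall>i\<in>Poly_Mapping.keys m. Poly_Mapping.lookup m i = 0"
      unfolding monomial_degree_def by (simp add: sum_eq_0_iff)
    then have "m = 0"
      by (intro poly_mapping_eqI) (auto simp: in_keys_iff)
    then show "m \<in> {0}" by simp
  qed
  then have "ev F = sc (Poly_Mapping.lookup F 0)"
    using evaluate_superset[of "{0}" F crd] by simp
  then show ?thesis
    using that F(3) by blast
qed

lemma coeff_graded_ev_mem: "F \<in> PU \<Longrightarrow> Polynomial.coeff (graded_ev F) d \<in> gr d"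
  unfolding coeff_graded_ev
  by (intro grI homogeneous_component_mem_polynomials_upto homogeneous_component_homogeneous)

text \<open>With \<open>T\<close> recording the degree, the last stage is the algebra generated over
  \<open>k\<close> by the products \<open>crd i * T\<close>, which is a copy of the homogeneous
  coordinate ring. Adjoining one generator at a time makes Hilbert's basis theorem
  applicable.\<close>

primrec stage :: "nat \<Rightarrow> 'K poly set"
  where "stage 0 = {[:sc c:] | c. True}"
  | "stage (Suc j) = {poly f (Polynomial.monom (crd j) 1) | f. f \<in> polys_over (stage j)}"

lemma type_subring_stage: "type_subring (stage j)"
proof (induction j)
  case 0
  show ?case
  proof
    show "1 \<in> stage 0"
      by (auto simp: one_pCons intro!: exI[of _ 1])
    fix p q assume "p \<in> stage 0" "q \<in> stage 0"
    then obtain a b where "p = [:sc a:]" "q = [:sc b:]"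
      by auto
    then have "p - q = [:sc (a - b):]" "p * q = [:sc (a * b):]"
      using \<iota>_add[of a "- b"] by (simp_all add: \<iota>_uminus \<iota>_mult)
    then show "p - q \<in> stage 0" "p * q \<in> stage 0"
      by auto
  qed
next
  case (Suc j)
  then show ?case
    using type_subring.type_subring_adjoin[OF Suc] by simp
qed

lemma noetherian_stage: "noetherian_subring (stage j)"
proof (induction j)
  case 0
  show ?case
    unfolding noetherian_subring_def
  proof (intro allI impI)
    fix f :: "nat \<Rightarrow> 'K poly" assume f: "range f \<subseteq> stage 0"
    interpret S: type_subring "stage 0"
      by (rule type_subring_stage)
    show "\<exists>n. f n \<in> span_upto (stage 0) f n"
    \<comment> \<open>Over a field every sequence stops at once: a zero \<open>f 0\<close> lies in
      the empty span, and a nonzero one generates everything.\<close>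
    proof (cases "f 0 = 0")
      case True
      then show ?thesis
        using S.span_upto_zero by (intro exI[of _ 0]) simp
    next
      case False
      have "f 0 \<in> stage 0" "f 1 \<in> stage 0"
        using f by auto
      then obtain a b where a: "f 0 = [:sc a:]" and b: "f 1 = [:sc b:]"
        by auto
      then have "a \<noteq> 0"
        using False by auto
      then have "b * inverse a * a = b"
        by simp
      from \<iota>_mult[of "b * inverse a" a, unfolded this]
      have "f 1 = [:sc (b * inverse a):] * f 0"
        unfolding a b by (simp add: mult.commute)
      moreover have "[:sc (b * inverse a):] * f 0 \<in> span_upto (stage 0) f 1"
        by (intro S.span_upto_mult S.span_upto_base) auto
      ultimately show ?thesis
        by (intro exI[of _ 1]) simp
    qed
  qed
next
  case (Suc j)
  then show ?case
    using type_subring.noetherian_adjoin[OF type_subring_stage Suc] by simp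
qed

lemma stage_mono: "i \<le> j \<Longrightarrow> stage i \<subseteq> stage j"
proof (induction rule: dec_induct)
  case (step k)
  interpret S: type_subring "stage k"
    by (rule type_subring_stage)
  have "stage k \<subseteq> stage (Suc k)"
  proof
    fix p assume "p \<in> stage k"
    then show "p \<in> stage (Suc k)"
      by (auto intro!: exI[of _ "[:p:]"])
  qed
  then show ?case using step by blast
qed simp

lemma monom_coord_mem_stage: "Polynomial.monom (crd j) 1 \<in> stage (Suc j)"
proof -
  interpret S: type_subring "stage j"
    by (rule type_subring_stage)
  have "Polynomial.monom 1 1 \<in> polys_over (stage j)"
    by (rule S.monom_mem_polys_over) simp
  then show ?thesis
    by (auto intro!: exI[of _ "Polynomial.monom 1 1"] simp: poly_monom)
qed

lemma graded_ev_mem_stage: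
  assumes "F \<in> PU"
  shows "graded_ev F \<in> stage (Suc (dim Y))"
proof -
  interpret S: type_subring "stage (Suc (dim Y))"
    by (rule type_subring_stage)
  have "[:sc c:] \<in> stage (Suc (dim Y))" for c
    using stage_mono[of 0 "Suc (dim Y)"] by auto
  moreover have "Polynomial.monom (crd i) 1 \<in> stage (Suc (dim Y))" if "i \<le> dim Y" for i
    using stage_mono[of "Suc i" "Suc (dim Y)"] monom_coord_mem_stage[of i] that by blast
  moreover have "i \<le> dim Y" if "m \<in> Poly_Mapping.keys F" "i \<in> Poly_Mapping.keys m" for m i
    using assms that unfolding polynomials_upto_def by blast
  ultimately show ?thesis
    unfolding graded_ev_def evaluate_def
    by (intro S.sum_mem S.mult_mem S.prod_mem S.power_mem) blast+
qed

lemma monom_mem_stage: "a \<in> gr d \<Longrightarrow> Polynomial.monom a d \<in> stage (Suc (dim Y))"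
  by (elim grE) (metis graded_ev_homogeneous graded_ev_mem_stage)

text \<open>With \<open>monom_mem_stage\<close> this passes back and forth between forms and the
  Noetherian ring: a relation in the ring gives one between forms on comparing coefficients of a
  power of \<open>T\<close>.\<close>

lemma coeff_stage: "j \<le> Suc (dim Y) \<Longrightarrow> p \<in> stage j \<Longrightarrow> Polynomial.coeff p d \<in> gr d"
proof (induction j arbitrary: p d)
  case 0
  then show ?case
    using gr_scalar by (auto simp: Polynomial.coeff_pCons split: nat.splits)
next
  case (Suc j)
  then obtain f where f: "f \<in> polys_over (stage j)" "p = poly f (Polynomial.monom (crd j) 1)"
    by auto
  have "Polynomial.coeff (Polynomial.coeff f i * Polynomial.monom (crd j) 1 ^ i) d \<in> gr d" for i
  proof -
    have "Polynomial.monom (crd j) 1 ^ i = Polynomial.monom (crd j ^ i) i"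
      using Polynomial.monom_power[of "crd j" 1 i] by simp
    then have "Polynomial.coeff f i * Polynomial.monom (crd j) 1 ^ i
        = Polynomial.monom (crd j ^ i) i * Polynomial.coeff f i"
      by (simp only: mult.commute)
    then have "Polynomial.coeff (Polynomial.coeff f i * Polynomial.monom (crd j) 1 ^ i) d
        = (if d < i then 0 else crd j ^ i * Polynomial.coeff (Polynomial.coeff f i) (d - i))"
      by (simp only: Polynomial.coeff_monom_mult)
    moreover have "Polynomial.coeff (Polynomial.coeff f i) (d - i) \<in> gr (d - i)"
      using f(1) Suc unfolding polys_over_def by auto
    then have "crd j ^ i * Polynomial.coeff (Polynomial.coeff f i) (d - i) \<in> gr (i + (d - i))"
      using Suc.prems by (intro gr_mult gr_coord_power) auto
    ultimately show ?thesis by auto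
  qed
  then show ?case
    unfolding f(2) poly_altdef Polynomial.coeff_sum by (intro gr_sum)
qed

end

lemma (in type_subring) primeideal_subring_of_type_iff:
  "primeideal q (subring_of_type A) \<longleftrightarrow> q \<subseteq> A \<and> 0 \<in> q \<and> (\<forall>x\<in>q. \<forall>y\<in>q. x + y \<in> q) \<and>
    (\<forall>a\<in>A. \<forall>x\<in>q. a * x \<in> q) \<and> 1 \<notin> q \<and> (\<forall>x\<in>A. \<forall>y\<in>A. x * y \<in> q \<longrightarrow> x \<in> q \<or> y \<in> q)"
  (is "?L \<longleftrightarrow> ?R")
proof
  assume ?L
  interpret q: primeideal q "subring_of_type A" by fact
  have mult: "\<forall>a\<in>A. \<forall>x\<in>q. a * x \<in> q"
    using q.I_l_closed by simp
  have sub: "q \<subseteq> A"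
    using q.Icarr by auto
  have "1 \<notin> q"
  proof
    assume "1 \<in> q"
    then have "A \<subseteq> q"
      using mult by (metis mult.right_neutral subsetI)
    then show False
      using q.I_notcarr sub by simp
  qed
  moreover have "0 \<in> q" "\<forall>x\<in>q. \<forall>y\<in>q. x + y \<in> q"
    using additive_subgroup.zero_closed[OF q.additive_subgroup_axioms]
      additive_subgroup.a_closed[OF q.additive_subgroup_axioms] by simp_all
  moreover have "\<forall>x\<in>A. \<forall>y\<in>A. x * y \<in> q \<longrightarrow> x \<in> q \<or> y \<in> q"
    using q.I_prime by simp
  ultimately show ?R
    using mult sub by blast
next
  assume R: ?R
  interpret R: domain "subring_of_type A"
    by (rule domain_subring_of_type)
  have um: "- x \<in> q" if "x \<in> q" for x
  proof -
    have "- 1 * x \<in> q"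
      using R that uminus_mem[OF one_mem] by blast
    then show ?thesis by simp
  qed
  have inv: "\<ominus>\<^bsub>subring_of_type A\<^esub> x = - x" if "x \<in> A" for x
    using that by (intro R.minus_equality) auto
  have "subgroup q (add_monoid (subring_of_type A))"
    using R um inv by (intro R.add.subgroupI) (auto simp: a_inv_def)
  moreover have "x * a \<in> q" if "x \<in> q" "a \<in> A" for x a
    using R that by (simp add: mult.commute[of x a])
  ultimately have "ideal q (subring_of_type A)"
    using R by (intro idealI R.ring_axioms) auto
  then show ?L
    using R R.cring_axioms by (intro primeidealI) auto
qed

context projective_scheme
begin

subsection \<open>Graded localizations\<close>

text \<open>Denominators sorted by degree. The two instances that matter are the complement of a
  graded prime, which gives a local ring, and the powers of one coordinate, which give a standard
  affine chart.\<close>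

definition graded_submonoid :: "(nat \<Rightarrow> 'K set) \<Rightarrow> bool"
  where "graded_submonoid S \<longleftrightarrow> 1 \<in> S 0 \<and> (\<forall>d. S d \<subseteq> gr d \<and> 0 \<notin> S d) \<and>
    (\<forall>d e. \<forall>a\<in>S d. \<forall>b\<in>S e. a * b \<in> S (d + e))"

definition loc :: "(nat \<Rightarrow> 'K set) \<Rightarrow> 'K set"
  where "loc S = {a / b | a b d. a \<in> gr d \<and> b \<in> S d}"

lemma locI: "a \<in> gr d \<Longrightarrow> b \<in> S d \<Longrightarrow> a / b \<in> loc S"
  unfolding loc_def by blast

lemma locE:
  assumes "x \<in> loc S"
  obtains a b d where "a \<in> gr d" "b \<in> S d" "x = a / b"
  using assms unfolding loc_def by blast

lemma graded_submonoidD: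
  assumes "graded_submonoid S"
  shows "1 \<in> S 0" "a \<in> S d \<Longrightarrow> a \<in> gr d" "a \<in> S d \<Longrightarrow> a \<noteq> 0"
    "a \<in> S d \<Longrightarrow> b \<in> S e \<Longrightarrow> a * b \<in> S (d + e)"
  using assms unfolding graded_submonoid_def by blast+

lemma type_subring_loc:
  assumes S: "graded_submonoid S"
  shows "type_subring (loc S)"
proof
  show "1 \<in> loc S"
    using locI[where S = S and d = 0, OF gr_one graded_submonoidD(1)[OF S]] by simp
  fix x y assume x: "x \<in> loc S" and y: "y \<in> loc S"
  obtain a b d where a: "a \<in> gr d" "b \<in> S d" "x = a / b"
    using x by (rule locE)
  obtain a' b' e where a': "a' \<in> gr e" "b' \<in> S e" "y = a' / b'"
    using y by (rule locE)
  note b = graded_submonoidD(2,3)[OF S a(2)] graded_submonoidD(2,3)[OF S a'(2)]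
  have bb: "b * b' \<in> S (d + e)"
    using graded_submonoidD(4)[OF S a(2) a'(2)] .
  have "x * y = (a * a') / (b * b')"
    unfolding a a' by simp
  then show "x * y \<in> loc S"
    using locI[where S = S and d = "d + e", OF gr_mult[OF a(1) a'(1)] bb] by simp
  have "x - y = (a * b' - a' * b) / (b * b')"
    unfolding a a' using b by (simp add: divide_simps)
  then show "x - y \<in> loc S"
    using locI[where S = S and d = "d + e", OF gr_diff[OF gr_mult[OF a(1) b(3)] gr_mult'[OF a'(1) b(1)]] bb]
    by simp
qed

text \<open>The numerators, as monomials in \<open>T\<close>, satisfy a relation in the coordinate
  ring. Its part of degree \<open>d n\<close> is homogeneous, and inserting the denominators turns
  it into a relation between the fractions.\<close>

lemma noetherian_loc:
  assumes S: "graded_submonoid S"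
  shows "noetherian_subring (loc S)"
  unfolding noetherian_subring_def
proof (intro allI impI)
  fix f :: "nat \<Rightarrow> 'K" assume "range f \<subseteq> loc S"
  then have "\<forall>n. \<exists>a b d. a \<in> gr d \<and> b \<in> S d \<and> f n = a / b"
    unfolding loc_def by blast
  then obtain a b d where "\<forall>n. a n \<in> gr (d n) \<and> b n \<in> S (d n) \<and> f n = a n / b n"
    by metis
  then have a: "\<And>n. a n \<in> gr (d n)" and b: "\<And>n. b n \<in> S (d n)" and f: "\<And>n. f n = a n / b n"
    by blast+
  have b0: "b n \<noteq> 0" and bgr: "b n \<in> gr (d n)" for n
    using graded_submonoidD(2,3)[OF S b] by auto
  obtain n r where r: "\<And>i. r i \<in> stage (Suc (dim Y))"
    "Polynomial.monom (a n) (d n) = (\<Sum>i<n. r i * Polynomial.monom (a i) (d i))"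
    by (rule noetherian_subringE[where f = "\<lambda>n. Polynomial.monom (a n) (d n)", OF noetherian_stage monom_mem_stage[OF a]])
      (rule that)
  \<comment> \<open>For \<open>d i > d n\<close> the product with \<open>r i\<close> has no term of
    degree \<open>d n\<close>. The explicit 0 is needed because the subtraction would
    truncate.\<close>
  define c where "c i = (if d i \<le> d n then Polynomial.coeff (r i) (d n - d i) else 0)" for i
  have "a n = Polynomial.coeff (\<Sum>i<n. Polynomial.monom (a i) (d i) * r i) (d n)"
    using r(2) by (metis (no_types, lifting) Polynomial.coeff_monom mult.commute sum.cong)
  also have "\<dots> = (\<Sum>i<n. c i * a i)"
    unfolding Polynomial.coeff_sum Polynomial.coeff_monom_mult c_def by (intro sum.cong) auto
  finally have an: "a n = (\<Sum>i<n. c i * a i)" .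
  define s where "s i = c i * b i / b n" for i
  have "s i \<in> loc S" for i
  proof (cases "d i \<le> d n")
    case True
    have "c i \<in> gr (d n - d i)"
      unfolding c_def using True coeff_stage[OF order_refl r(1)] by simp
    then have "c i * b i \<in> gr (d n)"
      using gr_mult[OF _ bgr, of "c i" "d n - d i" i] True by simp
    then show ?thesis
      unfolding s_def using b by (rule locI)
  next
    case False
    interpret type_subring "loc S"
      by (rule type_subring_loc[OF S])
    show ?thesis
      unfolding s_def c_def using False by simp
  qed
  moreover have "f n = (\<Sum>i<n. s i * f i)"
    unfolding f[of n] an sum_divide_distrib s_def using b0 by (intro sum.cong) (auto simp: f)
  ultimately show "\<exists>n. f n \<in> span_upto (loc S) f n"
    unfolding span_upto_def by (intro exI[of _ n] CollectI exI[of _ s]) blast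
qed

subsection \<open>Points as graded primes\<close>

text \<open>A homogeneous prime ideal seen through the images of its graded pieces in the function
  field; here localization can be carried out without polynomials.\<close>

definition graded_prime :: "(nat \<Rightarrow> 'K set) \<Rightarrow> bool"
  where "graded_prime \<rho> \<longleftrightarrow> (\<forall>d. \<rho> d \<subseteq> gr d \<and> 0 \<in> \<rho> d \<and> (\<forall>a\<in>\<rho> d. \<forall>b\<in>\<rho> d. a + b \<in> \<rho> d)) \<and>
    (\<forall>d e. \<forall>a\<in>gr d. \<forall>b\<in>\<rho> e. a * b \<in> \<rho> (d + e)) \<and>
    (\<forall>d e. \<forall>a\<in>gr d. \<forall>b\<in>gr e. a * b \<in> \<rho> (d + e) \<longrightarrow> a \<in> \<rho> d \<or> b \<in> \<rho> e) \<and>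
    (\<exists>i\<le>dim Y. crd i \<notin> \<rho> 1)"

lemma graded_primeD:
  assumes "graded_prime \<rho>"
  shows "a \<in> \<rho> d \<Longrightarrow> a \<in> gr d" "0 \<in> \<rho> d" "a \<in> \<rho> d \<Longrightarrow> b \<in> \<rho> d \<Longrightarrow> a + b \<in> \<rho> d"
    "a \<in> gr d \<Longrightarrow> b \<in> \<rho> e \<Longrightarrow> a * b \<in> \<rho> (d + e)"
    "a \<in> gr d \<Longrightarrow> b \<in> gr e \<Longrightarrow> a * b \<in> \<rho> (d + e) \<Longrightarrow> a \<in> \<rho> d \<or> b \<in> \<rho> e"
    "\<exists>i\<le>dim Y. crd i \<notin> \<rho> 1"
  using assms unfolding graded_prime_def by blast+

lemma graded_prime_one: "graded_prime \<rho> \<Longrightarrow> 1 \<notin> \<rho> 0"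
  using graded_primeD(4,6) gr_coord by (metis add.right_neutral mult.right_neutral)

lemma graded_prime_power:
  assumes \<rho>: "graded_prime \<rho>" and "a \<in> gr d" "a \<notin> \<rho> d"
  shows "a ^ k \<notin> \<rho> (k * d)"
proof (induction k)
  case 0
  then show ?case using graded_prime_one[OF \<rho>] by simp
next
  case (Suc k)
  then show ?case
    using graded_primeD(5)[OF \<rho> assms(2) gr_power[OF assms(2)], of k] assms(3) by auto
qed

lemma graded_prime_coord_power:
  assumes "graded_prime \<rho>" "i \<le> dim Y" "crd i \<notin> \<rho> 1"
  shows "crd i ^ k \<notin> \<rho> k"
  using graded_prime_power[OF assms(1) gr_coord assms(3)] assms(2) by simp

lemma graded_submonoid_complement:
  assumes "graded_prime \<rho>"
  shows "graded_submonoid (\<lambda>d. gr d - \<rho> d)"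
  unfolding graded_submonoid_def
proof (intro conjI allI ballI)
  show "1 \<in> gr 0 - \<rho> 0"
    using graded_prime_one[OF assms] by simp
  show "gr d - \<rho> d \<subseteq> gr d" "0 \<notin> gr d - \<rho> d" for d
    using graded_primeD(2)[OF assms] by blast+
  show "a * b \<in> gr (d + e) - \<rho> (d + e)" if "a \<in> gr d - \<rho> d" "b \<in> gr e - \<rho> e" for d e a b
    using graded_primeD(5)[OF assms, of a d b e] gr_mult[of a d b e] that by blast
qed

section \<open>The bijection between points and graded primes\<close>

definition part :: "'k mpolynomial set \<Rightarrow> nat \<Rightarrow> 'K set"
  where "part q d = ev ` {F \<in> q. homogeneous d F}"

definition point_of :: "(nat \<Rightarrow> 'K set) \<Rightarrow> 'k mpolynomial set"
  where "point_of \<rho> = {F \<in> PU. \<forall>d. Polynomial.coeff (graded_ev F) d \<in> \<rho> d}"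

lemma part_point_of:
  assumes \<rho>: "graded_prime \<rho>"
  shows "part (point_of \<rho>) = \<rho>"
proof (rule ext, intro equalityI subsetI)
  fix d a assume "a \<in> part (point_of \<rho>) d"
  then obtain F where F: "F \<in> point_of \<rho>" "homogeneous d F" "a = ev F"
    unfolding part_def by blast
  then have "Polynomial.coeff (graded_ev F) d \<in> \<rho> d"
    unfolding point_of_def by blast
  then show "a \<in> \<rho> d"
    unfolding graded_ev_homogeneous[OF F(2)] F(3) by simp
next
  fix d a assume a: "a \<in> \<rho> d"
  then obtain F where F: "F \<in> PU" "homogeneous d F" "a = ev F"
    using graded_primeD(1)[OF \<rho>] grE by metis
  then have "F \<in> point_of \<rho>"
    unfolding point_of_def using a graded_primeD(2)[OF \<rho>]
    by (auto simp: graded_ev_homogeneous Polynomial.coeff_monom)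
  then show "a \<in> part (point_of \<rho>) d"
    unfolding part_def using F by blast
qed

lemma primeideal_coordinate_ring_iff:
  "primeideal q (coordinate_ring Y) \<longleftrightarrow> q \<subseteq> PU \<and> 0 \<in> q \<and> (\<forall>x\<in>q. \<forall>y\<in>q. x + y \<in> q) \<and>
    (\<forall>a\<in>PU. \<forall>x\<in>q. a * x \<in> q) \<and> 1 \<notin> q \<and> (\<forall>x\<in>PU. \<forall>y\<in>PU. x * y \<in> q \<longrightarrow> x \<in> q \<or> y \<in> q)"
  unfolding coordinate_ring_def by (rule PU.primeideal_subring_of_type_iff)

lemma graded_prime_sum:
  "graded_prime \<rho> \<Longrightarrow> (\<And>i. i \<in> I \<Longrightarrow> f i \<in> \<rho> d) \<Longrightarrow> sum f I \<in> \<rho> d"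
  by (induction I rule: infinite_finite_induct) (auto simp: graded_primeD(2,3))

lemma graded_prime_uminus:
  assumes "graded_prime \<rho>" "a \<in> \<rho> d"
  shows "- a \<in> \<rho> d"
  using graded_primeD(4)[OF assms(1) gr_uminus[OF gr_one] assms(2)] by simp

lemma graded_prime_diff:
  assumes "graded_prime \<rho>" "a \<in> \<rho> d" "b \<in> \<rho> d"
  shows "a - b \<in> \<rho> d"
  using graded_primeD(3)[OF assms(1,2) graded_prime_uminus[OF assms(1,3)]] by simp

text \<open>Primality has to be tested on inhomogeneous polynomials as well. If neither factor lies
  in the ideal, take in each the lowest component outside \<open>\<rho>\<close>; in the degree of
  their product all other contributions lie in \<open>\<rho>\<close>.\<close>

lemma point_of_mem_points:
  assumes \<rho>: "graded_prime \<rho>"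
  shows "point_of \<rho> \<in> points Y"
proof -
  let ?q = "point_of \<rho>" and ?c = "\<lambda>F. Polynomial.coeff (graded_ev F)"
  note D = graded_primeD[OF \<rho>]
  have c0: "?c 0 d = 0" for d
    by (simp add: graded_ev_homogeneous[OF homogeneous_zero, of 0])
  have prime: "F \<in> ?q \<or> G \<in> ?q" if F: "F \<in> PU" and G: "G \<in> PU" and FG: "F * G \<in> ?q" for F G
  proof (rule ccontr)
    assume "\<not> ?thesis"
    then obtain i0 j0 where i0: "?c F i0 \<notin> \<rho> i0" and j0: "?c G j0 \<notin> \<rho> j0"
      using F G unfolding point_of_def by blast
    define i where "i = (LEAST i. ?c F i \<notin> \<rho> i)"
    define j where "j = (LEAST j. ?c G j \<notin> \<rho> j)"
    have i: "?c F i \<notin> \<rho> i" "\<And>k. k < i \<Longrightarrow> ?c F k \<in> \<rho> k"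
      unfolding i_def using LeastI[of "\<lambda>i. ?c F i \<notin> \<rho> i", OF i0] not_less_Least[of _ "\<lambda>i. ?c F i \<notin> \<rho> i"] by blast+
    have j: "?c G j \<notin> \<rho> j" "\<And>k. k < j \<Longrightarrow> ?c G k \<in> \<rho> k"
      unfolding j_def using LeastI[of "\<lambda>i. ?c G i \<notin> \<rho> i", OF j0] not_less_Least[of _ "\<lambda>i. ?c G i \<notin> \<rho> i"] by blast+
    have split: "?c (F * G) (i + j) = ?c F i * ?c G j + (\<Sum>k\<in>{..i + j} - {i}. ?c F k * ?c G (i + j - k))"
      unfolding graded_ev_mult Polynomial.coeff_mult by (subst sum.remove[of "{..i + j}" i]) simp_all
    have rest: "(\<Sum>k\<in>{..i + j} - {i}. ?c F k * ?c G (i + j - k)) \<in> \<rho> (i + j)"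
    proof (rule graded_prime_sum[OF \<rho>])
      fix k assume k: "k \<in> {..i + j} - {i}"
      show "?c F k * ?c G (i + j - k) \<in> \<rho> (i + j)"
      proof (cases "k < i")
        case True
        then have "?c G (i + j - k) * ?c F k \<in> \<rho> (i + j - k + k)"
          by (intro D(4) i(2) coeff_graded_ev_mem G)
        then show ?thesis using True by (simp add: mult.commute)
      next
        case False
        then have "i + j - k < j" using k by auto
        then have "?c F k * ?c G (i + j - k) \<in> \<rho> (k + (i + j - k))"
          by (intro D(4) j(2) coeff_graded_ev_mem F)
        then show ?thesis using k by simp
      qed
    qed
    have "?c (F * G) (i + j) \<in> \<rho> (i + j)"
      using FG unfolding point_of_def by blast
    from graded_prime_diff[OF \<rho> this rest] have "?c F i * ?c G j \<in> \<rho> (i + j)"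
      unfolding split by simp
    then show False
      using D(5)[OF coeff_graded_ev_mem[OF F] coeff_graded_ev_mem[OF G]] i(1) j(1) by blast
  qed
  have mult: "F * G \<in> ?q" if F: "F \<in> PU" and G: "G \<in> ?q" for F G
  proof -
    have "?c F k * ?c G (d - k) \<in> \<rho> d" if "k \<le> d" for k d
    proof -
      have "?c F k * ?c G (d - k) \<in> \<rho> (k + (d - k))"
        using G unfolding point_of_def by (intro D(4) coeff_graded_ev_mem F) blast
      then show ?thesis using that by simp
    qed
    then have "?c (F * G) d \<in> \<rho> d" for d
      unfolding graded_ev_mult Polynomial.coeff_mult by (intro graded_prime_sum[OF \<rho>]) auto
    then show ?thesis
      using F G unfolding point_of_def by auto
  qed
  have one: "1 \<notin> ?q"
  proof
    assume "1 \<in> ?q"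
    then have "?c 1 0 \<in> \<rho> 0"
      unfolding point_of_def by blast
    moreover have "homogeneous 0 (1 :: 'k mpolynomial)"
      using homogeneous_const[of 1] by simp
    ultimately show False
      using graded_prime_one[OF \<rho>] by (simp add: graded_ev_homogeneous)
  qed
  have "primeideal ?q (coordinate_ring Y)"
    unfolding primeideal_coordinate_ring_iff
    using prime mult one D(2,3) c0 by (auto simp: point_of_def graded_ev_add)
  moreover have "homogeneous_set ?q"
    unfolding homogeneous_set_def
  proof (intro ballI allI)
    fix F d assume F: "F \<in> ?q"
    then have "?c (homogeneous_component d F) e \<in> \<rho> e" for e
      using D(2) unfolding point_of_def coeff_graded_ev
        homogeneous_component_of_homogeneous[OF homogeneous_component_homogeneous] by auto
    then show "homogeneous_component d F \<in> ?q"
      using F homogeneous_component_mem_polynomials_upto unfolding point_of_def by blast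
  qed
  moreover have "vanishing_ideal Y \<subseteq> ?q"
    unfolding point_of_def using D(2) by (auto simp: vanishing_ideal_iff)
  moreover have "\<exists>i\<le>dim Y. variable i \<notin> ?q"
  proof -
    obtain i where i: "i \<le> dim Y" "crd i \<notin> \<rho> 1"
      using D(6) by blast
    have "?c (variable i) 1 = crd i"
      unfolding graded_ev_homogeneous[OF homogeneous_variable] by (simp add: evaluate_variable)
    then show ?thesis
      using i unfolding point_of_def by (metis (mono_tags, lifting) mem_Collect_eq)
  qed
  ultimately show ?thesis
    unfolding points_def by blast
qed

lemma pointsD:
  assumes "q \<in> points Y"
  shows "q \<subseteq> PU" "0 \<in> q" "F \<in> q \<Longrightarrow> G \<in> q \<Longrightarrow> F + G \<in> q" "F \<in> PU \<Longrightarrow> G \<in> q \<Longrightarrow> F * G \<in> q" "1 \<notin> q"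
    "F \<in> PU \<Longrightarrow> G \<in> PU \<Longrightarrow> F * G \<in> q \<Longrightarrow> F \<in> q \<or> G \<in> q"
    "F \<in> q \<Longrightarrow> homogeneous_component d F \<in> q" "vanishing_ideal Y \<subseteq> q" "\<exists>i\<le>dim Y. variable i \<notin> q"
  using assms unfolding points_def primeideal_coordinate_ring_iff homogeneous_set_def by blast+

text \<open>A point contains the vanishing ideal, so membership of a form in it depends only on the
  degree of the form and its image in the function field.\<close>

lemma point_ev_cong:
  assumes q: "q \<in> points Y" and "F \<in> q" "G \<in> PU" "homogeneous d F" "homogeneous d G" "ev F = ev G"
  shows "G \<in> q"
proof -
  have "F \<in> PU"
    using pointsD(1)[OF q] assms(2) by blast
  then have "G - F \<in> vanishing_ideal Y"
    using assms by (simp add: vanishing_ideal_iff graded_ev_diff graded_ev_homogeneous)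
  then have "G - F + F \<in> q"
    using pointsD(3,8)[OF q] assms(2) by blast
  then show ?thesis by simp
qed

lemma part_mem_iff:
  assumes "q \<in> points Y" "F \<in> PU" "homogeneous d F"
  shows "ev F \<in> part q d \<longleftrightarrow> F \<in> q"
  unfolding part_def using point_ev_cong[OF assms(1) _ assms(2) _ assms(3)] assms(3) by (auto simp: image_iff)

lemma graded_prime_part:
  assumes q: "q \<in> points Y"
  shows "graded_prime (part q)"
  unfolding graded_prime_def
proof (intro conjI allI ballI impI)
  note D = pointsD[OF q]
  show sub: "part q d \<subseteq> gr d" for d
    unfolding part_def gr_def using D(1) by blast
  show "0 \<in> part q d" for d
    using part_mem_iff[OF q PU.zero_mem homogeneous_zero] D(2) by simp
  show "a + b \<in> part q d" if "a \<in> part q d" "b \<in> part q d" for d a b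
  proof -
    obtain F G where "F \<in> q" "homogeneous d F" "a = ev F" "G \<in> q" "homogeneous d G" "b = ev G"
      using \<open>a \<in> part q d\<close> \<open>b \<in> part q d\<close> unfolding part_def by blast
    then show ?thesis
      using D(3) homogeneous_add unfolding part_def by (metis (mono_tags, lifting) evaluate_add image_eqI mem_Collect_eq)
  qed
  show "a * b \<in> part q (d + e)" if a: "a \<in> gr d" and b: "b \<in> part q e" for d e a b
  proof -
    obtain F where F: "F \<in> PU" "homogeneous d F" "a = ev F"
      using a by (rule grE)
    obtain G where G: "G \<in> q" "homogeneous e G" "b = ev G"
      using b unfolding part_def by blast
    have "F * G \<in> q" "homogeneous (d + e) (F * G)"
      using D(4) F G homogeneous_mult by auto
    then show ?thesis
      unfolding F G evaluate_mult[symmetric] part_def by blast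
  qed
  show "a \<in> part q d \<or> b \<in> part q e" if a: "a \<in> gr d" and b: "b \<in> gr e" and ab: "a * b \<in> part q (d + e)" for d e a b
  proof -
    obtain F where F: "F \<in> PU" "homogeneous d F" "a = ev F"
      using a by (rule grE)
    obtain G where G: "G \<in> PU" "homogeneous e G" "b = ev G"
      using b by (rule grE)
    have "F * G \<in> q"
      using ab part_mem_iff[OF q PU.mult_mem[OF F(1) G(1)] homogeneous_mult[OF F(2) G(2)]]
      by (simp add: F G evaluate_mult)
    then show ?thesis
      using D(6)[OF F(1) G(1)] part_mem_iff[OF q] F G by blast
  qed
  obtain i where "i \<le> dim Y" "variable i \<notin> q"
    using D(9) by blast
  then show "\<exists>i\<le>dim Y. crd i \<notin> part q 1"
    using part_mem_iff[OF q variable_mem_polynomials_upto homogeneous_variable] evaluate_variable by metis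
qed

lemma point_of_part:
  assumes q: "q \<in> points Y"
  shows "point_of (part q) = q"
proof (intro equalityI subsetI)
  note D = pointsD[OF q]
  fix F assume F: "F \<in> point_of (part q)"
  then have FP: "F \<in> PU"
    unfolding point_of_def by blast
  have comp: "homogeneous_component d F \<in> q" for d
  proof -
    have "ev (homogeneous_component d F) \<in> part q d"
      using F unfolding point_of_def coeff_graded_ev by blast
    then show ?thesis
      using part_mem_iff[OF q homogeneous_component_mem_polynomials_upto[OF FP] homogeneous_component_homogeneous]
      by blast
  qed
  have "(\<Sum>d\<in>I. homogeneous_component d F) \<in> q" for I
    using comp D(2,3) by (induction I rule: infinite_finite_induct) auto
  then show "F \<in> q"
    by (subst homogeneous_component_decomposition)
next
  note D = pointsD[OF q]
  fix F assume F: "F \<in> q"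
  then have FP: "F \<in> PU"
    using D(1) by blast
  have "ev (homogeneous_component d F) \<in> part q d" for d
    using part_mem_iff[OF q homogeneous_component_mem_polynomials_upto[OF FP] homogeneous_component_homogeneous]
      D(7)[OF F] by blast
  then show "F \<in> point_of (part q)"
    unfolding point_of_def coeff_graded_ev using FP by blast
qed

lemma point_subset_iff:
  assumes "q \<in> points Y" "r \<in> points Y"
  shows "q \<subseteq> r \<longleftrightarrow> (\<forall>d. part q d \<subseteq> part r d)"
proof
  show "q \<subseteq> r \<Longrightarrow> \<forall>d. part q d \<subseteq> part r d"
    unfolding part_def by blast
  assume "\<forall>d. part q d \<subseteq> part r d"
  then have "point_of (part q) \<subseteq> point_of (part r)"
    unfolding point_of_def by blast
  then show "q \<subseteq> r"
    unfolding point_of_part[OF assms(1)] point_of_part[OF assms(2)] .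
qed

lemma stalk_eq_loc:
  assumes q: "q \<in> points Y"
  shows "stalk Y q = loc (\<lambda>d. gr d - part q d)"
proof (intro equalityI subsetI)
  fix y assume "y \<in> stalk Y q"
  then obtain F G d where "F \<in> PU" "G \<in> PU" "homogeneous d F" "homogeneous d G" "G \<notin> q" "y = ev F / ev G"
    unfolding stalk_def by blast
  then show "y \<in> loc (\<lambda>d. gr d - part q d)"
    using part_mem_iff[OF q] grI by (intro locI[of _ d, THEN back_subst[of "\<lambda>x. x \<in> _"]]) auto
next
  fix y assume "y \<in> loc (\<lambda>d. gr d - part q d)"
  then obtain a b d where ab: "a \<in> gr d" "b \<in> gr d" "b \<notin> part q d" "y = a / b"
    unfolding loc_def by blast
  obtain F where F: "F \<in> PU" "homogeneous d F" "a = ev F"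
    using ab(1) by (rule grE)
  obtain G where G: "G \<in> PU" "homogeneous d G" "b = ev G"
    using ab(2) by (rule grE)
  have "G \<notin> q"
    using part_mem_iff[OF q G(1,2)] ab(3) G(3) by blast
  then show "y \<in> stalk Y q"
    unfolding stalk_def using F G ab(4) by blast
qed

lemma graded_prime_generic: "graded_prime (\<lambda>d. {0})"
  unfolding graded_prime_def
  using projective_integral unfolding projective_integral_def by auto

lemma vanishing_ideal_eq: "vanishing_ideal Y = point_of (\<lambda>d. {0})"
  unfolding point_of_def by (auto simp: vanishing_ideal_iff Polynomial.poly_eq_iff)

lemma vanishing_ideal_mem_points: "vanishing_ideal Y \<in> points Y"
  unfolding vanishing_ideal_eq by (rule point_of_mem_points[OF graded_prime_generic])

lemma part_vanishing_ideal: "part (vanishing_ideal Y) = (\<lambda>d. {0})"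
  unfolding vanishing_ideal_eq by (rule part_point_of[OF graded_prime_generic])

lemma fraction_of_forms:
  obtains a b d where "a \<in> gr d" "b \<in> gr d" "b \<noteq> 0" "y = a / b"
proof -
  have "y \<in> stalk Y (vanishing_ideal Y)"
    using projective_integral unfolding projective_integral_def by simp
  then show ?thesis
    unfolding stalk_eq_loc[OF vanishing_ideal_mem_points] part_vanishing_ideal
    using that by (elim locE) auto
qed

end

section \<open>Discrete valuation rings\<close>

lemma is_unit_in_mult: "type_subring R \<Longrightarrow> is_unit_in R a \<Longrightarrow> is_unit_in R b \<Longrightarrow> is_unit_in R (a * b)"
  unfolding is_unit_in_def by (simp add: type_subring.mult_mem)

lemma is_unit_in_inverse: "is_unit_in R a \<Longrightarrow> is_unit_in R (inverse a)"
  unfolding is_unit_in_def by simp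

lemma is_unit_in_one: "type_subring R \<Longrightarrow> is_unit_in R 1"
  unfolding is_unit_in_def by (simp add: type_subring.one_mem)

lemma is_unit_in_power: "type_subring R \<Longrightarrow> is_unit_in R a \<Longrightarrow> is_unit_in R (a ^ n)"
  by (induction n) (simp_all add: is_unit_in_one is_unit_in_mult)

lemma is_unit_in_power_int: "type_subring R \<Longrightarrow> is_unit_in R a \<Longrightarrow> is_unit_in R (a powi n)"
  unfolding power_int_def by (simp add: is_unit_in_power is_unit_in_inverse)

lemma is_unit_in_dvd:
  assumes "type_subring R" "a \<in> R" "b \<in> R" "is_unit_in R (a * b)"
  shows "is_unit_in R a"
proof -
  interpret type_subring R by fact
  have ab: "a \<noteq> 0" "b \<noteq> 0" "inverse (a * b) \<in> R"
    using assms unfolding is_unit_in_def by auto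
  then have eq: "inverse a = b * inverse (a * b)"
    by (simp add: field_simps)
  have "inverse a \<in> R"
    unfolding eq using assms(3) ab(3) by (rule mult_mem)
  then show ?thesis
    unfolding is_unit_in_def using ab(1) assms(2) by simp
qed

text \<open>The maximal ideals \<open>(R : ry)\<close> are prime, as in the theory of associated primes.\<close>

lemma exists_prime_conductor:
  fixes A :: "'a::field set"
  assumes "type_subring A" "noetherian_subring A" "y \<notin> A"
  shows "\<exists>r\<in>A. r * y \<notin> A \<and> primeideal {a \<in> A. a * (r * y) \<in> A} (subring_of_type A)"
proof -
  interpret type_subring A by fact
  define C where "C r = {a \<in> A. a * (r * y) \<in> A}" for r
  have C_mult: "b * a \<in> C r" if "a \<in> C r" "b \<in> A" for a b r
    using that unfolding C_def by (simp add: mult.assoc)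
  have C_add: "a + b \<in> C r" if "a \<in> C r" "b \<in> C r" for a b r
    using that unfolding C_def by (simp add: distrib_right)
  have C_zero: "0 \<in> C r" for r
    unfolding C_def by simp
  have C_sum: "sum f I \<in> C r" if "\<And>i. i \<in> I \<Longrightarrow> f i \<in> C r" for f :: "nat \<Rightarrow> 'a" and I r
    using that by (induction I rule: infinite_finite_induct) (simp_all add: C_add C_zero)
  have "\<exists>r. r \<in> A \<and> r * y \<notin> A \<and> (\<forall>s. s \<in> A \<and> s * y \<notin> A \<longrightarrow> \<not> C r \<subset> C s)"
  proof (rule ccontr)
    assume no: "\<not> ?thesis"
    have step: "\<exists>s. (s \<in> A \<and> s * y \<notin> A) \<and> C r \<subset> C s" if r: "r \<in> A \<and> r * y \<notin> A" for r
      using no r by meson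
    have "\<exists>f. \<forall>n. (f n \<in> A \<and> f n * y \<notin> A) \<and> C (f n) \<subset> C (f (Suc n))"
    proof (rule dependent_nat_choice)
      show "\<exists>x. x \<in> A \<and> x * y \<notin> A"
        using assms(3) by (intro exI[of _ 1]) simp
      show "\<exists>s. (s \<in> A \<and> s * y \<notin> A) \<and> C x \<subset> C s" if "x \<in> A \<and> x * y \<notin> A" for x and n :: nat
        using step[OF that] .
    qed
    then obtain f where f0: "\<forall>n. (f n \<in> A \<and> f n * y \<notin> A) \<and> C (f n) \<subset> C (f (Suc n))"
      by (rule exE)
    have f: "C (f n) \<subset> C (f (Suc n))" for n
      using f0[THEN spec, of n] by (rule conjunct2)
    have mono: "C (f m) \<subseteq> C (f n)" if "m \<le> n" for m n
      by (rule lift_Suc_mono_le[of "\<lambda>n. C (f n)", OF _ that]) (rule psubset_imp_subset[OF f])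
    have "\<forall>n. \<exists>a. a \<in> C (f (Suc n)) - C (f n)"
      using psubset_imp_ex_mem[OF f] by (rule allI)
    then obtain a where "\<forall>n. a n \<in> C (f (Suc n)) - C (f n)"
      by (rule choice[THEN exE])
    then have a: "a n \<in> C (f (Suc n))" "a n \<notin> C (f n)" for n
      by simp_all
    have aA: "a n \<in> A" for n
      using a(1)[of n] unfolding C_def by blast
    obtain n r where r: "\<And>i. r i \<in> A" "a n = (\<Sum>i<n. r i * a i)"
      by (rule noetherian_subringE[where f = a, OF assms(2) aA]) (rule that)
    have "r i * a i \<in> C (f n)" if "i < n" for i
    proof -
      have "a i \<in> C (f n)"
        using subsetD[OF mono[of "Suc i" n] a(1)[of i]] that by simp
      then show ?thesis
        using r(1) by (rule C_mult)
    qed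
    then have "a n \<in> C (f n)"
      unfolding r(2) by (intro C_sum) simp
    then show False
      using a(2) by blast
  qed
  then obtain r where r: "r \<in> A" "r * y \<notin> A" and max': "\<forall>s. s \<in> A \<and> s * y \<notin> A \<longrightarrow> \<not> C r \<subset> C s"
    by (elim exE conjE) (rule that; assumption)
  have max: "\<not> C r \<subset> C s" if "s \<in> A" "s * y \<notin> A" for s
    by (rule max'[THEN spec, THEN mp, OF conjI, OF that])
  have prime: "a \<in> C r \<or> b \<in> C r" if ab: "a \<in> A" "b \<in> A" "a * b \<in> C r" for a b
  proof (rule ccontr)
    assume no: "\<not> ?thesis"
    then have nin: "(b * r) * y \<notin> A"
      using ab(2) unfolding C_def by (simp add: mult.assoc)
    \<comment> \<open>With \<open>b\<close> outside \<open>C r\<close>, the element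
      \<open>b * r\<close> competes with \<open>r\<close>. Maximality makes the two conductors
      equal, although \<open>a\<close> lies in \<open>C (b * r)\<close> and not in
      \<open>C r\<close>.\<close>
    have sub: "C r \<subseteq> C (b * r)"
    proof
      fix c assume "c \<in> C r"
      then have "c \<in> A" "b * (c * (r * y)) \<in> A"
        using ab unfolding C_def by auto
      then show "c \<in> C (b * r)"
        unfolding C_def by (simp add: mult_ac)
    qed
    have "\<not> C r \<subset> C (b * r)"
      by (rule max[OF mult_mem[OF ab(2) r(1)] nin])
    with sub have "C r = C (b * r)"
      by (simp only: psubset_eq simp_thms)
    moreover have "a \<in> C (b * r)"
      using ab unfolding C_def by (simp add: mult_ac)
    ultimately show False
      using no by blast
  qed
  have one: "1 \<notin> C r"
    unfolding C_def using r by simp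
  have sub: "C r \<subseteq> A"
    unfolding C_def by blast
  have "primeideal (C r) (subring_of_type A)"
    unfolding primeideal_subring_of_type_iff
    by (intro conjI ballI impI sub one C_zero) ((rule C_add C_mult prime; assumption)+)
  then show ?thesis
    using r unfolding C_def by blast
qed

text \<open>Multiplication by \<open>y\<close> carries the set \<open>N\<close> of nonunits into
  \<open>R\<close>. If it carried \<open>N\<close> into itself, \<open>y\<close> would be integral
  over \<open>R\<close> and, by normality, an element of \<open>R\<close>. So \<open>y * t\<close>
  is a unit for some \<open>t\<close> in \<open>N\<close>, and
  \<open>x = t * (y * x) / (y * t)\<close> shows that \<open>t\<close> generates \<open>N\<close>.
  The element \<open>z\<close> makes \<open>N\<close> nonzero and serves as a denominator of
  \<open>y\<close>.\<close>

lemma uniformizer_of_conductor: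
  fixes A :: "'a::field set"
  assumes A: "type_subring A" and p: "primeideal p (subring_of_type A)" "p = {a \<in> A. a * y \<in> A}"
    and "y \<notin> A" and z: "z \<in> p" "z \<noteq> 0"
    and R: "R = {a / b | a b. a \<in> A \<and> b \<in> A \<and> b \<notin> p}" and "type_subring R" "noetherian_subring R" "normal_subring R"
  shows "\<exists>t. t \<noteq> 0 \<and> uniformizer R t" "y \<notin> R" "{a \<in> R. \<not> is_unit_in R a} = {a / b | a b. a \<in> p \<and> b \<in> A \<and> b \<notin> p}"
proof -
  interpret A: type_subring A by fact
  interpret R: type_subring R by fact
  note P = p(1)[unfolded A.primeideal_subring_of_type_iff]
  define N where "N = {a \<in> R. \<not> is_unit_in R a}"
  have one: "1 \<in> A" "1 \<notin> p"
    using P by auto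
  have N_iff: "N = {a / b | a b. a \<in> p \<and> b \<in> A \<and> b \<notin> p}"
  proof (intro equalityI subsetI)
    fix x assume "x \<in> N"
    then obtain a b where ab: "a \<in> A" "b \<in> A" "b \<notin> p" "x = a / b" and nu: "\<not> is_unit_in R x" and "x \<in> R"
      unfolding N_def R by blast
    have "a \<in> p"
    proof (rule ccontr)
      assume "a \<notin> p"
      then have "b / a \<in> R" "a \<noteq> 0" "b \<noteq> 0"
        using ab P unfolding R by auto
      then show False
        using nu \<open>x \<in> R\<close> ab(4) unfolding is_unit_in_def by simp
    qed
    then show "x \<in> {a / b | a b. a \<in> p \<and> b \<in> A \<and> b \<notin> p}"
      using ab by blast
  next
    fix x assume "x \<in> {a / b | a b. a \<in> p \<and> b \<in> A \<and> b \<notin> p}"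
    then obtain a b where ab: "a \<in> p" "b \<in> A" "b \<notin> p" "x = a / b"
      by blast
    have aA: "a \<in> A"
      using ab P by blast
    have "\<not> is_unit_in R x"
    proof
      assume u: "is_unit_in R x"
      then obtain c d where cd: "c \<in> A" "d \<in> A" "d \<notin> p" "inverse x = c / d" and x0: "x \<noteq> 0"
        unfolding is_unit_in_def R by blast
      have "d \<noteq> 0" "b \<noteq> 0" "a \<noteq> 0"
        using P cd ab x0 by auto
      then have "b * d = c * a"
        using cd(4) ab(4) by (simp add: field_simps)
      then have "b * d \<in> p"
        using P cd(1) ab(1) by simp
      then show False
        using P ab cd by blast
    qed
    moreover have "x \<in> R"
      using ab aA unfolding R by blast
    ultimately show "x \<in> N"
      unfolding N_def by blast
  qed
  then show "{a \<in> R. \<not> is_unit_in R a} = {a / b | a b. a \<in> p \<and> b \<in> A \<and> b \<notin> p}"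
    unfolding N_def .
  show yR: "y \<notin> R"
  proof
    assume "y \<in> R"
    then obtain a b where ab: "a \<in> A" "b \<in> A" "b \<notin> p" "y = a / b"
      unfolding R by blast
    then have "b \<noteq> 0"
      using P by auto
    then have "b * y = a"
      using ab by simp
    then show False
      using ab p(2) by auto
  qed
  have y0: "y \<noteq> 0"
    using yR by auto
  have yN: "y * x \<in> R" if x: "x \<in> N" for x
  proof -
    obtain a b where ab: "a \<in> p" "b \<in> A" "b \<notin> p" "x = a / b"
      using x unfolding N_iff by blast
    then have "a * y \<in> A"
      using p(2) by blast
    moreover have "y * x = a * y / b"
      using ab by simp
    ultimately show ?thesis
      using ab unfolding R by blast
  qed
  have "z = z / 1"
    by simp
  then have zN: "z \<in> N"
    unfolding N_iff using z one by blast
  have "\<exists>t\<in>N. y * t \<notin> N"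
  proof (rule ccontr)
    assume "\<not> ?thesis"
    then have "y ^ n * z \<in> N" for n
      by (induction n) (simp_all add: zN mult.assoc)
    then have "y ^ n * z \<in> R" for n
      unfolding N_def by blast
    then obtain n r where "\<And>i. r i \<in> R" "y ^ n = (\<Sum>i<n. r i * y ^ i)"
      using noetherian_integral[OF assms(9) z(2), of y] by blast
    then have "integral_over R y"
      using integral_overI[OF assms(8)] by blast
    moreover have "y = (y * z) / z"
      using z by simp
    moreover have "y * z \<in> R" "z \<in> R"
      using yN[OF zN] zN unfolding N_def by auto
    ultimately have "y \<in> R"
      using assms(10) z(2) unfolding normal_subring_def by metis
    then show False
      using yR by blast
  qed
  then obtain t where t: "t \<in> N" "y * t \<notin> N"
    by blast
  then have tR: "t \<in> R" "\<not> is_unit_in R t" and u: "is_unit_in R (y * t)"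
    using yN unfolding N_def by auto
  have t0: "t \<noteq> 0"
    using u unfolding is_unit_in_def by auto
  have "N = {t * a | a. a \<in> R}"
  proof (intro equalityI subsetI)
    fix x assume x: "x \<in> N"
    have "x = t * (y * x * inverse (y * t))"
      using t0 y0 by (simp add: field_simps)
    moreover have "y * x * inverse (y * t) \<in> R"
      using yN[OF x] u unfolding is_unit_in_def by blast
    ultimately show "x \<in> {t * a | a. a \<in> R}"
      by blast
  next
    fix x assume "x \<in> {t * a | a. a \<in> R}"
    then obtain a where a: "a \<in> R" "x = t * a"
      by blast
    then show "x \<in> N"
      using is_unit_in_dvd[OF assms(8) tR(1) a(1)] tR unfolding N_def by auto
  qed
  then show "\<exists>t. t \<noteq> 0 \<and> uniformizer R t"
    using t0 unfolding uniformizer_def N_def by blast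
qed

locale dvr = type_subring R for R :: "'a::field set" +
  fixes t :: 'a
  assumes noeth: "noetherian_subring R" and unif: "uniformizer R t" and t0: "t \<noteq> 0"
    and fractions: "\<exists>a\<in>R. \<exists>b\<in>R. b \<noteq> 0 \<and> x = a / b"
begin

lemma nonunit_iff: "a \<in> R \<Longrightarrow> \<not> is_unit_in R a \<longleftrightarrow> (\<exists>b\<in>R. a = t * b)"
  using unif unfolding uniformizer_def by blast

lemma t_mem: "t \<in> R" and t_nonunit: "\<not> is_unit_in R t"
proof -
  have "t * 1 \<in> {a \<in> R. \<not> is_unit_in R a}"
    using unif one_mem unfolding uniformizer_def by blast
  then show "t \<in> R" "\<not> is_unit_in R t"
    by auto
qed

text \<open>Otherwise \<open>x\<close> is divisible by every power of \<open>t\<close>, and a chain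
  relation among the quotients \<open>x / t ^ n\<close> makes \<open>t\<close> invertible.\<close>

lemma unit_times_power:
  assumes "x \<in> R" "x \<noteq> 0"
  shows "\<exists>u n. is_unit_in R u \<and> x = u * t ^ n"
proof (rule ccontr)
  assume no: "\<not> ?thesis"
  have "x / t ^ n \<in> R" for n
  proof (induction n)
    case (Suc n)
    have "\<not> is_unit_in R (x / t ^ n)"
    proof
      assume "is_unit_in R (x / t ^ n)"
      moreover have "x = (x / t ^ n) * t ^ n"
        using t0 by simp
      ultimately show False
        using no by blast
    qed
    then obtain b where "b \<in> R" "x / t ^ n = t * b"
      using nonunit_iff[OF Suc] by blast
    then have "x / t ^ Suc n = b"
      using t0 by (simp add: field_simps)
    then show ?case
      using \<open>b \<in> R\<close> by simp
  qed (simp add: assms)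
  then obtain n r where r: "\<And>i. r i \<in> R" "x / t ^ n = (\<Sum>i<n. r i * (x / t ^ i))"
    by (rule noetherian_subringE[where f = "\<lambda>n. x / t ^ n", OF noeth]) (rule that)
  define s where "s = (\<Sum>i<n. r i * t ^ (n - Suc i))"
  have "1 = (x / t ^ n) * (t ^ n / x)"
    using t0 assms by simp
  also have "\<dots> = (\<Sum>i<n. r i * (x / t ^ i) * (t ^ n / x))"
    unfolding r(2) sum_distrib_right ..
  also have "\<dots> = (\<Sum>i<n. t * (r i * t ^ (n - Suc i)))"
  proof (rule sum.cong)
    fix i assume "i \<in> {..<n}"
    then have "t ^ n = t ^ i * (t * t ^ (n - Suc i))"
      by (simp flip: power_add power_Suc)
    then show "r i * (x / t ^ i) * (t ^ n / x) = t * (r i * t ^ (n - Suc i))"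
      using t0 assms by (simp add: field_simps)
  qed simp
  also have "\<dots> = t * s"
    unfolding s_def sum_distrib_left ..
  finally have ts: "t * s = 1" ..
  have "s \<in> R"
    unfolding s_def using r(1) t_mem by (intro sum_mem mult_mem power_mem)
  moreover have "inverse t = s"
    using ts by (rule inverse_unique)
  ultimately show False
    using t_nonunit t_mem t0 unfolding is_unit_in_def by simp
qed

section \<open>The valuation of a discrete valuation ring\<close>

lemma unit_times_powi:
  assumes "x \<noteq> 0"
  shows "\<exists>u n. is_unit_in R u \<and> x = u * t powi n"
proof -
  obtain a b where ab: "a \<in> R" "b \<in> R" "b \<noteq> 0" "x = a / b"
    using fractions by blast
  then have "a \<noteq> 0"
    using assms by auto
  then obtain u n w m where u: "is_unit_in R u" "a = u * t ^ n" and w: "is_unit_in R w" "b = w * t ^ m"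
    using unit_times_power ab by meson
  have "x = (u * inverse w) * t powi (int n - int m)"
    unfolding ab(4) u(2) w(2) using t0 w(1) by (simp add: power_int_diff field_simps is_unit_in_def)
  moreover have "is_unit_in R (u * inverse w)"
    using u w by (intro is_unit_in_mult is_unit_in_inverse type_subring_axioms)
  ultimately show ?thesis
    by blast
qed

lemma powi_unit_eq_zero:
  assumes "is_unit_in R (t powi n)"
  shows "n = 0"
proof (rule ccontr)
  assume "n \<noteq> 0"
  define k where "k = nat \<bar>n\<bar> - 1"
  have "is_unit_in R (t ^ Suc k)"
  proof (cases "n > 0")
    case True
    then have "t powi n = t ^ Suc k"
      unfolding k_def by (simp add: power_int_def del: power_Suc)
    then show ?thesis using assms by simp
  next
    case False
    then have "t ^ Suc k = inverse (t powi n)"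
      using \<open>n \<noteq> 0\<close> unfolding k_def by (simp add: power_int_def power_inverse del: power_Suc)
    then show ?thesis
      using is_unit_in_inverse[OF assms] by simp
  qed
  then show False
    using is_unit_in_dvd[OF type_subring_axioms t_mem, of "t ^ k"] t_mem t_nonunit by simp
qed

lemma valuation_unique:
  assumes "is_unit_in R u" "is_unit_in R w" "u * t powi n = w * t powi m"
  shows "n = m"
proof -
  have "t powi (n - m) = w * inverse u"
    using assms t0 by (auto simp: power_int_diff field_simps is_unit_in_def)
  then have "is_unit_in R (t powi (n - m))"
    using assms by (simp add: is_unit_in_mult is_unit_in_inverse type_subring_axioms)
  then show ?thesis
    using powi_unit_eq_zero by fastforce
qed

lemma uniformizer_associated:
  assumes "uniformizer R s"
  shows "is_unit_in R (s / t)"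
proof -
  have "t * 1 \<in> {s * a | a. a \<in> R}"
    using unif one_mem assms unfolding uniformizer_def by blast
  then obtain a where a: "a \<in> R" "t = s * a"
    by auto
  have "s * 1 \<in> {t * a | a. a \<in> R}"
    using unif one_mem assms unfolding uniformizer_def by blast
  then obtain b where b: "b \<in> R" "s = t * b"
    by auto
  have "t * (b * a) = t * 1"
    using a(2) b(2) by (simp add: mult.assoc)
  then have ba: "b * a = 1"
    using t0 by simp
  have "s / t = b"
    using b t0 by simp
  moreover have "inverse b = a"
    using ba by (rule inverse_unique)
  moreover have "b \<noteq> 0"
    using ba by auto
  ultimately show ?thesis
    unfolding is_unit_in_def using a(1) b(1) by simp
qed

text \<open>The formula of \<open>ord_at\<close>, so that the two can be identified. It ranges over
  all uniformizers; two of them differ by a unit, so the exponent does not depend on the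
  choice.\<close>

definition val :: "'a \<Rightarrow> int"
  where "val x = (THE m. \<exists>s a. uniformizer R s \<and> is_unit_in R a \<and> x = a * s powi m)"

lemma val_eqI:
  assumes "is_unit_in R u"
  shows "val (u * t powi n) = n"
  unfolding val_def
proof (rule the_equality)
  show "\<exists>s a. uniformizer R s \<and> is_unit_in R a \<and> u * t powi n = a * s powi n"
    using unif assms by blast
  fix m assume "\<exists>s a. uniformizer R s \<and> is_unit_in R a \<and> u * t powi n = a * s powi m"
  then obtain s a where s: "uniformizer R s" "is_unit_in R a" "u * t powi n = a * s powi m"
    by blast
  define c where "c = s / t"
  have c: "is_unit_in R c"
    unfolding c_def by (rule uniformizer_associated[OF s(1)])
  have "s = c * t"
    unfolding c_def using t0 by simp
  then have "u * t powi n = (a * c powi m) * t powi m"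
    using s(3) by (simp add: power_int_mult_distrib)
  then show "m = n"
    using valuation_unique[OF assms is_unit_in_mult[OF type_subring_axioms s(2) is_unit_in_power_int[OF type_subring_axioms c]]]
    by metis
qed

lemma mem_iff_val:
  assumes "x \<noteq> 0"
  shows "x \<in> R \<longleftrightarrow> val x \<ge> 0"
proof
  assume "x \<in> R"
  then obtain u n where "is_unit_in R u" "x = u * t ^ n"
    using unit_times_power assms by blast
  then show "val x \<ge> 0"
    using val_eqI[of u "int n"] by simp
next
  assume "val x \<ge> 0"
  obtain u n where u: "is_unit_in R u" "x = u * t powi n"
    using unit_times_powi[OF assms] by blast
  then have "n \<ge> 0"
    using val_eqI \<open>val x \<ge> 0\<close> by simp
  then have "x = u * t ^ nat n"
    unfolding u(2) by (simp add: power_int_def)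
  then show "x \<in> R"
    using u t_mem unfolding is_unit_in_def by simp
qed

lemma val_mult:
  assumes "x \<noteq> 0" "y \<noteq> 0"
  shows "val (x * y) = val x + val y"
proof -
  obtain u n w m where u: "is_unit_in R u" "x = u * t powi n" and w: "is_unit_in R w" "y = w * t powi m"
    using unit_times_powi assms by meson
  have xy: "x * y = (u * w) * t powi (n + m)"
    unfolding u w using t0 by (simp add: power_int_add)
  have "val (x * y) = n + m"
    unfolding xy by (rule val_eqI[OF is_unit_in_mult[OF type_subring_axioms u(1) w(1)]])
  moreover have "val x = n" "val y = m"
    unfolding u(2) w(2) using val_eqI[OF u(1)] val_eqI[OF w(1)] by blast+
  ultimately show ?thesis by simp
qed

lemma field_valuation_val: "field_valuation val"
proof
  fix x y :: 'a assume xy: "x \<noteq> 0" "y \<noteq> 0"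
  show "val (x * y) = val x + val y"
    using val_mult[OF xy] .
  assume s: "x + y \<noteq> 0"
  have *: "min (val x) (val y) \<le> val (x + y)" if xy: "x \<noteq> 0" "y \<noteq> 0" "x + y \<noteq> 0" "val x \<le> val y" for x y
  proof -
    have "val (y / x) = val y - val x"
      using val_mult[of "y / x" x] xy by simp
    then have "y / x \<in> R"
      using mem_iff_val[of "y / x"] xy by simp
    then have "1 + y / x \<in> R"
      by simp
    moreover have eq: "x + y = x * (1 + y / x)"
      using xy by (simp add: field_simps)
    then have "1 + y / x \<noteq> 0"
      using xy by auto
    ultimately show ?thesis
      using mem_iff_val[of "1 + y / x"] val_mult[of x "1 + y / x"] xy eq by simp
  qed
  show "min (val x) (val y) \<le> val (x + y)"
    using *[of x y] *[of y x] xy s by (cases "val x \<le> val y") (auto simp: add.commute min.commute)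
qed

end

context projective_scheme
begin

section \<open>Prime divisors\<close>

lemma loc_fractions:
  assumes S: "graded_submonoid S" and i: "i \<le> dim Y" "\<And>d. crd i ^ d \<in> S d"
  shows "\<exists>a\<in>loc S. \<exists>b\<in>loc S. b \<noteq> 0 \<and> y = a / b"
proof -
  obtain a b d where ab: "a \<in> gr d" "b \<in> gr d" "b \<noteq> 0" "y = a / b"
    by (rule fraction_of_forms[of y])
  have "crd i ^ d \<noteq> 0"
    using graded_submonoidD(3)[OF S i(2)] .
  then have "y = (a / crd i ^ d) / (b / crd i ^ d)" "b / crd i ^ d \<noteq> 0"
    using ab by auto
  then show ?thesis
    using locI[where S = S, OF ab(1) i(2)] locI[where S = S, OF ab(2) i(2)] by blast
qed

text \<open>Pulls a prime of a localization back to forms: a form is tested after division by the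
  power of \<open>crd i\<close> of the same degree.\<close>

definition contraction :: "'K set \<Rightarrow> nat \<Rightarrow> nat \<Rightarrow> 'K set"
  where "contraction p i d = {a \<in> gr d. a / crd i ^ d \<in> p}"

text \<open>The correspondence between primes of a degree-0 localization and homogeneous primes that
  avoid the denominators, with equal local rings. It rests on \<open>m / crd i ^ d\<close> being a
  unit of \<open>loc S\<close> for each denominator \<open>m\<close> of degree
  \<open>d\<close>.\<close>

lemma contraction:
  assumes S: "graded_submonoid S" and i: "i \<le> dim Y" "\<And>d. crd i ^ d \<in> S d"
    and p: "primeideal p (subring_of_type (loc S))"
  shows graded_prime_contraction: "graded_prime (contraction p i)"
    and loc_contraction: "loc (\<lambda>d. gr d - contraction p i d) = {a / b | a b. a \<in> loc S \<and> b \<in> loc S \<and> b \<notin> p}"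
    and contraction_disjoint: "contraction p i d \<inter> S d = {}"
proof -
  interpret R: type_subring "loc S"
    by (rule type_subring_loc[OF S])
  note P = p[unfolded R.primeideal_subring_of_type_iff]
  have x0: "crd i \<noteq> 0"
    using graded_submonoidD(3)[OF S i(2)[of 1]] by simp
  have chart: "a / crd i ^ d \<in> loc S" if "a \<in> gr d" for a d
    by (rule locI[where S = S, OF that i(2)])
  have invert: "crd i ^ d / m \<in> loc S" if "m \<in> S d" for m d
    by (rule locI[where S = S, OF gr_coord_power[OF i(1)] that])
  have frac_mult: "(a * b) / crd i ^ (d + e) = (a / crd i ^ d) * (b / crd i ^ e)" for a b d e
    by (simp add: power_add)
  have unit_notin: "m / crd i ^ d \<notin> p" if m: "m \<in> S d" for m d
  proof
    assume "m / crd i ^ d \<in> p"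
    then have "(crd i ^ d / m) * (m / crd i ^ d) \<in> p"
      using P invert[OF m] by blast
    moreover have "m \<noteq> 0"
      using graded_submonoidD(3)[OF S m] .
    ultimately show False
      using P x0 by simp
  qed
  show "contraction p i d \<inter> S d = {}" for d
    unfolding contraction_def using unit_notin by blast
  show "graded_prime (contraction p i)"
    unfolding graded_prime_def
  proof (intro conjI allI ballI impI)
    show "contraction p i d \<subseteq> gr d" for d
      unfolding contraction_def by blast
    show "0 \<in> contraction p i d" for d
      unfolding contraction_def using P by simp
    show "a + b \<in> contraction p i d" if "a \<in> contraction p i d" "b \<in> contraction p i d" for a b d
      using that P gr_add unfolding contraction_def by (simp add: add_divide_distrib)
    show "a * b \<in> contraction p i (d + e)" if "a \<in> gr d" "b \<in> contraction p i e" for a b d e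
    proof -
      have "(a / crd i ^ d) * (b / crd i ^ e) \<in> p"
        using that P chart[of a d] unfolding contraction_def by blast
      then show ?thesis
        using that gr_mult unfolding contraction_def mem_Collect_eq frac_mult by blast
    qed
    show "a \<in> contraction p i d \<or> b \<in> contraction p i e"
      if "a \<in> gr d" "b \<in> gr e" "a * b \<in> contraction p i (d + e)" for a b d e
      using that P chart[of a d] chart[of b e] unfolding contraction_def mem_Collect_eq frac_mult by blast
    have "crd i \<notin> contraction p i 1"
      unfolding contraction_def using P x0 by simp
    then show "\<exists>j\<le>dim Y. crd j \<notin> contraction p i 1"
      using i(1) by blast
  qed
  show "loc (\<lambda>d. gr d - contraction p i d) = {a / b | a b. a \<in> loc S \<and> b \<in> loc S \<and> b \<notin> p}"
  proof (intro equalityI subsetI)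
    fix y assume "y \<in> loc (\<lambda>d. gr d - contraction p i d)"
    then obtain a b d where ab: "a \<in> gr d" "b \<in> gr d" "b \<notin> contraction p i d" "y = a / b"
      unfolding loc_def by blast
    then have "y = (a / crd i ^ d) / (b / crd i ^ d)" "b / crd i ^ d \<notin> p"
      using x0 unfolding contraction_def by auto
    then show "y \<in> {a / b | a b. a \<in> loc S \<and> b \<in> loc S \<and> b \<notin> p}"
      using chart[OF ab(1)] chart[OF ab(2)] by blast
  next
    fix y assume "y \<in> {a / b | a b. a \<in> loc S \<and> b \<in> loc S \<and> b \<notin> p}"
    then obtain a b where ab: "a \<in> loc S" "b \<in> loc S" "b \<notin> p" "y = a / b"
      by blast
    obtain a' m d where a: "a' \<in> gr d" "m \<in> S d" "a = a' / m"
      using ab(1) by (rule locE)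
    obtain b' n e where b: "b' \<in> gr e" "n \<in> S e" "b = b' / n"
      using ab(2) by (rule locE)
    note mn = graded_submonoidD(2,3)[OF S a(2)] graded_submonoidD(2,3)[OF S b(2)]
    have eq: "(b' * m) / crd i ^ (e + d) = b * ((n / crd i ^ e) * (m / crd i ^ d))"
      unfolding b(3) using mn by (simp add: power_add)
    have "(n / crd i ^ e) * (m / crd i ^ d) \<notin> p"
      using P unit_notin[OF b(2)] unit_notin[OF a(2)] chart[OF mn(1)] chart[OF mn(3)] by blast
    then have "b * ((n / crd i ^ e) * (m / crd i ^ d)) \<notin> p"
      using P ab(2,3) R.mult_mem[OF chart[OF mn(3)] chart[OF mn(1)]] by blast
    then have "b' * m \<in> gr (e + d) - contraction p i (e + d)"
      using gr_mult[OF b(1) mn(1)] unfolding contraction_def eq[symmetric] by blast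
    moreover have "a' * n \<in> gr (e + d)"
      by (rule gr_mult'[OF a(1) mn(3)])
    moreover have "y = (a' * n) / (b' * m)"
      unfolding ab(4) a(3) b(3) by simp
    ultimately show "y \<in> loc (\<lambda>d. gr d - contraction p i d)"
      using locI[of "a' * n" "e + d" "b' * m" "\<lambda>d. gr d - contraction p i d"] by simp
  qed
qed

lemma dvr_stalk:
  assumes q: "q \<in> points Y" and "t \<noteq> 0" "uniformizer (stalk Y q) t"
  shows "dvr (stalk Y q) t"
proof -
  let ?S = "\<lambda>d. gr d - part q d"
  have S: "graded_submonoid ?S"
    by (rule graded_submonoid_complement[OF graded_prime_part[OF q]])
  obtain i where i: "i \<le> dim Y" "crd i \<notin> part q 1"
    using graded_primeD(6)[OF graded_prime_part[OF q]] by blast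
  have *: "crd i ^ d \<in> ?S d" for d
    using graded_prime_coord_power[OF graded_prime_part[OF q] i] gr_coord_power[OF i(1)] by blast
  have eq: "stalk Y q = loc ?S"
    by (rule stalk_eq_loc[OF q])
  interpret type_subring "stalk Y q"
    unfolding eq by (rule type_subring_loc[OF S])
  show ?thesis
    using assms(2,3) noetherian_loc[OF S] loc_fractions[where S = ?S and i = i, OF S i(1) *]
    by unfold_locales (simp_all add: eq)
qed

text \<open>A point whose local ring is a discrete valuation ring has codimension one: over it a
  smaller graded prime contains a form, hence the numerator of the uniformizer.\<close>

lemma prime_divisor_if_dvr:
  assumes q: "q \<in> points Y" and t: "t \<noteq> 0" "uniformizer (stalk Y q) t"
  shows "q \<in> prime_divisors Y"
proof -
  interpret dvr "stalk Y q" t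
    by (rule dvr_stalk[OF assms])
  let ?\<rho> = "part q"
  have \<rho>: "graded_prime ?\<rho>"
    by (rule graded_prime_part[OF q])
  note D = graded_primeD[OF \<rho>]
  have eq: "stalk Y q = loc (\<lambda>d. gr d - ?\<rho> d)"
    by (rule stalk_eq_loc[OF q])
  obtain i where i: "i \<le> dim Y" "crd i \<notin> ?\<rho> 1"
    using D(6) by blast
  have xi: "crd i ^ d \<in> gr d - ?\<rho> d" for d
    using graded_prime_coord_power[OF \<rho> i] gr_coord_power[OF i(1)] by blast
  have x0: "crd i \<noteq> 0"
    using i D(2) by auto
  obtain a b e where ab: "a \<in> gr e" "b \<in> gr e" "b \<notin> ?\<rho> e" "t = a / b"
    using t_mem unfolding eq loc_def by blast
  have b0: "b \<noteq> 0" and a0: "a \<noteq> 0"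
    using ab D(2) t by auto
  have a\<rho>: "a \<in> ?\<rho> e"
  proof (rule ccontr)
    assume "a \<notin> ?\<rho> e"
    then have "b / a \<in> stalk Y q"
      unfolding eq using ab by (intro locI[where S = "\<lambda>d. gr d - ?\<rho> d"]) auto
    moreover have "inverse t = b / a"
      unfolding ab(4) by simp
    ultimately show False
      using t_nonunit t_mem t unfolding is_unit_in_def by simp
  qed
  have "q \<noteq> vanishing_ideal Y"
    using a\<rho> a0 part_vanishing_ideal by auto
  moreover have "\<not> (vanishing_ideal Y \<subset> r \<and> r \<subset> q)" if r: "r \<in> points Y" for r
  proof
    assume sub: "vanishing_ideal Y \<subset> r \<and> r \<subset> q"
    let ?\<tau> = "part r"
    have \<tau>: "graded_prime ?\<tau>"
      by (rule graded_prime_part[OF r])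
    note T = graded_primeD[OF \<tau>]
    have \<tau>\<rho>: "?\<tau> d \<subseteq> ?\<rho> d" for d
      using sub point_subset_iff[OF r q] by blast
    have "\<not> r \<subseteq> vanishing_ideal Y"
      using sub by blast
    then obtain d f where f: "f \<in> ?\<tau> d" "f \<noteq> 0"
      unfolding point_subset_iff[OF r vanishing_ideal_mem_points] part_vanishing_ideal by blast
    have "f / crd i ^ d \<in> stalk Y q"
      unfolding eq by (rule locI[where S = "\<lambda>d. gr d - ?\<rho> d", OF T(1)[OF f(1)] xi])
    then obtain u n where u: "is_unit_in (stalk Y q) u" "f / crd i ^ d = u * t ^ n"
      using unit_times_power f(2) x0 by fastforce
    have "inverse u \<in> stalk Y q" "u \<noteq> 0"
      using u(1) unfolding is_unit_in_def by auto
    then obtain c g h where cg: "c \<in> gr h" "g \<in> gr h" "g \<notin> ?\<rho> h" "inverse u = c / g"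
      unfolding eq loc_def by blast
    have c0: "c \<noteq> 0"
      using cg D(2) \<open>u \<noteq> 0\<close> by auto
    have "u = g / c"
      using cg(4) by (metis inverse_divide inverse_inverse_eq)
    \<comment> \<open>This clears the denominators of \<open>f / crd i ^ d = u * t ^ n\<close>. The
      left side lies in the smaller prime, and on the right \<open>g\<close> and
      \<open>crd i\<close> lie outside even the larger one, so \<open>a\<close> must lie in the
      smaller one.\<close>
    then have key: "(c * b ^ n) * f = (g * crd i ^ d) * a ^ n"
      using u(2) b0 c0 x0 unfolding ab(4) by (simp add: field_simps)
    have "(c * b ^ n) * f \<in> ?\<tau> (h + n * e + d)"
      by (intro T(4) gr_mult cg gr_power ab f(1))
    then have "(g * crd i ^ d) * a ^ n \<in> ?\<tau> ((h + d) + n * e)"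
      unfolding key by (simp add: ac_simps)
    moreover have "g * crd i ^ d \<in> gr (h + d)" "a ^ n \<in> gr (n * e)"
      using cg xi gr_mult gr_power ab by auto
    ultimately have "g * crd i ^ d \<in> ?\<tau> (h + d) \<or> a ^ n \<in> ?\<tau> (n * e)"
      by (intro T(5))
    moreover have "g * crd i ^ d \<notin> ?\<tau> (h + d)"
      using \<tau>\<rho> D(5)[OF cg(2), of "crd i ^ d" d] xi cg(3) by blast
    ultimately have a\<tau>: "a \<in> ?\<tau> e"
      using graded_prime_power[OF \<tau> ab(1)] by blast
    \<comment> \<open>A form of the larger prime gives a nonunit of the local ring, hence a multiple
      of \<open>t = a / b\<close>; since \<open>a\<close> lies in the smaller prime, so does the
      form.\<close>
    have "?\<rho> d \<subseteq> ?\<tau> d" for d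
    proof
      fix g assume g: "g \<in> ?\<rho> d"
      let ?y = "g / crd i ^ d"
      have yR: "?y \<in> stalk Y q"
        unfolding eq by (rule locI[where S = "\<lambda>d. gr d - ?\<rho> d", OF D(1)[OF g] xi])
      have "\<not> is_unit_in (stalk Y q) ?y"
      proof
        assume "is_unit_in (stalk Y q) ?y"
        then have "inverse ?y \<in> stalk Y q" "g \<noteq> 0"
          unfolding is_unit_in_def by auto
        then obtain c k h where ck: "c \<in> gr h" "k \<in> gr h" "k \<notin> ?\<rho> h" "inverse ?y = c / k"
          unfolding eq loc_def by blast
        then have "k \<noteq> 0"
          using D(2) by auto
        then have "crd i ^ d * k = c * g"
          using ck(4) \<open>g \<noteq> 0\<close> by (simp add: field_simps)
        then have "crd i ^ d * k \<in> ?\<rho> (d + h)"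
          using D(4)[OF ck(1) g] by (simp add: add.commute)
        then show False
          using D(5)[of "crd i ^ d" d k h] xi ck by blast
      qed
      then obtain w where w: "w \<in> stalk Y q" "?y = t * w"
        using nonunit_iff[OF yR] by blast
      then obtain c k h where ck: "c \<in> gr h" "k \<in> gr h" "k \<notin> ?\<rho> h" "w = c / k"
        unfolding eq loc_def by blast
      then have "k \<noteq> 0"
        using D(2) by auto
      then have key: "(b * k) * g = (c * crd i ^ d) * a"
        using w(2) b0 x0 unfolding ab(4) ck(4) by (simp add: field_simps)
      have "(c * crd i ^ d) * a \<in> ?\<tau> (h + d + e)"
        using ck xi by (intro T(4) gr_mult a\<tau>) auto
      then have "(b * k) * g \<in> ?\<tau> ((e + h) + d)"
        unfolding key by (simp add: ac_simps)
      moreover have "b * k \<notin> ?\<tau> (e + h)"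
        using \<tau>\<rho> D(5)[OF ab(2) ck(2)] ab(3) ck(3) by blast
      ultimately show "g \<in> ?\<tau> d"
        using T(5)[OF gr_mult[OF ab(2) ck(2)] D(1)[OF g]] by blast
    qed
    then have "q \<subseteq> r"
      using point_subset_iff[OF q r] by blast
    then show False
      using sub by blast
  qed
  ultimately show ?thesis
    unfolding prime_divisors_def using q by blast
qed

end

locale normal_projective_scheme = projective_scheme +
  assumes normal: "q \<in> points Y \<Longrightarrow> normal_subring (stalk Y q)"
begin

text \<open>The point sought corresponds to the prime conductor of a multiple \<open>r * y\<close>.
  Normality turns its local ring into a discrete valuation ring, so the point has codimension one.
  Disjointness from \<open>S\<close> places it in the part of \<open>Y\<close> that the localization
  describes.\<close>

lemma exists_prime_divisor:
  assumes S: "graded_submonoid S" and i: "i \<le> dim Y" "\<And>d. crd i ^ d \<in> S d" and "y \<notin> loc S"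
  shows "\<exists>W t. W \<in> prime_divisors Y \<and> y \<notin> stalk Y W \<and> t \<noteq> 0 \<and> uniformizer (stalk Y W) t \<and>
    (\<forall>d. part W d \<inter> S d = {})"
proof -
  let ?A = "loc S"
  interpret A: type_subring ?A
    by (rule type_subring_loc[OF S])
  obtain r where r: "r \<in> ?A" "r * y \<notin> ?A" "primeideal {a \<in> ?A. a * (r * y) \<in> ?A} (subring_of_type ?A)"
    using exists_prime_conductor[OF A.type_subring_axioms noetherian_loc[OF S] assms(4)] by blast
  define p where "p = {a \<in> ?A. a * (r * y) \<in> ?A}"
  have p: "primeideal p (subring_of_type ?A)"
    using r(3) unfolding p_def .
  define W where "W = point_of (contraction p i)"
  note C = contraction[where S = S and i = i, OF S i p]
  have W: "W \<in> points Y"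
    unfolding W_def by (rule point_of_mem_points[OF C(1)])
  have part: "part W = contraction p i"
    unfolding W_def by (rule part_point_of[OF C(1)])
  have eq: "stalk Y W = {a / b | a b. a \<in> ?A \<and> b \<in> ?A \<and> b \<notin> p}"
    unfolding stalk_eq_loc[OF W] part by (rule C(2))
  have S': "graded_submonoid (\<lambda>d. gr d - part W d)"
    by (rule graded_submonoid_complement[OF graded_prime_part[OF W]])
  obtain a b where ab: "a \<in> ?A" "b \<in> ?A" "b \<noteq> 0" "r * y = a / b"
    using loc_fractions[where S = S and i = i, OF S i, of "r * y"] by blast
  then have "b * (r * y) = a"
    by simp
  \<comment> \<open>A denominator of \<open>r * y\<close> is the nonzero element of the conductor
    that \<open>uniformizer_of_conductor\<close> needs.\<close>
  then have "b \<in> p"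
    unfolding p_def using ab by simp
  have sub: "type_subring (stalk Y W)" and noeth: "noetherian_subring (stalk Y W)"
    unfolding stalk_eq_loc[OF W] using type_subring_loc[OF S'] noetherian_loc[OF S'] by blast+
  note U = uniformizer_of_conductor[OF A.type_subring_axioms p p_def r(2) \<open>b \<in> p\<close> ab(3) eq sub noeth normal[OF W]]
  obtain t where t: "t \<noteq> 0" "uniformizer (stalk Y W) t"
    using U(1) by blast
  have "?A \<subseteq> stalk Y W"
  proof
    fix x assume "x \<in> ?A"
    moreover have "x = x / 1"
      by simp
    moreover have "1 \<notin> p"
      using p[unfolded A.primeideal_subring_of_type_iff] by blast
    ultimately show "x \<in> stalk Y W"
      unfolding eq using A.one_mem by blast
  qed
  then have "y \<notin> stalk Y W"
    using U(2) r(1) type_subring.mult_mem[OF sub] by blast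
  moreover have "W \<in> prime_divisors Y"
    by (rule prime_divisor_if_dvr[OF W t])
  moreover have "\<forall>d. part W d \<inter> S d = {}"
    unfolding part using C(3) by (rule allI)
  ultimately show ?thesis
    using t by blast
qed

text \<open>A nonzero form \<open>f\<close> of \<open>q\<close> gives a function
  \<open>crd i ^ d / f\<close> outside the local ring at \<open>q\<close>. It has a pole along a
  prime divisor passing through \<open>q\<close>, that is, contained in \<open>q\<close> as an
  ideal, and minimality of \<open>q\<close> makes the two equal.\<close>

lemma prime_divisor_dvr:
  assumes q: "q \<in> prime_divisors Y"
  shows "\<exists>t. dvr (stalk Y q) t"
proof -
  have qp: "q \<in> points Y" and "q \<noteq> vanishing_ideal Y"
    and min: "\<And>r. r \<in> points Y \<Longrightarrow> vanishing_ideal Y \<subset> r \<Longrightarrow> \<not> r \<subset> q"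
    using q unfolding prime_divisors_def by blast+
  let ?S = "\<lambda>d. gr d - part q d"
  note D = graded_primeD[OF graded_prime_part[OF qp]]
  have S: "graded_submonoid ?S"
    by (rule graded_submonoid_complement[OF graded_prime_part[OF qp]])
  obtain i where i: "i \<le> dim Y" "crd i \<notin> part q 1"
    using D(6) by blast
  have xi: "crd i ^ d \<in> ?S d" for d
    using graded_prime_coord_power[OF graded_prime_part[OF qp] i] gr_coord_power[OF i(1)] by blast
  have "\<not> q \<subseteq> vanishing_ideal Y"
    using \<open>q \<noteq> vanishing_ideal Y\<close> pointsD(8)[OF qp] by blast
  then obtain d f where f: "f \<in> part q d" "f \<noteq> 0"
    unfolding point_subset_iff[OF qp vanishing_ideal_mem_points] part_vanishing_ideal by blast
  have "crd i ^ d / f \<notin> loc ?S"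
  proof
    assume "crd i ^ d / f \<in> loc ?S"
    then obtain a b e where ab: "a \<in> gr e" "b \<in> gr e" "b \<notin> part q e" "crd i ^ d / f = a / b"
      unfolding loc_def by blast
    then have "b \<noteq> 0"
      using D(2) by auto
    then have "crd i ^ d * b = a * f"
      using ab(4) f(2) by (simp add: field_simps)
    then have "crd i ^ d * b \<in> part q (d + e)"
      using D(4)[OF ab(1) f(1)] by (simp add: add.commute)
    then show False
      using D(5)[of "crd i ^ d" d b e] xi ab by blast
  qed
  then obtain W t where W: "W \<in> prime_divisors Y" "t \<noteq> 0" "uniformizer (stalk Y W) t"
    "\<And>d. part W d \<inter> ?S d = {}"
    using exists_prime_divisor[where S = ?S and i = i, OF S i(1) xi] by blast
  have Wp: "W \<in> points Y" "W \<noteq> vanishing_ideal Y"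
    using W(1) unfolding prime_divisors_def by blast+
  have "part W d \<subseteq> part q d" for d
    using W(4)[of d] graded_primeD(1)[OF graded_prime_part[OF Wp(1)]] by blast
  then have "W \<subseteq> q"
    using point_subset_iff[OF Wp(1) qp] by blast
  moreover have "vanishing_ideal Y \<subset> W"
    using pointsD(8)[OF Wp(1)] Wp(2) by blast
  ultimately have "W = q"
    using min[OF Wp(1)] by blast
  then show ?thesis
    using dvr_stalk[OF Wp(1) W(2,3)] by blast
qed

section \<open>Orders along prime divisors as valuations of the function field\<close>

abbreviation PD :: "'a mpolynomial set set" where "PD \<equiv> prime_divisors Y"

lemma ord_at_eq_val: "W \<in> PD \<Longrightarrow> dvr (stalk Y W) t \<Longrightarrow> ord_at Y W = dvr.val (stalk Y W)"
  by (rule ext) (simp add: ord_at_def dvr.val_def)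

lemma field_valuation_ord:
  assumes "W \<in> PD"
  shows "field_valuation (ord_at Y W)"
  using prime_divisor_dvr[OF assms] ord_at_eq_val[OF assms] dvr.field_valuation_val by metis

lemma mem_stalk_iff_ord:
  assumes "W \<in> PD" "x \<noteq> 0"
  shows "x \<in> stalk Y W \<longleftrightarrow> 0 \<le> ord_at Y W x"
  using prime_divisor_dvr[OF assms(1)] ord_at_eq_val[OF assms(1)] dvr.mem_iff_val assms(2) by metis

lemma scalar_mem_stalk:
  assumes W: "W \<in> points Y"
  shows "sc c \<in> stalk Y W"
  unfolding stalk_eq_loc[OF W]
  using locI[where S = "\<lambda>d. gr d - part W d" and d = 0 and b = 1, OF gr_scalar[of c]]
    graded_submonoidD(1)[OF graded_submonoid_complement[OF graded_prime_part[OF W]]] by simp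

lemma ord_scalar:
  assumes "W \<in> PD" "c \<noteq> 0"
  shows "ord_at Y W (sc c) = 0"
proof -
  interpret V: field_valuation "ord_at Y W"
    by (rule field_valuation_ord[OF assms(1)])
  have W: "W \<in> points Y"
    using assms(1) unfolding prime_divisors_def by blast
  have "0 \<le> ord_at Y W (sc c)" "0 \<le> ord_at Y W (sc (inverse c))"
    using mem_stalk_iff_ord[OF assms(1), of "sc c"] mem_stalk_iff_ord[OF assms(1), of "sc (inverse c)"]
      scalar_mem_stalk[OF W] assms(2) by simp_all
  then show ?thesis
    using V.inverse[of "sc c"] assms(2) by (simp add: inverse_sc)
qed

end

context normal_projective_scheme
begin

section \<open>Global functions\<close>

lemma gr_prod:
  "(\<And>i. i \<in> I \<Longrightarrow> f i \<in> gr (d i)) \<Longrightarrow> prod f I \<in> gr (sum d I)"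
  by (induction I rule: infinite_finite_induct) (auto intro!: gr_mult)

text \<open>Here \<open>exists_prime_divisor\<close> is applied to the powers of one coordinate: a
  function without poles is regular on the chart of that coordinate.\<close>

lemma mem_chart_if_ord_nonneg:
  assumes i: "i \<le> dim Y" "crd i \<noteq> 0" and f: "f \<noteq> 0" "\<And>W. W \<in> PD \<Longrightarrow> 0 \<le> ord_at Y W f"
  shows "\<exists>N. f * crd i ^ N \<in> gr N"
proof -
  have S: "graded_submonoid (\<lambda>d. {crd i ^ d})"
    unfolding graded_submonoid_def using i gr_coord_power by (auto simp: power_add)
  have "f \<in> loc (\<lambda>d. {crd i ^ d})"
  proof (rule ccontr)
    assume "f \<notin> loc (\<lambda>d. {crd i ^ d})"
    then obtain W where "W \<in> PD" "f \<notin> stalk Y W"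
      using exists_prime_divisor[where i = i, OF S i(1)] by blast
    then show False
      using mem_stalk_iff_ord f by blast
  qed
  then obtain a b d where ab: "a \<in> gr d" "b \<in> {crd i ^ d}" "f = a / b"
    by (rule locE)
  then have "f * crd i ^ d = a"
    using i(2) by simp
  then show ?thesis
    using ab(1) by metis
qed

text \<open>Let \<open>N i\<close> be an exponent of \<open>crd i\<close> that absorbs
  \<open>f\<close>. With \<open>D\<close> the sum of the \<open>N i\<close>, every monomial of
  degree \<open>D\<close> contains some \<open>crd i\<close> with exponent at least
  \<open>N i\<close>.\<close>

lemma gr_stable_if_ord_nonneg:
  assumes f: "f \<noteq> 0" "\<And>W. W \<in> PD \<Longrightarrow> 0 \<le> ord_at Y W f"
  shows "\<exists>D. \<forall>a\<in>gr D. f * a \<in> gr D"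
proof -
  have "\<exists>N. f * crd i ^ N \<in> gr N" if "i \<le> dim Y" for i
  proof (cases "crd i = 0")
    case True
    \<comment> \<open>A vanishing coordinate has no chart, but the product is 0 and lies in every
      degree.\<close>
    then have "f * crd i ^ 1 \<in> gr 1"
      by simp
    then show ?thesis
      by blast
  next
    case False
    then show ?thesis
      using mem_chart_if_ord_nonneg[OF that False f] by blast
  qed
  then obtain N where N: "\<And>i. i \<le> dim Y \<Longrightarrow> f * crd i ^ N i \<in> gr (N i)"
    by metis
  define D where "D = (\<Sum>i\<le>dim Y. N i)"
  have "f * a \<in> gr D" if a: "a \<in> gr D" for a
  proof -
    obtain F where F: "F \<in> PU" "homogeneous D F" "a = ev F"
      using a by (rule grE)
    have "f * (sc (Poly_Mapping.lookup F m) * (\<Prod>i\<in>Poly_Mapping.keys m. crd i ^ Poly_Mapping.lookup m i)) \<in> gr D"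
      if m: "m \<in> Poly_Mapping.keys F" for m
    proof -
      let ?l = "Poly_Mapping.lookup m"
      have km: "Poly_Mapping.keys m \<subseteq> {..dim Y}"
        using F(1) m unfolding polynomials_upto_def by blast
      have deg: "(\<Sum>i\<le>dim Y. ?l i) = D"
        using F(2) m monomial_degree_superset[OF _ km] unfolding homogeneous_def by auto
      have "\<exists>i\<le>dim Y. N i \<le> ?l i"
      proof (rule ccontr)
        assume "\<not> ?thesis"
        then have "(\<Sum>i\<le>dim Y. ?l i) < (\<Sum>i\<le>dim Y. N i)"
          by (intro sum_strict_mono) auto
        then show False
          using deg unfolding D_def by simp
      qed
      then obtain i where i: "i \<le> dim Y" "N i \<le> ?l i"
        by blast
      have "f * crd i ^ N i * crd i ^ (?l i - N i) \<in> gr (N i + (?l i - N i))"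
        by (intro gr_mult N gr_coord_power i)
      then have "f * crd i ^ ?l i \<in> gr (?l i)"
        using i(2) by (simp add: mult.assoc flip: power_add)
      moreover have "(\<Prod>j\<in>{..dim Y} - {i}. crd j ^ ?l j) \<in> gr (\<Sum>j\<in>{..dim Y} - {i}. ?l j)"
        by (intro gr_prod gr_coord_power) simp
      ultimately have "sc (Poly_Mapping.lookup F m) * ((f * crd i ^ ?l i) * (\<Prod>j\<in>{..dim Y} - {i}. crd j ^ ?l j))
          \<in> gr (0 + (?l i + (\<Sum>j\<in>{..dim Y} - {i}. ?l j)))"
        by (intro gr_mult gr_scalar)
      moreover have "0 + (?l i + (\<Sum>j\<in>{..dim Y} - {i}. ?l j)) = D"
        using deg i(1) by (simp add: sum.remove[of "{..dim Y}" i])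
      moreover have "(\<Prod>j\<in>Poly_Mapping.keys m. crd j ^ ?l j) = crd i ^ ?l i * (\<Prod>j\<in>{..dim Y} - {i}. crd j ^ ?l j)"
        using keys_mult_superset[OF _ km, of crd] i(1) by (simp add: prod.remove[of "{..dim Y}" i])
      ultimately show ?thesis
        by (simp add: ac_simps)
    qed
    then show ?thesis
      unfolding F(3) evaluate_def sum_distrib_left by (rule gr_sum)
  qed
  then show ?thesis
    by blast
qed

text \<open>All \<open>f ^ n * crd i ^ D\<close> have the same degree \<open>D\<close>. In a
  relation among them only the degree-0 parts of the coefficients count, and these are
  scalars.\<close>

lemma algebraic_if_ord_nonneg:
  assumes f: "f \<noteq> 0" "\<And>W. W \<in> PD \<Longrightarrow> 0 \<le> ord_at Y W f"
  shows "\<exists>(n::nat) c. f ^ n = (\<Sum>i<n. sc (c i) * f ^ i)"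
proof -
  obtain D where D: "\<And>a. a \<in> gr D \<Longrightarrow> f * a \<in> gr D"
    using gr_stable_if_ord_nonneg[OF f] by blast
  obtain i where i: "i \<le> dim Y" "crd i \<noteq> 0"
    using graded_primeD(6)[OF graded_prime_generic] by blast
  have mem: "f ^ n * crd i ^ D \<in> gr D" for n
    by (induction n) (simp_all add: gr_coord_power[OF i(1)] D mult.assoc)
  obtain n r where r: "\<And>j. r j \<in> stage (Suc (dim Y))"
    "Polynomial.monom (f ^ n * crd i ^ D) D = (\<Sum>j<n. r j * Polynomial.monom (f ^ j * crd i ^ D) D)"
    by (rule noetherian_subringE[where f = "\<lambda>n. Polynomial.monom (f ^ n * crd i ^ D) D", OF noetherian_stage monom_mem_stage[OF mem]])
      (rule that)
  have "\<exists>c. Polynomial.coeff (r j) 0 = sc c" for j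
    using coeff_stage[OF order_refl r(1), of j 0] gr_0E by blast
  then obtain c where c: "\<And>j. Polynomial.coeff (r j) 0 = sc (c j)"
    by metis
  have "f ^ n * crd i ^ D = Polynomial.coeff (\<Sum>j<n. Polynomial.monom (f ^ j * crd i ^ D) D * r j) D"
    using r(2) by (metis (no_types, lifting) Polynomial.coeff_monom mult.commute sum.cong)
  also have "\<dots> = (\<Sum>j<n. sc (c j) * f ^ j) * crd i ^ D"
    unfolding Polynomial.coeff_sum Polynomial.coeff_monom_mult sum_distrib_right
    by (intro sum.cong) (simp_all add: c)
  finally have "f ^ n = (\<Sum>j<n. sc (c j) * f ^ j)"
    using i(2) by simp
  then show ?thesis
    by blast
qed

text \<open>At a zero of \<open>f\<close>, the nonzero term of lowest index in the algebraic
  equation would have strictly smaller order than every other term, so it could not be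
  cancelled.\<close>

lemma ord_eq_zero_if_nonneg:
  assumes f: "f \<noteq> 0" "\<And>W. W \<in> PD \<Longrightarrow> 0 \<le> ord_at Y W f" and W: "W \<in> PD"
  shows "ord_at Y W f = 0"
proof (rule ccontr)
  interpret V: field_valuation "ord_at Y W"
    by (rule field_valuation_ord[OF W])
  let ?v = "ord_at Y W"
  assume "?v f \<noteq> 0"
  then have v: "?v f > 0"
    using f(2)[OF W] by simp
  obtain n c where c: "f ^ n = (\<Sum>i<n. sc (c i) * f ^ i)"
    using algebraic_if_ord_nonneg[OF f] by blast
  have "\<exists>j. j < n \<and> c j \<noteq> 0"
  proof (rule ccontr)
    assume "\<not> ?thesis"
    then have "f ^ n = 0"
      unfolding c by (intro sum.neutral) auto
    then show False
      using f(1) by simp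
  qed
  then obtain j0 where j0: "j0 < n \<and> c j0 \<noteq> 0"
    by blast
  define j where "j = (LEAST j. j < n \<and> c j \<noteq> 0)"
  have j: "j < n" "c j \<noteq> 0"
    unfolding j_def using LeastI[of "\<lambda>j. j < n \<and> c j \<noteq> 0", OF j0] by simp_all
  have min: "c i = 0" if "i < j" for i
    using not_less_Least[of i "\<lambda>j. j < n \<and> c j \<noteq> 0"] that j(1) unfolding j_def by auto
  \<comment> \<open>All later terms and \<open>f ^ n\<close> itself have order at least this bound,
    while the \<open>j\<close>-th term has order \<open>int j * ?v f\<close>, just below it.\<close>
  let ?B = "V.bounded_below 1 ((int j + 1) * ?v f)"
  have high: "sc (c i) * f ^ i \<in> ?B" if "j < i" for i
  proof (cases "c i = 0")
    case False
    have "(int j + 1) * ?v f \<le> int i * ?v f"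
      using that v by (intro mult_right_mono) auto
    then show ?thesis
      using False f(1) unfolding V.bounded_below_def by (simp add: V.mult V.power ord_scalar[OF W])
  qed (simp add: V.zero_bounded_below)
  have "f ^ n \<in> ?B"
    using v j(1) f(1) mult_right_mono[of "int j + 1" "int n" "?v f"]
    unfolding V.bounded_below_def by (simp add: V.power)
  moreover have "(\<Sum>i\<in>{..<n} - {j}. sc (c i) * f ^ i) \<in> ?B"
  proof (rule V.sum_bounded_below)
    fix i assume "i \<in> {..<n} - {j}"
    then show "sc (c i) * f ^ i \<in> ?B"
      using high[of i] min[of i] by (cases "i < j") (auto simp: V.zero_bounded_below)
  qed simp
  ultimately have "f ^ n - (\<Sum>i\<in>{..<n} - {j}. sc (c i) * f ^ i) \<in> ?B"
    by (intro V.diff_bounded_below) simp_all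
  moreover have "f ^ n - (\<Sum>i\<in>{..<n} - {j}. sc (c i) * f ^ i) = sc (c j) * f ^ j"
    unfolding c by (subst sum.remove[of "{..<n}" j]) (use j in auto)
  ultimately have "(int j + 1) * ?v f \<le> int j * ?v f"
    using j(2) f(1) unfolding V.bounded_below_def by (simp add: V.mult V.power ord_scalar[OF W])
  then show False
    using v by (simp add: distrib_right)
qed

end

section \<open>Degrees of divisors\<close>

locale degree_scheme = normal_projective_scheme Y for Y :: "('k::field, 'K::field) proj_scheme" +
  fixes \<delta> :: "('k point \<Rightarrow> int) set \<Rightarrow> int"
  assumes degree_map: "degree_map Y \<delta>"
begin

abbreviation Dv :: "('k point \<Rightarrow> int) set" where "Dv \<equiv> carrier (div_group Y)"

lemma Dv_iff: "D \<in> Dv \<longleftrightarrow> finite {W. D W \<noteq> 0} \<and> {W. D W \<noteq> 0} \<subseteq> PD"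
  unfolding div_group_def by simp

definition dg :: "('k point \<Rightarrow> int) \<Rightarrow> int"
  where "dg D = \<delta> (divisor_class Y D)"

section \<open>The degree as a homomorphism on the group of divisors\<close>

lemma divisor_class_eq: "divisor_class Y D = {\<lambda>W. h W + D W | h. h \<in> principal_divisors Y}"
  unfolding divisor_class_def r_coset_def div_group_def by auto

lemma div_of_mult: "f \<noteq> 0 \<Longrightarrow> g \<noteq> 0 \<Longrightarrow> div_of Y (f * g) = (\<lambda>W. div_of Y f W + div_of Y g W)"
  unfolding div_of_def using field_valuation.mult[OF field_valuation_ord] by (intro ext) simp

lemma div_of_one: "div_of Y 1 = (\<lambda>W. 0)"
  unfolding div_of_def using field_valuation.one[OF field_valuation_ord] by (intro ext) simp

lemma div_of_inverse: "f \<noteq> 0 \<Longrightarrow> div_of Y (inverse f) = (\<lambda>W. - div_of Y f W)"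
  unfolding div_of_def using field_valuation.inverse[OF field_valuation_ord] by (intro ext) simp

lemma principal_zero: "(\<lambda>W. 0) \<in> principal_divisors Y"
  unfolding principal_divisors_def using div_of_one by (metis (mono_tags, lifting) mem_Collect_eq zero_neq_one)

lemma principal_add:
  assumes "D \<in> principal_divisors Y" "E \<in> principal_divisors Y"
  shows "(\<lambda>W. D W + E W) \<in> principal_divisors Y"
proof -
  obtain f g where "f \<noteq> 0" "D = div_of Y f" "g \<noteq> 0" "E = div_of Y g"
    using assms unfolding principal_divisors_def by blast
  then have "(\<lambda>W. D W + E W) = div_of Y (f * g)" "f * g \<noteq> 0"
    using div_of_mult by auto
  then show ?thesis
    unfolding principal_divisors_def by blast
qed

lemma principal_uminus:
  assumes "D \<in> principal_divisors Y"
  shows "(\<lambda>W. - D W) \<in> principal_divisors Y"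
proof -
  obtain f where "f \<noteq> 0" "D = div_of Y f"
    using assms unfolding principal_divisors_def by blast
  then have "(\<lambda>W. - D W) = div_of Y (inverse f)" "inverse f \<noteq> 0"
    using div_of_inverse by auto
  then show ?thesis
    unfolding principal_divisors_def by blast
qed

lemma divisor_class_principal:
  assumes "E \<in> principal_divisors Y"
  shows "divisor_class Y E = principal_divisors Y"
proof (intro equalityI subsetI)
  fix D assume "D \<in> divisor_class Y E"
  then show "D \<in> principal_divisors Y"
    unfolding divisor_class_eq using principal_add assms by blast
next
  fix D assume "D \<in> principal_divisors Y"
  then have "(\<lambda>W. D W + - E W) \<in> principal_divisors Y"
    using principal_add principal_uminus[OF assms] by blast
  moreover have "D = (\<lambda>W. (D W + - E W) + E W)"
    by simp
  ultimately show "D \<in> divisor_class Y E"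
    unfolding divisor_class_eq by (intro CollectI exI[of _ "\<lambda>W. D W + - E W"] conjI)
qed

lemma divisor_class_add:
  "divisor_class Y D <#>\<^bsub>div_group Y\<^esub> divisor_class Y E = divisor_class Y (\<lambda>W. D W + E W)"
proof (intro equalityI subsetI)
  fix F assume "F \<in> divisor_class Y D <#>\<^bsub>div_group Y\<^esub> divisor_class Y E"
  then obtain A B where AB: "A \<in> divisor_class Y D" "B \<in> divisor_class Y E" "F = A \<otimes>\<^bsub>div_group Y\<^esub> B"
    unfolding set_mult_def by blast
  obtain g h where gh: "g \<in> principal_divisors Y" "A = (\<lambda>W. g W + D W)"
    "h \<in> principal_divisors Y" "B = (\<lambda>W. h W + E W)"
    using AB(1,2) unfolding divisor_class_eq by blast
  have "F = (\<lambda>W. (g W + h W) + (D W + E W))"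
    unfolding AB(3) gh div_group_def by (simp add: algebra_simps)
  then show "F \<in> divisor_class Y (\<lambda>W. D W + E W)"
    unfolding divisor_class_eq using principal_add[OF gh(1,3)]
    by (intro CollectI exI[of _ "\<lambda>W. g W + h W"] conjI)
next
  fix F assume "F \<in> divisor_class Y (\<lambda>W. D W + E W)"
  then obtain h where h: "h \<in> principal_divisors Y" "F = (\<lambda>W. h W + (D W + E W))"
    unfolding divisor_class_eq by blast
  have "(\<lambda>W. h W + D W) \<in> divisor_class Y D" "(\<lambda>W. 0 + E W) \<in> divisor_class Y E"
    unfolding divisor_class_eq
    by (intro CollectI exI[of _ h] conjI refl h(1), intro CollectI exI[of _ "\<lambda>W. 0"] conjI refl principal_zero)
  moreover have "F = (\<lambda>W. h W + D W) \<otimes>\<^bsub>div_group Y\<^esub> (\<lambda>W. 0 + E W)"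
    unfolding h(2) div_group_def by (simp add: add.assoc)
  ultimately show "F \<in> divisor_class Y D <#>\<^bsub>div_group Y\<^esub> divisor_class Y E"
    unfolding set_mult_def by blast
qed

lemma divisor_class_carrier: "D \<in> Dv \<Longrightarrow> divisor_class Y D \<in> carrier (class_group Y)"
  unfolding class_group_def carrier_FactGroup divisor_class_def by blast

lemma Dv_zero: "(\<lambda>W. 0) \<in> Dv"
  unfolding Dv_iff by simp

lemma Dv_add:
  assumes "D \<in> Dv" "E \<in> Dv"
  shows "(\<lambda>W. D W + E W) \<in> Dv"
proof -
  have "{W. D W + E W \<noteq> 0} \<subseteq> {W. D W \<noteq> 0} \<union> {W. E W \<noteq> 0}"
    by auto
  moreover have "finite ({W. D W \<noteq> 0} \<union> {W. E W \<noteq> 0})" "{W. D W \<noteq> 0} \<union> {W. E W \<noteq> 0} \<subseteq> PD"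
    using assms unfolding Dv_iff by simp_all
  ultimately show ?thesis
    unfolding Dv_iff by (meson finite_subset subset_trans)
qed

lemma Dv_scale:
  assumes "D \<in> Dv"
  shows "(\<lambda>W. n * D W) \<in> Dv"
proof -
  have "{W. n * D W \<noteq> 0} \<subseteq> {W. D W \<noteq> 0}"
    by auto
  then show ?thesis
    using assms unfolding Dv_iff by (meson finite_subset subset_trans)
qed

lemma Dv_prime: "W \<in> PD \<Longrightarrow> prime_divisor W \<in> Dv"
  unfolding Dv_iff prime_divisor_def by auto

lemma Dv_sum: "(\<And>i. i \<in> I \<Longrightarrow> D i \<in> Dv) \<Longrightarrow> (\<lambda>W. \<Sum>i\<in>I. D i W) \<in> Dv"
  by (induction I rule: infinite_finite_induct) (auto simp: Dv_zero intro!: Dv_add)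

lemma dg_add:
  assumes "D \<in> Dv" "E \<in> Dv"
  shows "dg (\<lambda>W. D W + E W) = dg D + dg E"
proof -
  have "\<delta> \<in> hom (class_group Y) integer_group"
    using degree_map unfolding degree_map_def iso_def by blast
  from hom_mult[OF this divisor_class_carrier[OF assms(1)] divisor_class_carrier[OF assms(2)]]
  show ?thesis
    unfolding dg_def divisor_class_add[symmetric] class_group_def by (simp add: FactGroup_def)
qed

lemma dg_zero [simp]: "dg (\<lambda>W. 0) = 0"
  using dg_add[OF Dv_zero Dv_zero] by simp

lemma dg_uminus:
  assumes "D \<in> Dv"
  shows "dg (\<lambda>W. - D W) = - dg D"
  using dg_add[OF assms Dv_scale[OF assms, of "- 1"]] by simp

lemma dg_scale_nat: "D \<in> Dv \<Longrightarrow> dg (\<lambda>W. int n * D W) = int n * dg D"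
proof (induction n)
  case (Suc n)
  then show ?case
    using dg_add[OF Suc.prems Dv_scale[OF Suc.prems, of "int n"]] by (simp add: distrib_right)
qed simp

lemma dg_scale:
  assumes "D \<in> Dv"
  shows "dg (\<lambda>W. n * D W) = n * dg D"
proof (cases "n \<ge> 0")
  case True
  then show ?thesis
    using dg_scale_nat[OF assms, of "nat n"] by simp
next
  case False
  then show ?thesis
    using dg_scale_nat[OF assms, of "nat (- n)"] dg_uminus[OF Dv_scale[OF assms, of "- n"]] by simp
qed

lemma dg_sum: "(\<And>i. i \<in> I \<Longrightarrow> D i \<in> Dv) \<Longrightarrow> dg (\<lambda>W. \<Sum>i\<in>I. D i W) = (\<Sum>i\<in>I. dg (D i))"
proof (induction I rule: infinite_finite_induct)
  case (insert i I)
  then show ?case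
    using dg_add[of "D i" "\<lambda>W. \<Sum>i\<in>I. D i W"] Dv_sum[of I D] by simp
qed simp_all

lemma dg_principal:
  assumes "f \<noteq> 0"
  shows "dg (div_of Y f) = 0"
proof -
  have "div_of Y f \<in> principal_divisors Y"
    unfolding principal_divisors_def using assms by blast
  then have "divisor_class Y (div_of Y f) = divisor_class Y (\<lambda>W. 0)"
    using divisor_class_principal principal_zero by simp
  then show ?thesis
    using dg_zero unfolding dg_def by simp
qed

lemma principal_if_dg_zero:
  assumes D: "D \<in> Dv" and "dg D = 0"
  shows "\<exists>f. f \<noteq> 0 \<and> div_of Y f = D"
proof -
  have "inj_on \<delta> (carrier (class_group Y))"
    using degree_map unfolding degree_map_def iso_def bij_betw_def by blast
  then have "divisor_class Y D = divisor_class Y (\<lambda>W. 0)"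
    using assms dg_zero divisor_class_carrier[OF D] divisor_class_carrier[OF Dv_zero]
    unfolding dg_def by (intro inj_onD[of \<delta>]) simp_all
  then have "divisor_class Y D = principal_divisors Y"
    using divisor_class_principal[OF principal_zero] by simp
  moreover have "(\<lambda>W. 0 + D W) \<in> divisor_class Y D"
    unfolding divisor_class_eq by (intro CollectI exI[of _ "\<lambda>W. 0"] conjI refl principal_zero)
  ultimately have "D \<in> principal_divisors Y"
    by simp
  then show ?thesis
    unfolding principal_divisors_def by blast
qed

subsection \<open>Sections\<close>

abbreviation gs :: "('k point \<Rightarrow> int) \<Rightarrow> 'K set" where "gs \<equiv> global_sections Y"

lemma gs_iff: "f \<noteq> 0 \<Longrightarrow> f \<in> gs D \<longleftrightarrow> (\<forall>W\<in>PD. 0 \<le> ord_at Y W f + D W)"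
  unfolding global_sections_def by simp

lemma gs_zero [simp]: "0 \<in> gs D"
  unfolding global_sections_def by simp

lemma gs_add:
  assumes "f \<in> gs D" "g \<in> gs D"
  shows "f + g \<in> gs D"
proof (cases "f = 0 \<or> g = 0 \<or> f + g = 0")
  case False
  have "0 \<le> ord_at Y W (f + g) + D W" if W: "W \<in> PD" for W
  proof -
    have "0 \<le> ord_at Y W f + D W" "0 \<le> ord_at Y W g + D W"
      using False assms W by (auto simp: gs_iff)
    then show ?thesis
      using field_valuation.add[OF field_valuation_ord[OF W], of f g] False by simp
  qed
  then show ?thesis
    using False by (simp add: gs_iff)
qed (use assms in auto)

lemma gs_mult:
  assumes "f \<in> gs D" "g \<in> gs E"
  shows "f * g \<in> gs (\<lambda>W. D W + E W)"
proof (cases "f = 0 \<or> g = 0")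
  case False
  have "0 \<le> ord_at Y W (f * g) + (D W + E W)" if W: "W \<in> PD" for W
  proof -
    have "0 \<le> ord_at Y W f + D W" "0 \<le> ord_at Y W g + E W"
      using False assms W by (auto simp: gs_iff)
    then show ?thesis
      using field_valuation.mult[OF field_valuation_ord[OF W], of f g] False by simp
  qed
  then show ?thesis
    using False by (simp add: gs_iff)
qed auto

lemma gs_scalar: "sc c \<in> gs (\<lambda>W. 0)"
  by (cases "c = 0") (simp_all add: gs_iff ord_scalar)

lemma gs_power: "f \<in> gs D \<Longrightarrow> f ^ n \<in> gs (\<lambda>W. int n * D W)"
proof (induction n)
  case 0
  then show ?case using gs_scalar[of 1] by simp
next
  case (Suc n)
  then show ?case
    using gs_mult[OF Suc.prems Suc.IH[OF Suc.prems]] by (simp add: distrib_right)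
qed

lemma gs_prod:
  "finite I \<Longrightarrow> (\<And>i. i \<in> I \<Longrightarrow> f i \<in> gs (D i)) \<Longrightarrow> prod f I \<in> gs (\<lambda>W. \<Sum>i\<in>I. D i W)"
proof (induction I rule: finite_induct)
  case empty
  then show ?case using gs_scalar[of 1] by simp
next
  case (insert i I)
  then show ?case
    using gs_mult[of "f i" "D i" "prod f I" "\<lambda>W. \<Sum>i\<in>I. D i W"] by simp
qed

lemma gs_sum: "(\<And>i. i \<in> I \<Longrightarrow> f i \<in> gs D) \<Longrightarrow> sum f I \<in> gs D"
  by (induction I rule: infinite_finite_induct) (simp_all add: gs_add)

text \<open>Extracts what is needed from very ampleness. The embedded variety has the same local
  rings as \<open>Y\<close>, and one of those is the whole function field, the local ring at the
  generic point.\<close>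

lemma ample_generator:
  obtains H m N f where "H \<in> Dv" "dg H = 1" "m > 0" "\<And>j. j \<le> N \<Longrightarrow> f j \<in> gs (\<lambda>W. int m * H W)"
    "\<exists>j\<le>N. f j \<noteq> 0" "\<exists>q. stalk (Y\<lparr>dim := N, coord := f\<rparr>) q = UNIV"
proof -
  obtain H where H: "H \<in> Dv" "ample Y H" "dg H = 1"
    using degree_map unfolding degree_map_def dg_def by blast
  obtain m :: nat where m: "m > 0" "very_ample Y (\<lambda>W. int m * H W)"
    using H(2) unfolding ample_def by blast
  obtain N f where f: "\<forall>j\<le>N. f j \<in> gs (\<lambda>W. int m * H W)"
    and gen: "\<forall>q\<in>points Y. \<exists>j\<le>N. f j \<noteq> 0 \<and>
       (\<forall>W\<in>PD. W \<subseteq> q \<longrightarrow> ord_at Y W (f j) + int m * H W = 0)"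
    and st: "stalk (Y\<lparr>dim := N, coord := f\<rparr>) ` points (Y\<lparr>dim := N, coord := f\<rparr>) = stalk Y ` points Y"
    using m(2) unfolding very_ample_def Let_def by (elim exE conjE) (rule that; assumption)
  have "UNIV \<in> stalk Y ` points Y"
    using vanishing_ideal_mem_points projective_integral unfolding projective_integral_def by (metis image_eqI)
  then have "\<exists>q. stalk (Y\<lparr>dim := N, coord := f\<rparr>) q = UNIV"
    unfolding st[symmetric] by blast
  moreover have "\<exists>j\<le>N. f j \<noteq> 0"
    using gen vanishing_ideal_mem_points by blast
  ultimately show ?thesis
    using that[OF H(1,3) m(1)] f by blast
qed

text \<open>In degree 0, multiplying the section by a function with divisor \<open>D\<close> gives a
  function without poles, which then has no zeros either. A negative degree is compensated by a
  section \<open>g\<close> of a multiple of the ample \<open>H\<close>. In the resulting degree-0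
  divisor neither \<open>f\<close> nor \<open>g\<close> can have excess zeros, so \<open>- D\<close>
  would be the divisor of \<open>f\<close>, of degree 0.\<close>

lemma dg_nonneg_if_section:
  assumes D: "D \<in> Dv" and f: "f \<in> gs D" "f \<noteq> 0"
  shows "0 \<le> dg D" and "dg D = 0 \<Longrightarrow> W \<in> PD \<Longrightarrow> ord_at Y W f = - D W"
proof -
  have rigid: "ord_at Y W f = - D W" if d: "dg D = 0" and W: "W \<in> PD"
    and D: "D \<in> Dv" and f: "f \<in> gs D" "f \<noteq> 0" for D f W
  proof -
    obtain h where h: "h \<noteq> 0" "div_of Y h = D"
      using principal_if_dg_zero[OF D d] by blast
    have ord_h: "ord_at Y W h = D W" if "W \<in> PD" for W
      using fun_cong[OF h(2), of W] that unfolding div_of_def by simp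
    have mult: "ord_at Y W (f * h) = ord_at Y W f + D W" if W: "W \<in> PD" for W
      using field_valuation.mult[OF field_valuation_ord[OF W] f(2) h(1)] ord_h[OF W] by simp
    have "ord_at Y W (f * h) = 0"
    proof (rule ord_eq_zero_if_nonneg[OF _ _ W])
      show "f * h \<noteq> 0"
        using f(2) h(1) by simp
      show "0 \<le> ord_at Y W (f * h)" if "W \<in> PD" for W
        using f gs_iff that by (simp add: mult)
    qed
    then show ?thesis
      using mult[OF W] by simp
  qed
  then show "dg D = 0 \<Longrightarrow> W \<in> PD \<Longrightarrow> ord_at Y W f = - D W"
    using assms by blast
  show "0 \<le> dg D"
  proof (rule ccontr)
    assume neg: "\<not> 0 \<le> dg D"
    define e where "e = nat (- dg D)"
    have e: "e > 0" "int e = - dg D"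
      unfolding e_def using neg by auto
    obtain H m N g0 where H: "H \<in> Dv" "dg H = 1" "m > 0" "\<And>j. j \<le> N \<Longrightarrow> g0 j \<in> gs (\<lambda>W. int m * H W)"
      "\<exists>j\<le>N. g0 j \<noteq> 0" "\<exists>q. stalk (Y\<lparr>dim := N, coord := g0\<rparr>) q = UNIV"
      by (rule ample_generator) (rule that)
    then obtain g where g: "g \<in> gs (\<lambda>W. int m * H W)" "g \<noteq> 0"
      by blast
    have mH: "(\<lambda>W. int m * H W) \<in> Dv"
      by (rule Dv_scale[OF H(1)])
    \<comment> \<open>The divisor of which \<open>f ^ m * g ^ e\<close> is a section. The exponents
      are chosen so that the degrees \<open>m * dg D\<close> and \<open>e * m\<close>
      cancel.\<close>
    let ?F = "\<lambda>W. int m * D W + int e * (int m * H W)"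
    have F: "?F \<in> Dv"
      by (intro Dv_add Dv_scale D H(1))
    have "dg ?F = int m * dg D + int e * (int m * 1)"
      using dg_add[OF Dv_scale[OF D, of "int m"] Dv_scale[OF mH, of "int e"]] dg_scale[OF mH, of "int e"]
        dg_scale[OF D, of "int m"] dg_scale[OF H(1), of "int m"] H(2) by simp
    then have dF: "dg ?F = 0"
      using e(2) by simp
    have "f ^ m * g ^ e \<in> gs ?F"
      by (intro gs_mult gs_power f(1) g(1))
    then have rel: "ord_at Y W (f ^ m * g ^ e) = - ?F W" if "W \<in> PD" for W
      using rigid[OF dF that F] f(2) g(2) by simp
    have "ord_at Y W f = - D W" if W: "W \<in> PD" for W
    proof -
      interpret V: field_valuation "ord_at Y W"
        by (rule field_valuation_ord[OF W])
      have "int m * (ord_at Y W f + D W) + int e * (ord_at Y W g + int m * H W) = 0"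
        using rel[OF W] f(2) g(2) by (simp add: V.mult V.power algebra_simps)
      moreover have "0 \<le> ord_at Y W f + D W" "0 \<le> ord_at Y W g + int m * H W"
        using f g W by (simp_all add: gs_iff)
      ultimately have "int m * (ord_at Y W f + D W) = 0"
        by (smt (verit) mult_nonneg_nonneg of_nat_0_le_iff)
      then show ?thesis
        using H(3) by simp
    qed
    then have "div_of Y f = (\<lambda>W. - D W)"
      using D unfolding div_of_def Dv_iff by (intro ext) auto
    then show False
      using dg_principal[OF f(2)] dg_uminus[OF D] neg by simp
  qed
qed

text \<open>The constant 1 is a section of the divisor \<open>W\<close> with an excess zero along
  \<open>W\<close>, which is impossible in degree 0.\<close>

lemma dg_prime_pos:
  assumes W: "W \<in> PD"
  shows "1 \<le> dg (prime_divisor W)"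
proof -
  have one: "1 \<in> gs (prime_divisor W)"
    using field_valuation.one[OF field_valuation_ord] by (simp add: gs_iff prime_divisor_def)
  have "ord_at Y W 1 \<noteq> - prime_divisor W W"
    using field_valuation.one[OF field_valuation_ord[OF W]] by (simp add: prime_divisor_def)
  then have "dg (prime_divisor W) \<noteq> 0"
    using dg_nonneg_if_section(2)[OF Dv_prime[OF W] one _ _ W] by auto
  then show ?thesis
    using dg_nonneg_if_section(1)[OF Dv_prime[OF W] one] by simp
qed

text \<open>When finitely many of the excess zeros are subtracted from \<open>D\<close>,
  \<open>f\<close> remains a section. Each of them costs a degree of at least 1, so there are at
  most \<open>dg D\<close> of them.\<close>

lemma finite_support_section:
  assumes D: "D \<in> Dv" and f: "f \<in> gs D" "f \<noteq> 0"
  shows "finite {W \<in> PD. ord_at Y W f \<noteq> 0}"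
proof -
  let ?P = "{W \<in> PD. 0 < ord_at Y W f + D W}"
  have "card F \<le> nat (dg D)" if F: "F \<subseteq> ?P" "finite F" for F
  proof -
    have prime: "prime_divisor V \<in> Dv" if "V \<in> F" for V
      using F that Dv_prime by blast
    let ?S = "\<lambda>W. \<Sum>V\<in>F. prime_divisor V W"
    have S: "?S \<in> Dv"
      using prime by (rule Dv_sum)
    have S_eq: "?S W = (if W \<in> F then 1 else 0)" for W
      unfolding prime_divisor_def using F(2) by (simp add: sum.delta)
    have "f \<in> gs (\<lambda>W. D W + - 1 * ?S W)"
      unfolding gs_iff[OF f(2)] S_eq using f F(1) by (auto simp: gs_iff)
    then have "0 \<le> dg (\<lambda>W. D W + - 1 * ?S W)"
      using dg_nonneg_if_section(1)[OF Dv_add[OF D Dv_scale[OF S, of "- 1"]]] f(2) by blast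
    also have "\<dots> = dg D - dg ?S"
      using dg_add[OF D Dv_scale[OF S, of "- 1"]] dg_scale[OF S, of "- 1"] by simp
    also have "dg ?S = (\<Sum>V\<in>F. dg (prime_divisor V))"
      using prime by (rule dg_sum)
    finally have "(\<Sum>V\<in>F. dg (prime_divisor V)) \<le> dg D"
      by simp
    moreover have "(\<Sum>V\<in>F. 1) \<le> (\<Sum>V\<in>F. dg (prime_divisor V))"
      using F(1) dg_prime_pos by (intro sum_mono) auto
    ultimately show ?thesis
      by simp
  qed
  then have "finite ?P"
    by (meson finite_if_finite_subsets_card_bdd)
  moreover have "finite {W. D W \<noteq> 0}"
    using D unfolding Dv_iff by blast
  moreover have "{W \<in> PD. ord_at Y W f \<noteq> 0} \<subseteq> ?P \<union> {W. D W \<noteq> 0}"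
    using f by (fastforce simp: gs_iff)
  ultimately show ?thesis
    by (meson finite_UnI finite_subset)
qed

lemma evaluate_sections:
  assumes "\<And>j. j \<le> N \<Longrightarrow> g j \<in> gs D" "F \<in> polynomials_upto N" "homogeneous e F"
  shows "evaluate sc g F \<in> gs (\<lambda>W. int e * D W)"
  unfolding evaluate_def
proof (rule gs_sum)
  fix m assume m: "m \<in> Poly_Mapping.keys F"
  then have km: "Poly_Mapping.keys m \<subseteq> {..N}" and deg: "monomial_degree m = e"
    using assms(2,3) unfolding polynomials_upto_def homogeneous_def by blast+
  have "(\<Prod>i\<in>Poly_Mapping.keys m. g i ^ Poly_Mapping.lookup m i)
      \<in> gs (\<lambda>W. \<Sum>i\<in>Poly_Mapping.keys m. int (Poly_Mapping.lookup m i) * D W)"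
    using km assms(1) by (intro gs_prod gs_power) auto
  moreover have "(\<Sum>i\<in>Poly_Mapping.keys m. int (Poly_Mapping.lookup m i) * D W) = int e * D W" for W
    using deg unfolding monomial_degree_def by (simp flip: sum_distrib_right of_nat_sum)
  ultimately show "sc (Poly_Mapping.lookup F m) * (\<Prod>i\<in>Poly_Mapping.keys m. g i ^ Poly_Mapping.lookup m i)
      \<in> gs (\<lambda>W. int e * D W)"
    using gs_mult[OF gs_scalar] by fastforce
qed

text \<open>An arbitrary function is a quotient of two forms of equal degree in the sections that
  define the embedding, and such forms are themselves sections of a multiple of \<open>H\<close>, to
  which \<open>finite_support_section\<close> applies.\<close>

theorem finite_support:
  assumes "f \<noteq> 0"
  shows "finite {W \<in> PD. ord_at Y W f \<noteq> 0}"
proof -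
  obtain H m N g where H: "H \<in> Dv" "dg H = 1" "m > 0" "\<And>j. j \<le> N \<Longrightarrow> g j \<in> gs (\<lambda>W. int m * H W)"
    "\<exists>j\<le>N. g j \<noteq> 0" "\<exists>q. stalk (Y\<lparr>dim := N, coord := g\<rparr>) q = UNIV"
    by (rule ample_generator) (rule that)
  obtain q where "f \<in> stalk (Y\<lparr>dim := N, coord := g\<rparr>) q"
    using H(6) by blast
  then obtain F G e where FG: "f = evaluate sc g F / evaluate sc g G" "F \<in> polynomials_upto N"
    "G \<in> polynomials_upto N" "homogeneous e F" "homogeneous e G"
    unfolding stalk_def by auto
  let ?D = "\<lambda>W. int e * (int m * H W)" and ?a = "evaluate sc g F" and ?b = "evaluate sc g G"
  have D: "?D \<in> Dv"
    by (intro Dv_scale H(1))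
  have nz: "?a \<noteq> 0" "?b \<noteq> 0"
    using assms FG(1) by auto
  have fin: "finite {W \<in> PD. ord_at Y W ?a \<noteq> 0}" "finite {W \<in> PD. ord_at Y W ?b \<noteq> 0}"
    using finite_support_section[OF D evaluate_sections[OF H(4) FG(2,4)] nz(1)]
      finite_support_section[OF D evaluate_sections[OF H(4) FG(3,5)] nz(2)] by blast+
  have "{W \<in> PD. ord_at Y W f \<noteq> 0} \<subseteq> {W \<in> PD. ord_at Y W ?a \<noteq> 0} \<union> {W \<in> PD. ord_at Y W ?b \<noteq> 0}"
    unfolding FG(1) using field_valuation.divide[OF field_valuation_ord nz] by auto
  then show ?thesis
    using fin by (meson finite_UnI finite_subset)
qed

end

section \<open>The points $v_{ij}$\<close>

lemma excess_step:
  assumes "j < length mu" "mu ! j = ms @ [a, b]"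
  shows "excess mu = Suc (excess (mu[j := ms @ [c]]))"
proof -
  let ?mu' = "mu[j := ms @ [c]]"
  have "excess mu = (length (mu ! j) - 1) + (\<Sum>i\<in>{..<length mu} - {j}. length (mu ! i) - 1)"
    unfolding excess_def using assms(1) by (subst sum.remove[of _ j]) auto
  moreover have "excess ?mu' = (length (?mu' ! j) - 1) + (\<Sum>i\<in>{..<length mu} - {j}. length (?mu' ! i) - 1)"
    unfolding excess_def using assms(1) by (subst sum.remove[of _ j]) auto
  moreover have "(\<Sum>i\<in>{..<length mu} - {j}. length (?mu' ! i) - 1) = (\<Sum>i\<in>{..<length mu} - {j}. length (mu ! i) - 1)"
    by (intro sum.cong) auto
  ultimately show ?thesis
    using assms by simp
qed

definition positive_tuples :: "nat list list \<Rightarrow> bool"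
  where "positive_tuples mu \<longleftrightarrow> (\<forall>\<mu>\<in>set mu. \<mu> \<noteq> [] \<and> (\<forall>m\<in>set \<mu>. 0 < m))"

lemma positive_tuples_step:
  assumes "positive_tuples mu" "j < length mu" "mu ! j = ms @ [a, b]"
  shows "positive_tuples (mu[j := ms @ [gcd a b]])" "0 < a" "0 < b"
proof -
  have "ms @ [a, b] \<in> set mu"
    using assms(2,3) nth_mem by metis
  then have pos: "\<forall>m\<in>set (ms @ [a, b]). 0 < m"
    using assms(1) unfolding positive_tuples_def by blast
  then show "0 < a" "0 < b"
    by simp_all
  then have "\<forall>m\<in>set (ms @ [gcd a b]). 0 < m"
    using pos by auto
  then show "positive_tuples (mu[j := ms @ [gcd a b]])"
    using assms(1) set_update_subset_insert[of mu j "ms @ [gcd a b]"] unfolding positive_tuples_def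
    by (metis (no_types, lifting) append_is_Nil_conv insertE list.distinct(1) subsetD)
qed

text \<open>Stated for plain functions instead of finitely supported ones, so that a further
  coordinate is a function update.\<close>

definition pair_upto :: "nat \<Rightarrow> (nat \<Rightarrow> int) \<Rightarrow> vec \<Rightarrow> rat"
  where "pair_upto d u x = (\<Sum>n<d. of_int (u n) * x n)"

lemma pair_upto_Suc:
  "pair_upto (Suc d) (u(d := w)) (x(d := y)) = pair_upto d u x + of_int w * y"
proof -
  have "(\<Sum>n<d. of_int ((u(d := w)) n) * (x(d := y)) n) = (\<Sum>n<d. of_int (u n) * x n)"
    by (intro sum.cong) auto
  then show ?thesis
    unfolding pair_upto_def by simp
qed

lemma base_vertex:
  assumes "positive_tuples mu" "\<forall>i<length mu. length (mu ! i) = 1" "i < length mu"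
  shows "of_int (e * int (cofactor mu i)) / of_nat (\<Prod>l<length mu. mu ! l ! 0) = (of_int e / of_nat (mu ! i ! 0) :: rat)"
    and "(\<Prod>l<length mu. mu ! l ! 0) = mu ! i ! 0 * cofactor mu i"
    and "0 < mu ! i ! 0" and "0 < cofactor mu i"
proof -
  have pos: "0 < mu ! l ! 0" if "l < length mu" for l
    using assms(1,2) that unfolding positive_tuples_def
    by (metis length_greater_0_conv nth_mem)
  show p: "(\<Prod>l<length mu. mu ! l ! 0) = mu ! i ! 0 * cofactor mu i"
    unfolding cofactor_def using assms(3) by (subst prod.remove[of _ i]) auto
  show m: "0 < mu ! i ! 0"
    using pos assms(3) .
  show c: "0 < cofactor mu i"
    unfolding cofactor_def using pos by (intro prod_pos) auto
  show "of_int (e * int (cofactor mu i)) / of_nat (\<Prod>l<length mu. mu ! l ! 0) = (of_int e / of_nat (mu ! i ! 0) :: rat)"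
    unfolding p using m c by simp
qed

text \<open>In the inductive step \<open>a\<close> and \<open>b\<close> are multiples of their gcd,
  for which integrality is known by induction, and the new coordinates have denominators
  \<open>a\<close> and \<open>b\<close>.\<close>

lemma vertex_family_integral:
  assumes "vertex_family mu v" "positive_tuples mu" "i < length mu" "k < length (mu ! i)" "n < excess mu + 1"
  shows "of_nat (mu ! i ! k) * v i k n \<in> \<int>"
  using assms
proof (induction arbitrary: i k n rule: vertex_family.induct)
  case (base mu e v)
  have "k = 0"
    using base by auto
  moreover have "excess mu = 0"
    unfolding excess_def using base(1) by simp
  then have "n = 0"
    using base by simp
  moreover have "v i 0 0 = of_int (e i) / of_nat (mu ! i ! 0)"
    using base(3) base_vertex(1)[OF base(4,1,5)] base(5) by simp
  ultimately show ?case
    using base_vertex(3)[OF base(4,1,5)] by simp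
next
  case (step j mu ms a b v' \<alpha> \<beta> d v)
  let ?g = "gcd a b" and ?mu' = "mu[j := ms @ [gcd a b]]"
  note pos = positive_tuples_step[OF step(10) step(1,2)]
  have d: "d = excess ?mu' + 1"
    using excess_step[OF step(1,2)] step(5) by simp
  have IH: "of_nat (?mu' ! i ! k) * v' i k n \<in> \<int>" if "i < length mu" "k < length (?mu' ! i)" "n < d" for i k n
    using step.IH[OF pos(1)] that d by simp
  have last: "of_nat ?g * v' j (length ms) n \<in> \<int>" if "n < d" for n
    using IH[OF step(1), of "length ms" n] that step(1) by simp
  consider "i = j" "k = length ms" | "i = j" "k = Suc (length ms)" | "i \<noteq> j \<or> k < length ms"
    using step(2,12) by (cases "i = j") (auto simp: less_Suc_eq)
  then show ?case
  proof cases
    case 1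
    show ?thesis
    proof (cases "n = d")
      case True
      then show ?thesis
        using 1 step(2,6) pos(2) by simp
    next
      case False
      then have "n < d"
        using step(5,13) by simp
      obtain c where "a = ?g * c"
        by (meson gcd_dvd1 dvdE)
      then have eq: "of_nat a * v' j (length ms) n = of_nat c * (of_nat ?g * v' j (length ms) n)"
        by (metis (no_types, lifting) mult.assoc mult.commute of_nat_mult)
      have "of_nat a * v' j (length ms) n \<in> \<int>"
        unfolding eq by (intro Ints_mult last[OF \<open>n < d\<close>]) simp
      then show ?thesis
        using 1 False step(2,6) by simp
    qed
  next
    case 2
    show ?thesis
    proof (cases "n = d")
      case True
      then show ?thesis
        using 2 step(2,7) pos(3) by (simp add: nth_append)
    next
      case False
      then have "n < d"
        using step(5,13) by simp
      obtain c where "b = ?g * c"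
        by (meson gcd_dvd2 dvdE)
      then have eq: "of_nat b * v' j (length ms) n = of_nat c * (of_nat ?g * v' j (length ms) n)"
        by (metis (no_types, lifting) mult.assoc mult.commute of_nat_mult)
      have "of_nat b * v' j (length ms) n \<in> \<int>"
        unfolding eq by (intro Ints_mult last[OF \<open>n < d\<close>]) simp
      then show ?thesis
        using 2 False step(2,7) by (simp add: nth_append)
    qed
  next
    case 3
    then have v: "v i k = (v' i k)(d := 0)"
      using step(8,11,12) by blast
    show ?thesis
    proof (cases "n = d")
      case False
      then have "n < d"
        using step(5,13) by simp
      moreover have "k < length (?mu' ! i)" "?mu' ! i ! k = mu ! i ! k"
        using 3 step(1,2,12) by (cases "i = j"; auto simp: nth_append)+
      ultimately show ?thesis
        using IH[OF step(11), of k n] v False by simp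
    qed (simp add: v)
  qed
qed

text \<open>In the inductive step the new pair of values arises from the value for the gcd and the new
  coordinate of \<open>u\<close> by a matrix of determinant one.\<close>

lemma vertex_family_surjective:
  assumes "vertex_family mu v" "positive_tuples mu"
  shows "\<exists>a u. (\<forall>i<length mu. \<forall>k<length (mu ! i).
      of_nat (mu ! i ! k) * (of_int (a i) + pair_upto (excess mu + 1) u (v i k)) = of_int (t i k)) \<and>
    (\<Sum>i<length mu. a i) = N"
  using assms
proof (induction arbitrary: t N rule: vertex_family.induct)
  case (base mu e v)
  let ?m = "\<lambda>i. mu ! i ! 0" and ?c = "cofactor mu" and ?s = "length mu"
  define P where "P = int (\<Prod>l<?s. ?m l)"
  \<comment> \<open>This value is forced: add the required equations
    \<open>?m i * a i + e i * u = t i 0\<close> with the weights \<open>?c i\<close>, use that the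
    \<open>e i * ?c i\<close> add up to 1, and insert \<open>N\<close> for the sum of the
    \<open>a i\<close>.\<close>
  define u where "u = (\<Sum>i<?s. int (?c i) * t i 0) - P * N"
  have P: "P = int (?m i) * int (?c i)" "P > 0" if "i < ?s" for i
    using base_vertex(2-4)[OF base(4,1) that] unfolding P_def by simp_all
  \<comment> \<open>Modulo \<open>?m i\<close> all cofactors but the \<open>i\<close>-th vanish.
    Hence \<open>?c i * e i\<close> is congruent to 1 and \<open>u\<close> to
    \<open>?c i * t i 0\<close>, which makes \<open>e i * u\<close> congruent to
    \<open>t i 0\<close>.\<close>
  have dvd: "int (?m i) dvd t i 0 - e i * u" if i: "i < ?s" for i
  proof -
    have cof: "?m i dvd ?c l" if "l < ?s" "l \<noteq> i" for l
      unfolding cofactor_def using i that by (intro dvd_prodI) auto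
    have *: "int (?m i) dvd (\<Sum>l<?s. int (?c l) * f l) - int (?c i) * f i" for f
    proof -
      have eq: "(\<Sum>l<?s. int (?c l) * f l) - int (?c i) * f i = (\<Sum>l\<in>{..<?s} - {i}. int (?c l) * f l)"
        using i by (subst sum.remove[of _ i]) auto
      have dv: "int (?m i) dvd int (?c l) * f l" if "l \<in> {..<?s} - {i}" for l
        using cof[of l] that by (intro dvd_mult2) (simp add: int_dvd_int_iff)
      show ?thesis
        unfolding eq by (rule dvd_sum) (rule dv)
    qed
    have "int (?m i) dvd (1 - int (?c i) * e i)"
      using *[of e] base(2) by (simp add: mult.commute)
    moreover have "int (?m i) dvd (u - int (?c i) * t i 0)"
    proof -
      have "u - int (?c i) * t i 0 = ((\<Sum>l<?s. int (?c l) * t l 0) - int (?c i) * t i 0) - int (?m i) * (int (?c i) * N)"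
        unfolding u_def P(1)[OF i] by simp
      then show ?thesis
        using dvd_diff[OF *[of "\<lambda>l. t l 0"] dvd_triv_left[of "int (?m i)" "int (?c i) * N"]] by (simp only:)
    qed
    ultimately have "int (?m i) dvd (1 - int (?c i) * e i) * t i 0 - e i * (u - int (?c i) * t i 0)"
      by (rule dvd_diff[OF dvd_mult2 dvd_mult])
    moreover have "(1 - int (?c i) * e i) * t i 0 - e i * (u - int (?c i) * t i 0) = t i 0 - e i * u"
      by (simp add: algebra_simps)
    ultimately show ?thesis
      by (simp only:)
  qed
  define a where "a i = (t i 0 - e i * u) div int (?m i)" for i
  have a: "int (?m i) * a i = t i 0 - e i * u" if "i < ?s" for i
    unfolding a_def using dvd[OF that] by simp
  have "P * (\<Sum>i<?s. a i) = (\<Sum>i<?s. int (?c i) * (int (?m i) * a i))"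
    unfolding sum_distrib_left using P(1) by (intro sum.cong) auto
  also have "\<dots> = (\<Sum>i<?s. int (?c i) * t i 0 - (e i * int (?c i)) * u)"
    by (intro sum.cong refl, subst a) (auto simp: algebra_simps)
  also have "\<dots> = P * N"
    using base(2) unfolding sum_subtractf u_def by (simp flip: sum_distrib_right)
  finally have PN: "P * (\<Sum>i<?s. a i) = P * N" .
  have "0 < ?s"
    using base(2) by (cases "?s = 0") auto
  then have sum: "(\<Sum>i<?s. a i) = N"
    using PN P(2)[of 0] by simp
  have ex: "excess mu = 0"
    unfolding excess_def using base(1) by simp
  have "of_nat (?m i) * (of_int (a i) + pair_upto (excess mu + 1) (\<lambda>_. u) (v i 0)) = (of_int (t i 0) :: rat)"
    if i: "i < ?s" for i
  proof -
    have "pair_upto (excess mu + 1) (\<lambda>_. u) (v i 0) = of_int u * (of_int (e i) / of_nat (?m i))"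
      using base(3) i base_vertex(1)[OF base(4,1) i] unfolding ex pair_upto_def by simp
    then have "of_nat (?m i) * (of_int (a i) + pair_upto (excess mu + 1) (\<lambda>_. u) (v i 0))
        = (of_int (int (?m i) * a i + e i * u) :: rat)"
      using base_vertex(3)[OF base(4,1) i] by (simp add: field_simps)
    then show ?thesis
      using a[OF i] by simp
  qed
  then show ?case
    using sum base(1) by - (rule exI[of _ a], rule exI[of _ "\<lambda>_. u"], auto)
next
  case (step j mu ms a b v' \<alpha> \<beta> d v)
  let ?g = "gcd a b" and ?mu' = "mu[j := ms @ [gcd a b]]" and ?r = "length ms"
  note pos = positive_tuples_step[OF step(10) step(1,2)]
  have d: "d = excess ?mu' + 1"
    using excess_step[OF step(1,2)] step(5) by simp
  obtain a' b' where a': "a = ?g * a'" and b': "b = ?g * b'"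
    by (meson gcd_dvd1 gcd_dvd2 dvdE)
  have "int ?g * (\<alpha> * int a' + \<beta> * int b') = int ?g * 1"
  proof -
    have "int ?g * (\<alpha> * int a' + \<beta> * int b') = \<alpha> * int (?g * a') + \<beta> * int (?g * b')"
      by (simp add: algebra_simps)
    also have "\<dots> = int ?g"
      using step(4) a' b' by simp
    finally show ?thesis by simp
  qed
  then have det: "\<alpha> * int a' + \<beta> * int b' = 1"
    using pos(2) by simp
  \<comment> \<open>\<open>B\<close>, the value to be prescribed for the gcd, and the new coordinate
    \<open>w\<close> solve the system with rows \<open>(a', - \<beta>)\<close> and
    \<open>(b', \<alpha>)\<close> and right-hand sides the two wanted values; \<open>det\<close>
    says that its determinant is 1.\<close>
  define B where "B = \<alpha> * t j ?r + \<beta> * t j (Suc ?r)"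
  define w where "w = int a' * t j (Suc ?r) - int b' * t j ?r"
  have B1: "int a' * B - \<beta> * w = t j ?r"
  proof -
    have "int a' * B - \<beta> * w = (\<alpha> * int a' + \<beta> * int b') * t j ?r"
      unfolding B_def w_def by (simp add: algebra_simps)
    then show ?thesis using det by simp
  qed
  have B2: "int b' * B + \<alpha> * w = t j (Suc ?r)"
  proof -
    have "int b' * B + \<alpha> * w = (\<alpha> * int a' + \<beta> * int b') * t j (Suc ?r)"
      unfolding B_def w_def by (simp add: algebra_simps)
    then show ?thesis using det by simp
  qed
  define t' where "t' i k = (if i = j \<and> k = ?r then B else t i k)" for i k
  obtain x u where xu: "\<And>i k. i < length mu \<Longrightarrow> k < length (?mu' ! i) \<Longrightarrow>
      of_nat (?mu' ! i ! k) * (of_int (x i) + pair_upto d u (v' i k)) = of_int (t' i k)"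
    and sum: "(\<Sum>i<length mu. x i) = N"
    using step.IH[OF pos(1), of t' N] d by auto
  have gB: "of_nat ?g * (of_int (x j) + pair_upto d u (v' j ?r)) = of_int B"
    using xu[OF step(1), of ?r] step(1) unfolding t'_def by simp
  have ex: "excess mu + 1 = Suc d"
    using step(5) by simp
  have main: "of_nat (mu ! i ! k) * (of_int (x i) + pair_upto (excess mu + 1) (u(d := w)) (v i k)) = of_int (t i k)"
    if i: "i < length mu" and k: "k < length (mu ! i)" for i k
  proof -
    consider "i = j" "k = ?r" | "i = j" "k = Suc ?r" | "i \<noteq> j \<or> k < ?r"
      using step(2) k by (cases "i = j") (auto simp: less_Suc_eq)
    then show ?thesis
    proof cases
      case 1
      have eq1: "of_nat a * (of_int (x j) + pair_upto (Suc d) (u(d := w)) (v j ?r))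
          = of_nat a * (of_int (x j) + pair_upto d u (v' j ?r)) - of_int (\<beta> * w)"
        unfolding step(6) pair_upto_Suc using pos(2) by (simp add: field_simps)
      have eq2: "of_nat a * (of_int (x j) + pair_upto d u (v' j ?r)) = of_nat a' * of_int B"
        unfolding gB[symmetric] by (subst (1) a') (simp add: mult.commute mult.left_commute)
      have m: "mu ! j ! ?r = a"
        using step(2) by simp
      show ?thesis
        unfolding ex 1 m eq1 eq2 B1[symmetric] by simp
    next
      case 2
      have eq1: "of_nat b * (of_int (x j) + pair_upto (Suc d) (u(d := w)) (v j (Suc ?r)))
          = of_nat b * (of_int (x j) + pair_upto d u (v' j ?r)) + of_int (\<alpha> * w)"
      proof -
        have h: "of_nat b * (of_int w * (of_int \<alpha> / of_nat b)) = (of_int (\<alpha> * w) :: rat)"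
          using pos(3) by simp
        show ?thesis
          unfolding step(7) pair_upto_Suc add.assoc[symmetric]
            distrib_left[of "of_nat b" "of_int (x j) + pair_upto d u (v' j ?r)"] h ..
      qed
      have eq2: "of_nat b * (of_int (x j) + pair_upto d u (v' j ?r)) = of_nat b' * of_int B"
        unfolding gB[symmetric] by (subst (1) b') (simp add: mult.commute mult.left_commute)
      have m: "mu ! j ! Suc ?r = b"
        using step(2) by (simp add: nth_append)
      show ?thesis
        unfolding ex 2 m eq1 eq2 B2[symmetric] by simp
    next
      case 3
      then have v: "v i k = (v' i k)(d := 0)"
        using step(8) i k by blast
      have "k < length (?mu' ! i)" "?mu' ! i ! k = mu ! i ! k" "t' i k = t i k"
        using 3 step(1,2) k unfolding t'_def by (cases "i = j"; auto simp: nth_append)+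
      then show ?thesis
        using xu[OF i, of k] unfolding ex v pair_upto_Suc by simp
    qed
  qed
  show ?case
    by (rule exI[of _ x], rule exI[of _ "u(d := w)"], intro conjI allI impI main sum)
qed

section \<open>Rings of Laurent polynomials defined by monomial valuations\<close>

locale monomial_valuations =
  fixes I :: "'i set" and V :: "'i \<Rightarrow> 'a::field \<Rightarrow> int" and m :: "'i \<Rightarrow> int"
    and c :: "'i \<Rightarrow> (nat \<Rightarrow>\<^sub>0 int) \<Rightarrow> int" and n :: nat
  assumes V: "w \<in> I \<Longrightarrow> field_valuation (V w)"
    and m: "w \<in> I \<Longrightarrow> 0 \<le> m w"
    and c_add: "w \<in> I \<Longrightarrow> c w (u + u') = c w u + c w u'"
    and finite_values: "f \<noteq> 0 \<Longrightarrow> finite {w \<in> I. m w * V w f + c w u \<noteq> 0}"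
    and dual_monomials: "w \<in> I \<Longrightarrow> \<exists>f u. f \<noteq> 0 \<and> Poly_Mapping.keys u \<subseteq> {..<n} \<and>
      (\<forall>w'\<in>I. m w' * V w' f + c w' u = (if w' = w then 1 else 0))"
begin

definition valuation_ring :: "((nat \<Rightarrow>\<^sub>0 int) \<Rightarrow>\<^sub>0 'a) set"
  where "valuation_ring = {a \<in> laurent n. \<forall>w\<in>I. \<forall>u\<in>Poly_Mapping.keys a.
    0 \<le> m w * V w (Poly_Mapping.lookup a u) + c w u}"

abbreviation val :: "'i \<Rightarrow> ((nat \<Rightarrow>\<^sub>0 int) \<Rightarrow>\<^sub>0 'a) \<Rightarrow> int"
  where "val w \<equiv> field_valuation.monomial_val (V w) (m w) (c w)"

lemma valuation_ring_eq: "valuation_ring = {a \<in> laurent n. a = 0 \<or> (\<forall>w\<in>I. 0 \<le> val w a)}"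
proof -
  have "(\<forall>w\<in>I. \<forall>u\<in>Poly_Mapping.keys a. 0 \<le> m w * V w (Poly_Mapping.lookup a u) + c w u) \<longleftrightarrow>
      a = 0 \<or> (\<forall>w\<in>I. 0 \<le> val w a)" for a
  proof (cases "a = 0")
    case False
    then show ?thesis
      using field_valuation.monomial_val_ge_iff[OF V False, of _ 0] by simp
  qed simp
  then show ?thesis
    unfolding valuation_ring_def by simp
qed

lemma val_mult:
  assumes "w \<in> I" "a \<noteq> 0" "b \<noteq> 0"
  shows "val w (a * b) = val w a + val w b"
  using assms c_add by (intro field_valuation.monomial_val_mult V m) auto

lemma c_zero: "w \<in> I \<Longrightarrow> c w 0 = 0"
  using c_add[of w 0 0] by simp

lemma type_subring_valuation_ring: "type_subring valuation_ring"
proof -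
  interpret B: type_subring "laurent n :: ((nat \<Rightarrow>\<^sub>0 int) \<Rightarrow>\<^sub>0 'a) set"
    by (rule type_subring_laurent)
  show ?thesis
  proof
    have "val w 1 = 0" if "w \<in> I" for w
      using field_valuation.monomial_val_single[OF V[OF that], of 1 "m w" "c w" 0]
        field_valuation.one[OF V[OF that]] c_zero[OF that] by simp
    then show "1 \<in> valuation_ring"
      unfolding valuation_ring_eq by simp
  next
    fix a b assume a: "a \<in> valuation_ring" and b: "b \<in> valuation_ring"
    show "a * b \<in> valuation_ring"
      using a b val_mult[of _ a b] unfolding valuation_ring_eq
      by (cases "a = 0 \<or> b = 0") auto
    have "0 \<le> m w * V w (Poly_Mapping.lookup (a - b) u) + c w u"
      if w: "w \<in> I" and u: "u \<in> Poly_Mapping.keys (a - b)" for w u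
    proof -
      interpret Vw: field_valuation "V w"
        by (rule V[OF w])
      have "Poly_Mapping.lookup x u \<in> Vw.bounded_below (m w) (- c w u)" if "x \<in> valuation_ring" for x
        using that w unfolding valuation_ring_def Vw.bounded_below_def
        by (cases "u \<in> Poly_Mapping.keys x") (force simp: in_keys_iff)+
      from Vw.diff_bounded_below[OF m[OF w] this[OF a] this[OF b]]
      show ?thesis
        using u unfolding Vw.bounded_below_def by (simp add: lookup_minus in_keys_iff)
    qed
    then show "a - b \<in> valuation_ring"
      using a b B.diff_mem unfolding valuation_ring_def by blast
  qed
qed

theorem factorial_valuation_ring: "factorial_subring valuation_ring"
proof (rule type_subring.factorial_valuation_subring[where A = "laurent n" and I = I and \<nu> = val])
  show "type_subring (laurent n :: ((nat \<Rightarrow>\<^sub>0 int) \<Rightarrow>\<^sub>0 'a) set)"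
    by (rule type_subring_laurent)
  show "factorial_subring (laurent n :: ((nat \<Rightarrow>\<^sub>0 int) \<Rightarrow>\<^sub>0 'a) set)"
    by (rule factorial_laurent)
  show "val w (a * b) = val w a + val w b" if "w \<in> I" "a \<noteq> 0" "b \<noteq> 0" for w a b
    using val_mult[OF that] .
  show "finite {w \<in> I. val w a \<noteq> 0}" if a: "a \<noteq> 0" for a
  proof (rule finite_subset)
    show "{w \<in> I. val w a \<noteq> 0} \<subseteq>
        (\<Union>u\<in>Poly_Mapping.keys a. {w \<in> I. m w * V w (Poly_Mapping.lookup a u) + c w u \<noteq> 0})"
      using field_valuation.monomial_val_eq_zero[OF V a] by blast
    show "finite (\<Union>u\<in>Poly_Mapping.keys a. {w \<in> I. m w * V w (Poly_Mapping.lookup a u) + c w u \<noteq> 0})"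
      using finite_values by (intro finite_UN_I) (auto simp: in_keys_iff)
  qed
  show "\<exists>p\<in>laurent n. \<exists>q\<in>laurent n. p * q = 1 \<and> (\<forall>w'\<in>I. val w' p = (if w' = w then 1 else 0))"
    if w: "w \<in> I" for w
  proof -
    obtain f u where fu: "f \<noteq> 0" "Poly_Mapping.keys u \<subseteq> {..<n}"
      "\<forall>w'\<in>I. m w' * V w' f + c w' u = (if w' = w then 1 else 0)"
      using dual_monomials[OF w] by blast
    let ?p = "Poly_Mapping.single u f" and ?q = "Poly_Mapping.single (- u) (inverse f)"
    have "?p \<in> laurent n" "?q \<in> laurent n"
      using fu(2) by (auto intro!: single_mem_laurent)
    moreover have "?p * ?q = 1"
      using fu(1) by (simp add: mult_single)
    moreover have "val w' ?p = (if w' = w then 1 else 0)" if "w' \<in> I" for w'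
    proof -
      have "val w' ?p = m w' * V w' f + c w' u"
        by (rule field_valuation.monomial_val_single[OF V[OF that] fu(1)])
      also have "\<dots> = (if w' = w then 1 else 0)"
        using fu(3) that by blast
      finally show ?thesis .
    qed
    ultimately show ?thesis
      by blast
  qed
  show "valuation_ring = {x \<in> laurent n. x = 0 \<or> (\<forall>w\<in>I. 0 \<le> val w x)}"
    by (rule valuation_ring_eq)
  show "type_subring valuation_ring"
    by (rule type_subring_valuation_ring)
qed

end

section \<open>The ring of the polyhedral divisor\<close>

locale polyhedral_scheme = degree_scheme Y \<delta> for Y :: "('k::field, 'K::field) proj_scheme" and \<delta> +
  fixes Z :: "('k point \<times> nat list) list" and v :: "nat \<Rightarrow> nat \<Rightarrow> vec"
  assumes distinct: "distinct (map fst Z)"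
    and prime: "i < length Z \<Longrightarrow> fst (Z ! i) \<in> PD" "i < length Z \<Longrightarrow> dg (prime_divisor (fst (Z ! i))) = 1"
    and positive: "positive_tuples (map snd Z)"
    and vertices: "vertex_family (map snd Z) v"
begin

abbreviation mu :: "nat list list" where "mu \<equiv> map snd Z"
abbreviation rank :: nat where "rank \<equiv> excess mu + 1"
abbreviation D :: "nat \<Rightarrow> 'k point" where "D i \<equiv> fst (Z ! i)"

lemma D_eq_iff: "i < length Z \<Longrightarrow> j < length Z \<Longrightarrow> D i = D j \<longleftrightarrow> i = j"
  using nth_eq_iff_index_eq[OF distinct, of i j] by simp

lemma mu_pos: "i < length Z \<Longrightarrow> k < length (mu ! i) \<Longrightarrow> 0 < mu ! i ! k"
  using positive unfolding positive_tuples_def by (metis length_map nth_mem)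

lemma mu_nonempty: "i < length Z \<Longrightarrow> mu ! i \<noteq> []"
  using positive unfolding positive_tuples_def by (metis length_map nth_mem)

section \<open>Linear forms on the polyhedra and the values of the polyhedral divisor\<close>

lemma pairing_eq_pair_upto:
  assumes "Poly_Mapping.keys u \<subseteq> {..<d}"
  shows "pairing u x = pair_upto d (Poly_Mapping.lookup u) x"
  unfolding pairing_def pair_upto_def using assms
  by (intro sum.mono_neutral_left) (auto simp: in_keys_iff)

lemma pairing_add: "pairing u (\<lambda>n. x n + y n) = pairing u x + pairing u y"
  unfolding pairing_def by (simp add: distrib_left sum.distrib)

lemma pairing_sum: "pairing u (\<lambda>n. \<Sum>g\<in>F. c g * h g n) = (\<Sum>g\<in>F. c g * pairing u (h g))"
  unfolding pairing_def sum_distrib_left by (subst sum.swap) (simp add: ac_simps)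

lemma zero_mem_tail_cone: "(\<lambda>n. 0) \<in> tail_cone mu v"
  unfolding tail_cone_def cone_over_def by (intro CollectI exI[of _ "{}"]) simp

definition least_value :: "(nat \<Rightarrow>\<^sub>0 int) \<Rightarrow> nat \<Rightarrow> rat"
  where "least_value u i = (LEAST t. t \<in> pairing u ` coefficient_polyhedron mu v i)"

text \<open>A weight is non-negative on the tail cone, so the minimum is that on the convex hull,
  where it is attained at a vertex. In particular \<open>LEAST\<close> picks an existing
  element.\<close>

lemma least_value:
  assumes i: "i < length Z" and u: "u \<in> weights mu v"
  shows "\<exists>k<length (mu ! i). least_value u i = pairing u (v i k)"
    and "k < length (mu ! i) \<Longrightarrow> least_value u i \<le> pairing u (v i k)"
proof -
  let ?P = "(\<lambda>k. pairing u (v i k)) ` {..<length (mu ! i)}"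
  have fin: "finite ?P" "?P \<noteq> {}"
    using mu_nonempty[OF i] by (auto simp: lessThan_empty_iff)
  obtain k0 where k0: "k0 < length (mu ! i)" "Min ?P = pairing u (v i k0)"
    using Min_in[OF fin] by auto
  have min: "Min ?P \<le> pairing u (v i k)" if "k < length (mu ! i)" for k
    using that fin by (intro Min_le) auto
  have "least_value u i = Min ?P"
    unfolding least_value_def
  proof (rule Least_equality)
    have "v i k0 \<in> rational_convex_hull (v i ` {..<length (mu ! i)})"
      unfolding rational_convex_hull_def using k0(1)
      by (intro CollectI exI[of _ "{v i k0}"] exI[of _ "\<lambda>_. 1"]) auto
    then have "(\<lambda>n. v i k0 n + 0) \<in> coefficient_polyhedron mu v i"
      unfolding coefficient_polyhedron_def using zero_mem_tail_cone
      by - (rule CollectI, rule exI[of _ "v i k0"], rule exI[of _ "\<lambda>n. 0"], intro conjI refl)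
    then show "Min ?P \<in> pairing u ` coefficient_polyhedron mu v i"
      unfolding k0(2) by simp
    fix t assume "t \<in> pairing u ` coefficient_polyhedron mu v i"
    then obtain x y where xy: "x \<in> rational_convex_hull (v i ` {..<length (mu ! i)})" "y \<in> tail_cone mu v"
      "t = pairing u (\<lambda>n. x n + y n)"
      unfolding coefficient_polyhedron_def by blast
    obtain F c where F: "finite F" "F \<subseteq> v i ` {..<length (mu ! i)}" "\<forall>g\<in>F. 0 \<le> c g" "sum c F = 1"
      "x = (\<lambda>n. \<Sum>g\<in>F. c g * g n)"
      using xy(1) unfolding rational_convex_hull_def by blast
    have "Min ?P = (\<Sum>g\<in>F. c g * Min ?P)"
      using F(4) by (simp flip: sum_distrib_right)
    also have "\<dots> \<le> (\<Sum>g\<in>F. c g * pairing u g)"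
      using F(2,3) min by (intro sum_mono mult_left_mono) auto
    also have "\<dots> = pairing u x"
      unfolding F(5) pairing_sum ..
    also have "\<dots> \<le> t"
      using u xy(2) unfolding xy(3) pairing_add weights_def by simp
    finally show "Min ?P \<le> t" .
  qed
  then show "\<exists>k<length (mu ! i). least_value u i = pairing u (v i k)"
    "k < length (mu ! i) \<Longrightarrow> least_value u i \<le> pairing u (v i k)"
    using k0 min by auto
qed

lemma polyhedral_eval_at:
  "polyhedral_eval Z v u W = (\<Sum>i<length Z. if W = D i then least_value u i else 0)"
  unfolding polyhedral_eval_def least_value_def by (intro sum.cong) simp_all

lemma polyhedral_eval_divisor:
  assumes "i < length Z"
  shows "polyhedral_eval Z v u (D i) = least_value u i"
proof -
  have "polyhedral_eval Z v u (D i) = (\<Sum>j<length Z. if j = i then least_value u j else 0)"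
    unfolding polyhedral_eval_at using D_eq_iff assms by (intro sum.cong) auto
  then show ?thesis
    using assms by simp
qed

lemma polyhedral_eval_other: "W \<notin> D ` {..<length Z} \<Longrightarrow> polyhedral_eval Z v u W = 0"
  unfolding polyhedral_eval_at by (intro sum.neutral) auto

text \<open>The minimum over a polyhedron is replaced by a condition at each vertex. This makes
  sense for every \<open>u\<close>, in the dual cone or not, and reads as non-negativity of the
  valuations.\<close>

definition admissible :: "(nat \<Rightarrow>\<^sub>0 int) \<Rightarrow> 'K \<Rightarrow> bool"
  where "admissible u f \<longleftrightarrow> (\<forall>W\<in>PD - D ` {..<length Z}. 0 \<le> ord_at Y W f) \<and>
    (\<forall>i<length Z. \<forall>k<length (mu ! i). 0 \<le> of_int (ord_at Y (D i) f) + pairing u (v i k))"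

lemma floor_nonneg_iff: "0 \<le> z + \<lfloor>x\<rfloor> \<longleftrightarrow> 0 \<le> of_int z + x" for x :: rat
  by linarith

text \<open>The weight condition is the non-negativity of the degree of a divisor with a section.\<close>

lemma weights_if_admissible:
  assumes u: "Poly_Mapping.keys u \<subseteq> {..<rank}" and f: "f \<noteq> 0" "admissible u f"
  shows "u \<in> weights mu v"
proof -
  have ray: "0 \<le> pairing u (\<lambda>n. \<Sum>i<length mu. v i (\<kappa> i) n)"
    if \<kappa>: "\<forall>i<length mu. \<kappa> i < length (mu ! i)" for \<kappa>
  proof -
    \<comment> \<open>A ray of the tail cone is a choice of one vertex for each \<open>i\<close>.
      For this choice \<open>f\<close> is a section of the rounded divisor \<open>E\<close>, and the
      degree of \<open>E\<close> is at most the pairing of \<open>u\<close> with the ray.\<close>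
    define E where "E = (\<lambda>W. \<Sum>i<length Z. \<lfloor>pairing u (v i (\<kappa> i))\<rfloor> * prime_divisor (D i) W)"
    have P: "prime_divisor (D i) \<in> Dv" if "i < length Z" for i
      using prime(1)[OF that] by (rule Dv_prime)
    have E: "E \<in> Dv"
      unfolding E_def using P by (intro Dv_sum Dv_scale) auto
    have "dg E = (\<Sum>i<length Z. \<lfloor>pairing u (v i (\<kappa> i))\<rfloor>)"
      unfolding E_def using P prime(2) by (subst dg_sum) (auto simp: Dv_scale dg_scale)
    moreover have "0 \<le> ord_at Y W f + E W" if W: "W \<in> PD" for W
    proof (cases "W \<in> D ` {..<length Z}")
      case True
      then obtain i where i: "i < length Z" "W = D i"
        by blast
      have "E W = (\<Sum>j<length Z. if j = i then \<lfloor>pairing u (v j (\<kappa> j))\<rfloor> else 0)"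
        unfolding E_def prime_divisor_def i(2) using D_eq_iff i(1) by (intro sum.cong) auto
      then have "E W = \<lfloor>pairing u (v i (\<kappa> i))\<rfloor>"
        using i(1) by simp
      moreover have "0 \<le> of_int (ord_at Y (D i) f) + pairing u (v i (\<kappa> i))"
        using f(2) i(1) \<kappa> unfolding admissible_def by simp
      ultimately show ?thesis
        unfolding i(2) by (simp only: floor_nonneg_iff)
    next
      case False
      then have "E W = 0"
        unfolding E_def prime_divisor_def by (intro sum.neutral) auto
      then show ?thesis
        using f(2) W False unfolding admissible_def by simp
    qed
    then have "f \<in> gs E"
      using f(1) by (simp add: gs_iff)
    then have "0 \<le> dg E"
      using dg_nonneg_if_section(1)[OF E _ f(1)] by blast
    ultimately have "0 \<le> (\<Sum>i<length Z. \<lfloor>pairing u (v i (\<kappa> i))\<rfloor>)"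
      by simp
    then have "0 \<le> (\<Sum>i<length Z. of_int \<lfloor>pairing u (v i (\<kappa> i))\<rfloor> :: rat)"
      by (simp flip: of_int_sum)
    also have "\<dots> \<le> (\<Sum>i<length Z. pairing u (v i (\<kappa> i)))"
      by (intro sum_mono of_int_floor_le)
    also have "\<dots> = pairing u (\<lambda>n. \<Sum>i<length mu. v i (\<kappa> i) n)"
      using pairing_sum[of u "\<lambda>_. 1" "\<lambda>i. v i (\<kappa> i)" "{..<length mu}"] by simp
    finally show ?thesis .
  qed
  have "0 \<le> pairing u x" if x: "x \<in> tail_cone mu v" for x
  proof -
    obtain F c where F: "F \<subseteq> {\<lambda>n. \<Sum>i<length mu. v i (\<kappa> i) n | \<kappa>. \<forall>i<length mu. \<kappa> i < length (mu ! i)}"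
      "\<forall>g\<in>F. 0 \<le> c g" "x = (\<lambda>n. \<Sum>g\<in>F. c g * g n)"
      using x unfolding tail_cone_def cone_over_def by blast
    have "0 \<le> c g * pairing u g" if "g \<in> F" for g
      using F(1,2) that ray by (intro mult_nonneg_nonneg) blast+
    then show ?thesis
      unfolding F(3) pairing_sum by (rule sum_nonneg)
  qed
  then show ?thesis
    using u unfolding weights_def by blast
qed

lemma section_iff_admissible:
  assumes u: "u \<in> weights mu v" and f: "f \<noteq> 0"
  shows "f \<in> gs (\<lambda>W. \<lfloor>polyhedral_eval Z v u W\<rfloor>) \<longleftrightarrow> admissible u f"
proof -
  have at: "0 \<le> ord_at Y (D i) f + \<lfloor>polyhedral_eval Z v u (D i)\<rfloor> \<longleftrightarrow>
      (\<forall>k<length (mu ! i). 0 \<le> of_int (ord_at Y (D i) f) + pairing u (v i k))" if i: "i < length Z" for i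
  proof -
    obtain k0 where k0: "k0 < length (mu ! i)" "least_value u i = pairing u (v i k0)"
      using least_value(1)[OF i u] by blast
    show ?thesis
      unfolding polyhedral_eval_divisor[OF i] floor_nonneg_iff
    proof (intro iffI allI impI)
      fix k assume "0 \<le> of_int (ord_at Y (D i) f) + least_value u i" "k < length (mu ! i)"
      then show "0 \<le> of_int (ord_at Y (D i) f) + pairing u (v i k)"
        using least_value(2)[OF i u, of k] by linarith
    next
      assume "\<forall>k<length (mu ! i). 0 \<le> of_int (ord_at Y (D i) f) + pairing u (v i k)"
      then show "0 \<le> of_int (ord_at Y (D i) f) + least_value u i"
        using k0 by simp
    qed
  qed
  have "f \<in> gs (\<lambda>W. \<lfloor>polyhedral_eval Z v u W\<rfloor>) \<longleftrightarrow>
      (\<forall>W\<in>PD - D ` {..<length Z}. 0 \<le> ord_at Y W f + \<lfloor>polyhedral_eval Z v u W\<rfloor>) \<and>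
      (\<forall>i<length Z. 0 \<le> ord_at Y (D i) f + \<lfloor>polyhedral_eval Z v u (D i)\<rfloor>)"
    unfolding gs_iff[OF f] using prime(1) by blast
  then show ?thesis
    unfolding admissible_def using at polyhedral_eval_other by simp
qed

lemma polyhedral_ring_eq:
  "polyhedral_ring Y Z v = {a \<in> laurent rank. \<forall>u\<in>Poly_Mapping.keys a. admissible u (Poly_Mapping.lookup a u)}"
proof -
  have keys: "Poly_Mapping.keys u \<subseteq> {..<rank}" if "u \<in> weights mu v" for u
    using that unfolding weights_def by blast
  have "u \<in> weights mu v \<and> f \<in> gs (\<lambda>W. \<lfloor>polyhedral_eval Z v u W\<rfloor>) \<longleftrightarrow>
      Poly_Mapping.keys u \<subseteq> {..<rank} \<and> admissible u f" if "f \<noteq> 0" for u f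
    using weights_if_admissible[OF _ that] section_iff_admissible[OF _ that] keys by blast
  then show ?thesis
    unfolding polyhedral_ring_def laurent_def by (auto simp: in_keys_iff)
qed

text \<open>The normalized valuations: \<open>Inl W\<close> for the prime divisors outside \<open>Z\<close>, and \<open>Inr (i, k)\<close> for
  $\mu_{ik}$ times the valuation defined by the vertex $v_{ik}$.\<close>

definition index_set :: "('k point + nat \<times> nat) set"
  where "index_set = Inl ` (PD - D ` {..<length Z}) \<union> Inr ` (SIGMA i:{..<length Z}. {..<length (mu ! i)})"

text \<open>The floor is only a change of type: for indices in range the product is an integer by
  \<open>vertex_family_integral\<close>.\<close>

definition ivertex :: "nat \<Rightarrow> nat \<Rightarrow> nat \<Rightarrow> int"
  where "ivertex i k n = \<lfloor>of_nat (mu ! i ! k) * v i k n\<rfloor>"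

primrec index_val :: "'k point + nat \<times> nat \<Rightarrow> 'K \<Rightarrow> int"
  where "index_val (Inl W) = ord_at Y W" | "index_val (Inr p) = ord_at Y (D (fst p))"

primrec index_mult :: "'k point + nat \<times> nat \<Rightarrow> int"
  where "index_mult (Inl W) = 1" | "index_mult (Inr p) = int (mu ! fst p ! snd p)"

primrec index_form :: "'k point + nat \<times> nat \<Rightarrow> (nat \<Rightarrow>\<^sub>0 int) \<Rightarrow> int"
  where "index_form (Inl W) = (\<lambda>u. 0)"
  | "index_form (Inr p) = (\<lambda>u. \<Sum>n<rank. Poly_Mapping.lookup u n * ivertex (fst p) (snd p) n)"

lemma index_value:
  assumes "i < length Z" "k < length (mu ! i)"
  shows "of_int (index_mult (Inr (i, k)) * index_val (Inr (i, k)) f + index_form (Inr (i, k)) u)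
    = of_nat (mu ! i ! k) * (of_int (ord_at Y (D i) f) + pair_upto rank (Poly_Mapping.lookup u) (v i k))"
proof -
  have "of_int (ivertex i k n) = of_nat (mu ! i ! k) * v i k n" if "n < rank" for n
    unfolding ivertex_def using vertex_family_integral[OF vertices positive, of i k n] assms that by simp
  then have "of_int (index_form (Inr (i, k)) u) = of_nat (mu ! i ! k) * pair_upto rank (Poly_Mapping.lookup u) (v i k)"
    unfolding pair_upto_def sum_distrib_left by (simp add: ac_simps)
  then show ?thesis
    by (simp add: distrib_left)
qed

sublocale monomial_valuations index_set index_val index_mult index_form rank
proof (rule monomial_valuations.intro)
  show "field_valuation (index_val w)" if "w \<in> index_set" for w
    using that unfolding index_set_def by (auto intro!: field_valuation_ord prime(1))
  show "0 \<le> index_mult w" if "w \<in> index_set" for w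
    by (cases w) simp_all
  show "index_form w (u + u') = index_form w u + index_form w u'" if "w \<in> index_set" for w u u'
    by (cases w) (simp_all add: lookup_add distrib_right sum.distrib)
  show "finite {w \<in> index_set. index_mult w * index_val w f + index_form w u \<noteq> 0}" if f: "f \<noteq> 0" for f u
  proof (rule finite_subset)
    show "{w \<in> index_set. index_mult w * index_val w f + index_form w u \<noteq> 0} \<subseteq>
        Inl ` {W \<in> PD. ord_at Y W f \<noteq> 0} \<union> Inr ` (SIGMA i:{..<length Z}. {..<length (mu ! i)})"
      unfolding index_set_def by auto
    show "finite (Inl ` {W \<in> PD. ord_at Y W f \<noteq> 0} \<union> Inr ` (SIGMA i:{..<length Z}. {..<length (mu ! i)}))"
      using finite_support[OF f] by (intro finite_UnI finite_imageI finite_SigmaI) auto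
  qed
  show "\<exists>f u. f \<noteq> 0 \<and> Poly_Mapping.keys u \<subseteq> {..<rank} \<and>
      (\<forall>w'\<in>index_set. index_mult w' * index_val w' f + index_form w' u = (if w' = w then 1 else 0))"
    if w: "w \<in> index_set" for w
  proof -
    \<comment> \<open>The wanted values at the vertices are \<open>t\<close>, the wanted orders
      along the remaining prime divisors are \<open>b\<close>. According to the kind of
      \<open>w\<close>, one of them has a single 1 and the other is 0.\<close>
    define t where "t i k = (if w = Inr (i, k) then 1 else 0 :: int)" for i k
    define b where "b W = (if w = Inl W then 1 else 0 :: int)" for W
    have b: "b \<in> Dv"
    proof -
      have "{W. b W \<noteq> 0} \<subseteq> (case w of Inl W \<Rightarrow> {W} | Inr p \<Rightarrow> {})"
        unfolding b_def by (cases w) auto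
      moreover have "finite (case w of Inl W \<Rightarrow> {W} | Inr p \<Rightarrow> {})" "(case w of Inl W \<Rightarrow> {W} | Inr p \<Rightarrow> {}) \<subseteq> PD"
        using w unfolding index_set_def by (auto split: sum.splits)
      ultimately show ?thesis
        unfolding Dv_iff by (meson finite_subset subset_trans)
    qed
    \<comment> \<open>The divisors in \<open>Z\<close> have degree 1, so their multiplicities must
      add up to \<open>- dg b\<close> for the divisor \<open>E\<close> below to have degree 0 and
      hence to be principal.\<close>
    obtain a u0 where au: "\<And>i k. i < length Z \<Longrightarrow> k < length (mu ! i) \<Longrightarrow>
        of_nat (mu ! i ! k) * (of_int (a i) + pair_upto rank u0 (v i k)) = of_int (t i k)"
      and sum: "(\<Sum>i<length Z. a i) = - dg b"
      using vertex_family_surjective[OF vertices positive, of t "- dg b"] by auto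
    define u where "u = (\<Sum>n<rank. Poly_Mapping.single n (u0 n))"
    have lookup_u: "Poly_Mapping.lookup u n = (if n < rank then u0 n else 0)" for n
      unfolding u_def lookup_sum lookup_single when_def by simp
    have keys_u: "Poly_Mapping.keys u \<subseteq> {..<rank}"
      by (auto simp: in_keys_iff lookup_u split: if_splits)
    have pu: "pair_upto rank (Poly_Mapping.lookup u) x = pair_upto rank u0 x" for x
      unfolding pair_upto_def by (intro sum.cong) (simp_all add: lookup_u)
    define E where "E = (\<lambda>W. b W + (\<Sum>i<length Z. a i * prime_divisor (D i) W))"
    have P: "prime_divisor (D i) \<in> Dv" if "i < length Z" for i
      using prime(1)[OF that] by (rule Dv_prime)
    have S: "(\<lambda>W. \<Sum>i<length Z. a i * prime_divisor (D i) W) \<in> Dv"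
      using P by (intro Dv_sum Dv_scale) auto
    have "dg (\<lambda>W. \<Sum>i<length Z. a i * prime_divisor (D i) W) = (\<Sum>i<length Z. a i)"
      using P prime(2) by (subst dg_sum) (auto simp: Dv_scale dg_scale)
    then have "dg E = 0"
      unfolding E_def using dg_add[OF b S] sum by simp
    then obtain f where f: "f \<noteq> 0" "div_of Y f = E"
      using principal_if_dg_zero[OF Dv_add[OF b S]] unfolding E_def by blast
    have ord: "ord_at Y W f = E W" if "W \<in> PD" for W
      using fun_cong[OF f(2), of W] that unfolding div_of_def by simp
    have "index_mult w' * index_val w' f + index_form w' u = (if w' = w then 1 else 0)"
      if w': "w' \<in> index_set" for w'
    proof (cases w')
      case (Inl W)
      then have W: "W \<in> PD" "W \<notin> D ` {..<length Z}"
        using w' unfolding index_set_def by auto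
      then have "E W = b W"
        unfolding E_def prime_divisor_def by (auto intro!: sum.neutral)
      then show ?thesis
        using ord[OF W(1)] Inl unfolding b_def by auto
    next
      case (Inr p)
      then obtain i k where ik: "i < length Z" "k < length (mu ! i)" "w' = Inr (i, k)"
        using w' unfolding index_set_def by auto
      have "b (D i) = 0"
        using w ik(1) unfolding b_def index_set_def by auto
      moreover have "(\<Sum>j<length Z. a j * prime_divisor (D j) (D i)) = (\<Sum>j<length Z. if j = i then a j else 0)"
        unfolding prime_divisor_def using D_eq_iff ik(1) by (intro sum.cong) auto
      ultimately have "ord_at Y (D i) f = a i"
        using ord[OF prime(1)[OF ik(1)]] ik(1) unfolding E_def by simp
      then have "of_int (index_mult w' * index_val w' f + index_form w' u) = (of_int (t i k) :: rat)"
        unfolding ik(3) index_value[OF ik(1,2)] pu using au[OF ik(1,2)] by simp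
      then have "index_mult w' * index_val w' f + index_form w' u = t i k"
        by (simp only: of_int_eq_iff)
      then show ?thesis
        unfolding t_def ik(3) by auto
    qed
    then show ?thesis
      using f(1) keys_u by blast
  qed
qed

text \<open>Scaling by the positive number \<open>mu ! i ! k\<close> does not affect signs; it only
  makes the values at the vertices integral.\<close>

lemma polyhedral_ring_eq_valuation_ring: "polyhedral_ring Y Z v = valuation_ring"
proof -
  have "admissible u f \<longleftrightarrow> (\<forall>w\<in>index_set. 0 \<le> index_mult w * index_val w f + index_form w u)"
    if u: "Poly_Mapping.keys u \<subseteq> {..<rank}" for u f
  proof -
    have "0 \<le> index_mult (Inr (i, k)) * index_val (Inr (i, k)) f + index_form (Inr (i, k)) u \<longleftrightarrow>
        0 \<le> of_int (ord_at Y (D i) f) + pairing u (v i k)" if "i < length Z" "k < length (mu ! i)" for i k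
    proof -
      have "0 \<le> index_mult (Inr (i, k)) * index_val (Inr (i, k)) f + index_form (Inr (i, k)) u \<longleftrightarrow>
          (0::rat) \<le> of_int (index_mult (Inr (i, k)) * index_val (Inr (i, k)) f + index_form (Inr (i, k)) u)"
        by (simp only: of_int_0_le_iff)
      also have "\<dots> \<longleftrightarrow> 0 \<le> of_int (ord_at Y (D i) f) + pairing u (v i k)"
        unfolding index_value[OF that] pairing_eq_pair_upto[OF u] using mu_pos[OF that]
        by (simp add: zero_le_mult_iff)
      finally show ?thesis .
    qed
    then show ?thesis
      unfolding admissible_def index_set_def ball_Un by auto
  qed
  then show ?thesis
    unfolding polyhedral_ring_eq valuation_ring_def laurent_def by auto
qed

theorem polyhedral_ring_normal_factorial:
  "normal_subring ((\<lambda>a. Fract a 1) ` polyhedral_ring Y Z v) \<and>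
    factorial_domain (subring_of_type (polyhedral_ring Y Z v))"
  unfolding polyhedral_ring_eq_valuation_ring
  using type_subring.normal_subring_if_factorial[OF type_subring_valuation_ring factorial_valuation_ring]
    type_subring.factorial_domain_if_factorial[OF type_subring_valuation_ring factorial_valuation_ring]
  by blast

end

theorem theorem6p2:
  fixes Y :: "('k::{alg_closed_field, field_char_0}, 'K::field) proj_scheme"
    and \<delta> :: "('k point \<Rightarrow> int) set \<Rightarrow> int"
    and Z :: "('k point \<times> nat list) list"
    and v :: "nat \<Rightarrow> nat \<Rightarrow> vec"
  assumes "normal_projective_variety Y"
    and "degree_map Y \<delta>"
    and "distinct (map fst Z)"
    and "\<forall>(D, \<mu>) \<in> set Z. D \<in> prime_divisors Y \<and> \<delta> (divisor_class Y (prime_divisor D)) = 1"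
    and "\<forall>(D, \<mu>) \<in> set Z. \<mu> \<noteq> [] \<and> (\<forall>m\<in>set \<mu>. m > 0)"
    and "\<forall>i<length Z. \<forall>j<length Z. i \<noteq> j \<longrightarrow>
      coprime (Gcd (set (snd (Z ! i)))) (Gcd (set (snd (Z ! j))))"
    and "vertex_family (map snd Z) v"
  shows "normal_subring ((\<lambda>a. Fract a 1) ` polyhedral_ring Y Z v) \<and>
    factorial_domain (subring_of_type (polyhedral_ring Y Z v))"
proof -
  interpret degree_scheme Y \<delta>
    using assms(1,2) unfolding normal_projective_variety_def by unfold_locales auto
  interpret polyhedral_scheme Y \<delta> Z v
  proof
    show "distinct (map fst Z)" "vertex_family (map snd Z) v"
      by fact+
    show "fst (Z ! i) \<in> prime_divisors Y" "dg (prime_divisor (fst (Z ! i))) = 1" if "i < length Z" for i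
      using assms(4) nth_mem[OF that] unfolding dg_def by (auto simp: case_prod_beta)
    show "positive_tuples (map snd Z)"
      using assms(5) unfolding positive_tuples_def by auto
  qed
  show ?thesis
    by (rule polyhedral_ring_normal_factorial)
qed

end
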